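(* Under the Main Assumptions and the controllability assumption (both listed in the context), for every $(w,z)\in\{-1,1\}^2$ and every $(x,y)\in\overline B_{(w,z)}$, $$\underline V(x,y,w,z)=\inf_{\gamma\in\Gamma}\sup_{\beta\in\mathcal B}\left(\int_0^{\tau}e^{-\lambda s}\ell\big(X(s),Y(s),w,z,\gamma[\beta](s),\beta(s)\big)ds+e^{-\lambda\tau}\underline V\big(X(\tau),Y(\tau),(w,z)^+\big)\right),$$ $$\overline V(x,y,w,z)=\sup_{\xi\in\Xi}\inf_{\alpha\in\mathcal A}\left(\int_0^{\tau}e^{-\lambda s}\ell\big(X(s),Y(s),w,z,\alpha(s),\xi[\alpha](s)\big)ds+e^{-\lambda\tau}\overline V\big(X(\tau),Y(\tau),(w,z)^+\big)\right).$$ Here, in the first formula, $X$ is the trajectory from $(x,w)$ with control $\gamma[\beta]$ and $Y$ the trajectory from $(y,z)$ with control $\beta$; in the second, $X$ is the trajectory from $(x,w)$ with control $\alpha$ and $Y$ the trajectory from $(y,z)$ with control $\xi[\alpha]$. In both cases $\tau=\min\{\tau_X,\tau_Y\}$ is the first switching instant, where $\tau_X$ (resp. $\tau_Y$) is the first switching instant of $X$ (resp. of $Y$), and $(w,z)^+$ is the first switched label: $$(w,z)^+=\begin{cases}(-w,z)&\text{if }\tau=\tau_X<\tau_Y,\\(-w,-z)&\text{if }\tau=\tau_X=\tau_Y,\\(w,-z)&\text{if }\tau=\tau_Y<\tau_X.\end{cases}$$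
   Context: **Sectors.** Fix reals $\rho_{-1}<\rho_1$ and $\eta_{-1}<\eta_1$ (switching thresholds). Let $x\cdot e_1$, $y\cdot e_1$ denote first coordinates of $x\in\mathbb{R}^n$, $y\in\mathbb{R}^m$. Set $\Omega_X^{1}=\{x: x\cdot e_1>\rho_{-1}\}$, $\Omega_X^{-1}=\{x:x\cdot e_1<\rho_1\}$, $\Omega_Y^{1}=\{y:y\cdot e_1>\eta_{-1}\}$, $\Omega_Y^{-1}=\{y:y\cdot e_1<\eta_1\}$, with closures $\overline\Omega_X^w,\overline\Omega_Y^z$; thus $\partial\Omega_X^w=\{x\cdot e_1=\rho_{-w}\}$, $\partial\Omega_Y^z=\{y\cdot e_1=\eta_{-z}\}$. Set $\overline B_{(w,z)}=\overline\Omega_X^w\times\overline\Omega_Y^z$ for $(w,z)\in\{-1,1\}^2$. **Controls and strategies.** $A,B$ are compact (metric) sets; $\mathcal A$ (resp. $\mathcal B$) is the set of measurable functions $[0,+\infty[\to A$ (resp. $\to B$). $\Gamma$ is the set of non-anticipating strategies $\gamma:\mathcal B\to\mathcal A$, i.e. for all $t\ge0$, $\beta_1=\beta_2$ a.e. in $[0,t]$ implies $\gamma[\beta_1]=\gamma[\beta_2]$ a.e. in $[0,t]$; $\Xi$ is the set of non-anticipating strategies $\xi:\mathcal A\to\mathcal B$, defined symmetrically. **Main Assumptions.** $f:\mathbb{R}^n\times\{-1,1\}\times A\to\mathbb{R}^n$ and $g:\mathbb{R}^m\times\{-1,1\}\times B\to\mathbb{R}^m$ are continuous, bounded, and Lipschitz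 in the state variable ($x$, resp. $y$) uniformly in the other variables. The running cost is $\ell(x,y,w,z,a,b)=\ell_1(x,y,w,z,a)+\ell_2(x,y,w,z,b)\in[0,+\infty[$ with $\ell_1,\ell_2$ continuous, bounded, and Lipschitz in $(x,y)$ uniformly in the other variables. $\lambda>0$ is a constant. **Controllability assumption.** With $f_1,g_1$ the first components of $f,g$: for all $w\in\{-1,1\}$ and $x\in\partial\Omega_X^w$ there are $a_1,a_2\in A$ with $f_1(x,w,a_1)<0<f_1(x,w,a_2)$; for all $z\in\{-1,1\}$ and $y\in\partial\Omega_Y^z$ there are $b_1,b_2\in B$ with $g_1(y,z,b_1)<0<g_1(y,z,b_2)$. **Switching dynamics.** For $x\in\overline\Omega_X^w$ and $\alpha\in\mathcal A$, the trajectory $(X,W)$ is the solution of $X'=f(X,W,\alpha)$, $X(0)=x$, where $W$ is governed by the delayed thermostat with thresholds $(\rho_{-1},\rho_1)$ applied to $X\cdot e_1$, with initial output $w$. That is, $(X,W)$ is the unique pair such that (i) $X$ is continuous and $W:[0,+\infty[\to\{-1,1\}$ is left-continuous with $W(0)=w$; (ii) $X(t)=x+\int_0^tf(X(s),W(s),\alpha(s))ds$ and $X(t)\in\overline\Omega_X^{W(t)}$ for all $t\ge0$; (iii) for every $t$ it minimizes the number of switchings of $W$ in $[0,t]$ among pairs satisfying (i), (ii). Equivalently: move with dynamics $f(\cdot,w,\alpha)$ until the first exit time $t_1=\inf\{t\ge0:X(t)\notin\overline\Omega_X^w\}$, then from $X(t_1)$ with $f(\cdot,-w,\alpha)$ until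 the first exit time from $\overline\Omega_X^{-w}$, and so on; at a switching instant $W$ still has its old value. The trajectory $(Y,Z)$ from $(y,z)$, $y\in\overline\Omega_Y^z$, with control $\beta\in\mathcal B$ is defined in the same way with $g$, thresholds $(\eta_{-1},\eta_1)$ and $Y\cdot e_1$. **First switching instants.** The first switching instant of $X$ is the first exit time from $\overline\Omega_X^w$ of the trajectory moving from $x$ with dynamics $f(\cdot,w,\cdot)$; the first switching instant of $Y$ is the first exit time from $\overline\Omega_Y^z$ of the trajectory moving from $y$ with dynamics $g(\cdot,z,\cdot)$. Convention: $\inf\emptyset=+\infty$, and if $\tau=+\infty$ the term multiplied by $e^{-\lambda\tau}$ is $0$. **Cost and values.** For $(x,y)\in\overline B_{(w,z)}$, $J(x,y,w,z,\alpha,\beta)=\int_0^{+\infty}e^{-\lambda t}\ell(X(t),Y(t),W(t),Z(t),\alpha(t),\beta(t))\,dt$, and $$\underline V(x,y,w,z)=\inf_{\gamma\in\Gamma}\sup_{\beta\in\mathcal B}J(x,y,w,z,\gamma[\beta],\beta),\quad \overline V(x,y,w,z)=\sup_{\xi\in\Xi}\inf_{\alpha\in\mathcal A}J(x,y,w,z,\alpha,\xi[\alpha]).$$ *)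

theory Defs
  imports "HOL-Analysis.Analysis"
begin

text \<open>
  Thermostat labels are the integers \<open>-1\<close> and \<open>1\<close>, and a pair of thresholds is a function
  \<open>\<rho>\<close> on labels. The index \<open>i\<close> names the coordinate that drives the
  thermostat; it is a free parameter because the index type of \<open>real ^ 'n\<close> need not be ordered,
  so ``the first coordinate'' is one arbitrary but fixed index.
\<close>

definition sector :: "'n::finite \<Rightarrow> (int \<Rightarrow> real) \<Rightarrow> int \<Rightarrow> (real ^ 'n) set" where
  "sector i \<rho> w = {x. if w = 1 then \<rho> (-1) < x $ i else x $ i < \<rho> 1}"

text \<open>
  Only the values of a control on \<open>{0..}\<close> are constrained. This is harmless: trajectories and
  costs use no others, and a non-anticipating strategy ignores them up to null sets.
\<close>

definition controls :: "'c::metric_space set \<Rightarrow> (real \<Rightarrow> 'c) set" where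
  "controls C = {\<alpha> \<in> borel_measurable (lebesgue_on {0..}). \<forall>t\<ge>0. \<alpha> t \<in> C}"

definition strategies ::
    "'c::metric_space set \<Rightarrow> 'd::metric_space set \<Rightarrow> ((real \<Rightarrow> 'c) \<Rightarrow> (real \<Rightarrow> 'd)) set" where
  "strategies C D = {\<gamma>. (\<forall>\<beta>\<in>controls C. \<gamma> \<beta> \<in> controls D) \<and>
     (\<forall>t\<ge>0. \<forall>\<beta>\<^sub>1\<in>controls C. \<forall>\<beta>\<^sub>2\<in>controls C.
        (AE s in lebesgue_on {0..t}. \<beta>\<^sub>1 s = \<beta>\<^sub>2 s) \<longrightarrow>
        (AE s in lebesgue_on {0..t}. \<gamma> \<beta>\<^sub>1 s = \<gamma> \<beta>\<^sub>2 s))}"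

definition regular_dynamics ::
    "'c::metric_space set \<Rightarrow> (real ^ 'n::finite \<Rightarrow> int \<Rightarrow> 'c \<Rightarrow> real ^ 'n) \<Rightarrow> bool" where
  "regular_dynamics C f \<longleftrightarrow>
     continuous_on (UNIV \<times> {-1, 1} \<times> C) (\<lambda>(x, w, a). f x w a) \<and>
     bounded ((\<lambda>(x, w, a). f x w a) ` (UNIV \<times> {-1, 1} \<times> C)) \<and>
     (\<exists>L. \<forall>w\<in>{-1, 1}. \<forall>a\<in>C. L-lipschitz_on UNIV (\<lambda>x. f x w a))"

definition regular_cost ::
    "'c::metric_space set \<Rightarrow>
     (real ^ 'n::finite \<Rightarrow> real ^ 'm::finite \<Rightarrow> int \<Rightarrow> int \<Rightarrow> 'c \<Rightarrow> real) \<Rightarrow> bool" where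
  "regular_cost C k \<longleftrightarrow>
     continuous_on (UNIV \<times> UNIV \<times> {-1, 1} \<times> {-1, 1} \<times> C) (\<lambda>(x, y, w, z, c). k x y w z c) \<and>
     bounded ((\<lambda>(x, y, w, z, c). k x y w z c) ` (UNIV \<times> UNIV \<times> {-1, 1} \<times> {-1, 1} \<times> C)) \<and>
     (\<exists>L. \<forall>w\<in>{-1, 1}. \<forall>z\<in>{-1, 1}. \<forall>c\<in>C. L-lipschitz_on UNIV (\<lambda>(x, y). k x y w z c))"

definition controllable ::
    "'n::finite \<Rightarrow> (int \<Rightarrow> real) \<Rightarrow> 'c set \<Rightarrow> (real ^ 'n \<Rightarrow> int \<Rightarrow> 'c \<Rightarrow> real ^ 'n) \<Rightarrow> bool" where
  "controllable i \<rho> C f \<longleftrightarrow>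
     (\<forall>w\<in>{-1, 1}. \<forall>x\<in>frontier (sector i \<rho> w).
        \<exists>a\<^sub>1\<in>C. \<exists>a\<^sub>2\<in>C. f x w a\<^sub>1 $ i < 0 \<and> 0 < f x w a\<^sub>2 $ i)"

text \<open>
  The solution that starts from \<open>p\<close> at time \<open>t\<^sub>0\<close> with the label frozen at \<open>v\<close>. For
  \<open>t < t\<^sub>0\<close> the integral is over the empty set, so the equation makes the solution constant there and
  determines it as a function on all of \<open>real\<close>.
\<close>

definition flow ::
    "(real ^ 'n::finite \<Rightarrow> int \<Rightarrow> 'c \<Rightarrow> real ^ 'n) \<Rightarrow> (real \<Rightarrow> 'c) \<Rightarrow>
     real \<Rightarrow> real ^ 'n \<Rightarrow> int \<Rightarrow> real \<Rightarrow> real ^ 'n" where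
  "flow f \<alpha> t\<^sub>0 p v = (THE X. continuous_on UNIV X \<and>
     (\<forall>t. X t = p + (LINT s:{t\<^sub>0..t}|lebesgue. f (X s) v (\<alpha> s))))"

definition exit_time ::
    "'n::finite \<Rightarrow> (int \<Rightarrow> real) \<Rightarrow> (real ^ 'n \<Rightarrow> int \<Rightarrow> 'c \<Rightarrow> real ^ 'n) \<Rightarrow> (real \<Rightarrow> 'c) \<Rightarrow>
     real \<Rightarrow> real ^ 'n \<Rightarrow> int \<Rightarrow> ereal" where
  "exit_time i \<rho> f \<alpha> t\<^sub>0 p v =
     (INF t\<in>{t. t\<^sub>0 \<le> t \<and> flow f \<alpha> t\<^sub>0 p v t \<notin> closure (sector i \<rho> v)}. ereal t)"

text \<open>
  Starting time, starting point and label of the \<open>k\<close>-th phase between switchings. Phases whose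
  starting time is \<open>\<infinity>\<close> never begin; their other two components are irrelevant.
\<close>

primrec phase ::
    "'n::finite \<Rightarrow> (int \<Rightarrow> real) \<Rightarrow> (real ^ 'n \<Rightarrow> int \<Rightarrow> 'c \<Rightarrow> real ^ 'n) \<Rightarrow> (real \<Rightarrow> 'c) \<Rightarrow>
     real ^ 'n \<Rightarrow> int \<Rightarrow> nat \<Rightarrow> ereal \<times> (real ^ 'n) \<times> int" where
  "phase i \<rho> f \<alpha> x w 0 = (0, x, w)"
| "phase i \<rho> f \<alpha> x w (Suc k) =
     (case phase i \<rho> f \<alpha> x w k of (T, p, v) \<Rightarrow>
        let T' = (if T = \<infinity> then \<infinity> else exit_time i \<rho> f \<alpha> (real_of_ereal T) p v)
        in (T', flow f \<alpha> (real_of_ereal T) p v (real_of_ereal T'), - v))"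

text \<open>
  The least \<open>k\<close> here puts a switching instant in the phase that it ends, so that the label
  still has its old value there and is left-continuous.
\<close>

definition phase_at ::
    "'n::finite \<Rightarrow> (int \<Rightarrow> real) \<Rightarrow> (real ^ 'n \<Rightarrow> int \<Rightarrow> 'c \<Rightarrow> real ^ 'n) \<Rightarrow> (real \<Rightarrow> 'c) \<Rightarrow>
     real ^ 'n \<Rightarrow> int \<Rightarrow> real \<Rightarrow> ereal \<times> (real ^ 'n) \<times> int" where
  "phase_at i \<rho> f \<alpha> x w t =
     phase i \<rho> f \<alpha> x w (LEAST k. ereal t \<le> fst (phase i \<rho> f \<alpha> x w (Suc k)))"

definition state ::
    "'n::finite \<Rightarrow> (int \<Rightarrow> real) \<Rightarrow> (real ^ 'n \<Rightarrow> int \<Rightarrow> 'c \<Rightarrow> real ^ 'n) \<Rightarrow> (real \<Rightarrow> 'c) \<Rightarrow>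
     real ^ 'n \<Rightarrow> int \<Rightarrow> real \<Rightarrow> real ^ 'n" where
  "state i \<rho> f \<alpha> x w t =
     (case phase_at i \<rho> f \<alpha> x w t of (T, p, v) \<Rightarrow> flow f \<alpha> (real_of_ereal T) p v t)"

definition label ::
    "'n::finite \<Rightarrow> (int \<Rightarrow> real) \<Rightarrow> (real ^ 'n \<Rightarrow> int \<Rightarrow> 'c \<Rightarrow> real ^ 'n) \<Rightarrow> (real \<Rightarrow> 'c) \<Rightarrow>
     real ^ 'n \<Rightarrow> int \<Rightarrow> real \<Rightarrow> int" where
  "label i \<rho> f \<alpha> x w t = snd (snd (phase_at i \<rho> f \<alpha> x w t))"

definition first_switch ::
    "'n::finite \<Rightarrow> (int \<Rightarrow> real) \<Rightarrow> (real ^ 'n \<Rightarrow> int \<Rightarrow> 'c \<Rightarrow> real ^ 'n) \<Rightarrow> (real \<Rightarrow> 'c) \<Rightarrow>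
     real ^ 'n \<Rightarrow> int \<Rightarrow> ereal" where
  "first_switch i \<rho> f \<alpha> x w = exit_time i \<rho> f \<alpha> 0 x w"

definition cost ::
    "'n::finite \<Rightarrow> 'm::finite \<Rightarrow> (int \<Rightarrow> real) \<Rightarrow> (int \<Rightarrow> real) \<Rightarrow>
     (real ^ 'n \<Rightarrow> int \<Rightarrow> 'a \<Rightarrow> real ^ 'n) \<Rightarrow> (real ^ 'm \<Rightarrow> int \<Rightarrow> 'b \<Rightarrow> real ^ 'm) \<Rightarrow>
     (real ^ 'n \<Rightarrow> real ^ 'm \<Rightarrow> int \<Rightarrow> int \<Rightarrow> 'a \<Rightarrow> 'b \<Rightarrow> real) \<Rightarrow> real \<Rightarrow>
     real ^ 'n \<Rightarrow> real ^ 'm \<Rightarrow> int \<Rightarrow> int \<Rightarrow> (real \<Rightarrow> 'a) \<Rightarrow> (real \<Rightarrow> 'b) \<Rightarrow> real" where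
  "cost i j \<rho> \<eta> f g l lam x y w z \<alpha> \<beta> =
     (LINT t:{0..}|lebesgue. exp (- lam * t) *
        l (state i \<rho> f \<alpha> x w t) (state j \<eta> g \<beta> y z t)
          (label i \<rho> f \<alpha> x w t) (label j \<eta> g \<beta> y z t) (\<alpha> t) (\<beta> t))"

definition lower_value ::
    "'a::metric_space set \<Rightarrow> 'b::metric_space set \<Rightarrow>
     'n::finite \<Rightarrow> 'm::finite \<Rightarrow> (int \<Rightarrow> real) \<Rightarrow> (int \<Rightarrow> real) \<Rightarrow>
     (real ^ 'n \<Rightarrow> int \<Rightarrow> 'a \<Rightarrow> real ^ 'n) \<Rightarrow> (real ^ 'm \<Rightarrow> int \<Rightarrow> 'b \<Rightarrow> real ^ 'm) \<Rightarrow>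
     (real ^ 'n \<Rightarrow> real ^ 'm \<Rightarrow> int \<Rightarrow> int \<Rightarrow> 'a \<Rightarrow> 'b \<Rightarrow> real) \<Rightarrow> real \<Rightarrow>
     real ^ 'n \<Rightarrow> real ^ 'm \<Rightarrow> int \<Rightarrow> int \<Rightarrow> real" where
  "lower_value A B i j \<rho> \<eta> f g l lam x y w z =
     (INF \<gamma>\<in>strategies B A. SUP \<beta>\<in>controls B. cost i j \<rho> \<eta> f g l lam x y w z (\<gamma> \<beta>) \<beta>)"

definition upper_value ::
    "'a::metric_space set \<Rightarrow> 'b::metric_space set \<Rightarrow>
     'n::finite \<Rightarrow> 'm::finite \<Rightarrow> (int \<Rightarrow> real) \<Rightarrow> (int \<Rightarrow> real) \<Rightarrow>
     (real ^ 'n \<Rightarrow> int \<Rightarrow> 'a \<Rightarrow> real ^ 'n) \<Rightarrow> (real ^ 'm \<Rightarrow> int \<Rightarrow> 'b \<Rightarrow> real ^ 'm) \<Rightarrow>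
     (real ^ 'n \<Rightarrow> real ^ 'm \<Rightarrow> int \<Rightarrow> int \<Rightarrow> 'a \<Rightarrow> 'b \<Rightarrow> real) \<Rightarrow> real \<Rightarrow>
     real ^ 'n \<Rightarrow> real ^ 'm \<Rightarrow> int \<Rightarrow> int \<Rightarrow> real" where
  "upper_value A B i j \<rho> \<eta> f g l lam x y w z =
     (SUP \<xi>\<in>strategies A B. INF \<alpha>\<in>controls A. cost i j \<rho> \<eta> f g l lam x y w z \<alpha> (\<xi> \<alpha>))"

definition switched_label :: "ereal \<Rightarrow> ereal \<Rightarrow> int \<Rightarrow> int \<Rightarrow> int \<times> int" where
  "switched_label \<tau>X \<tau>Y w z =
     (if \<tau>X < \<tau>Y then (- w, z) else if \<tau>X = \<tau>Y then (- w, - z) else (w, - z))"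

text \<open>
  The cost accumulated up to the first switching instant, followed by the terminal reward \<open>V\<close>
  evaluated at the switched label.
\<close>

definition cost_to_first_switch ::
    "'n::finite \<Rightarrow> 'm::finite \<Rightarrow> (int \<Rightarrow> real) \<Rightarrow> (int \<Rightarrow> real) \<Rightarrow>
     (real ^ 'n \<Rightarrow> int \<Rightarrow> 'a \<Rightarrow> real ^ 'n) \<Rightarrow> (real ^ 'm \<Rightarrow> int \<Rightarrow> 'b \<Rightarrow> real ^ 'm) \<Rightarrow>
     (real ^ 'n \<Rightarrow> real ^ 'm \<Rightarrow> int \<Rightarrow> int \<Rightarrow> 'a \<Rightarrow> 'b \<Rightarrow> real) \<Rightarrow> real \<Rightarrow>
     (real ^ 'n \<Rightarrow> real ^ 'm \<Rightarrow> int \<Rightarrow> int \<Rightarrow> real) \<Rightarrow>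
     real ^ 'n \<Rightarrow> real ^ 'm \<Rightarrow> int \<Rightarrow> int \<Rightarrow> (real \<Rightarrow> 'a) \<Rightarrow> (real \<Rightarrow> 'b) \<Rightarrow> real" where
  "cost_to_first_switch i j \<rho> \<eta> f g l lam V x y w z \<alpha> \<beta> =
     (let X = state i \<rho> f \<alpha> x w;
          Y = state j \<eta> g \<beta> y z;
          \<tau>X = first_switch i \<rho> f \<alpha> x w;
          \<tau>Y = first_switch j \<eta> g \<beta> y z;
          \<tau> = min \<tau>X \<tau>Y;
          (w', z') = switched_label \<tau>X \<tau>Y w z
      in (LINT s:{s. 0 \<le> s \<and> ereal s \<le> \<tau>}|lebesgue.
            exp (- lam * s) * l (X s) (Y s) w z (\<alpha> s) (\<beta> s)) +
         (if \<tau> = \<infinity> then 0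
          else exp (- lam * real_of_ereal \<tau>) *
               V (X (real_of_ereal \<tau>)) (Y (real_of_ereal \<tau>)) w' z'))"

end

theory Submission
  imports Defs
begin

text \<open>
  The switching instants are exit times from closed sectors. Whether a trajectory switches at time
  \<open>\<tau>\<close> is therefore decided by the controls immediately after \<open>\<tau>\<close>, and not by those up to \<open>\<tau>\<close>. This is the
  only obstacle to the usual dynamic programming argument: if at \<open>\<tau>\<close> a player changes to a near-optimal
  strategy for the game that restarts from the state reached, the switching that has led to this
  change may disappear.

  The remedy is to keep the old control for a short while after \<open>\<tau>\<close>, which preserves the switching,
  and to make up for this loss of time afterwards. That this costs little is the content of
  \<open>imitation_exists\<close>: a follower that has to begin with a prescribed control can, from then on, shadow the
  motion generated by another control. States stay close, labels and control values
  coincide except during a set of times of small measure, and the follower's control is a causal function of the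
  given ones. Here controllability enters. A follower with the same label as the leader must not switch before
  the leader; near the threshold it pushes inward for a short total time, after which it is at least as
  deep as the leader (\<open>match_step\<close>). When the leader switches, the follower pushes outward and
  switches shortly afterwards (\<open>mismatch_step\<close>). Since the thresholds differ and the speed is bounded,
  a bounded time contains boundedly many switchings, and finitely many such steps cover it
  (\<open>tracking_steps\<close>). By the discount the costs of leader and follower are then close (\<open>cost_close\<close>).

  For the lower value, let first \<open>\<gamma>\<close> be a strategy for the problem that stops at the first switching.
  Following \<open>\<gamma>\<close> until the first switching and then a near-optimal strategy for the state reached, replaced
  by an imitation beginning with \<open>\<gamma>\<close> if the first system has switched, gives a strategy for the whole game
  whose cost is at most a little larger (\<open>lower_value_le_switch\<close>). Conversely let \<open>\<gamma>\<close> be near-optimal for the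
  whole game, and fix a control \<open>\<beta>\<close> of the opponent. Answering in the restarted game as \<open>\<gamma>\<close> answers to
  \<open>\<beta>\<close> continued by an imitation of the opponent's new control is an admissible strategy there. So
  the lower value after the switching is at most the cost of \<open>\<gamma>\<close> against one of these continuations, up to a small
  error (\<open>switch_le_lower_value\<close>). Exchanging the players and changing the sign of the cost reduces the upper
  value to the lower one.
\<close>

section \<open>Measurability and integrals along the time axis\<close>

text \<open>The controls take values in an arbitrary metric space, so the pair of state and control need not be measurable for the Borel sets of the product. Approximating the state by simple
  functions leaves only finitely many fixed states at a time.\<close>

lemma measurable_caratheodory:
  fixes F :: "'s::{metric_space, second_countable_topology} \<Rightarrow> 'c::metric_space \<Rightarrow> 'e::metric_space"
  assumes cont: "continuous_on (UNIV \<times> C) (\<lambda>(x, c). F x c)"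
    and X: "X \<in> borel_measurable N" and \<alpha>: "\<alpha> \<in> borel_measurable N"
    and C: "\<And>s. s \<in> space N \<Longrightarrow> \<alpha> s \<in> C"
  shows "(\<lambda>s. F (X s) (\<alpha> s)) \<in> borel_measurable N"
proof -
  obtain G where G: "\<And>k. simple_function N (G k)"
      and lim: "\<And>s. s \<in> space N \<Longrightarrow> (\<lambda>k. G k s) \<longlonglongrightarrow> X s"
    using borel_measurable_implies_sequence_metric[OF X, of undefined] by blast
  have \<alpha>C: "\<alpha> \<in> measurable N (restrict_space borel C)"
    using \<alpha> C by (intro measurable_restrict_space2) auto
  have fixed: "(\<lambda>s. F x (\<alpha> s)) \<in> borel_measurable N" for x
  proof -
    have "continuous_on C (\<lambda>c. (\<lambda>(x, c). F x c) (x, c))"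
      by (rule continuous_on_compose2[OF cont]) (auto intro!: continuous_intros)
    then have "F x \<in> borel_measurable (restrict_space borel C)"
      by (intro borel_measurable_continuous_on_restrict) auto
    from measurable_compose[OF \<alpha>C this] show ?thesis .
  qed
  show ?thesis
  proof (rule borel_measurable_LIMSEQ_metric[where f = "\<lambda>k s. F (G k s) (\<alpha> s)"])
    fix k
    show "(\<lambda>s. F (G k s) (\<alpha> s)) \<in> borel_measurable N"
    proof (rule measurable_compose_countable'[where f = "\<lambda>x s. F x (\<alpha> s)"])
      show "G k \<in> measurable N (count_space (G k ` space N))"
        using G[of k] by (auto simp: measurable_count_space_eq2 simple_function_def)
      show "countable (G k ` space N)"
        using G[of k] by (auto simp: simple_function_def countable_finite)
    qed (rule fixed)
  next
    fix s assume s: "s \<in> space N"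
    have "isCont (\<lambda>x. F x (\<alpha> s)) (X s)"
    proof -
      have "continuous_on UNIV (\<lambda>x. (\<lambda>(x, c). F x c) (x, \<alpha> s))"
        by (rule continuous_on_compose2[OF cont]) (use C[OF s] in \<open>auto intro!: continuous_intros\<close>)
      then show ?thesis by (simp add: continuous_on_eq_continuous_at)
    qed
    then show "(\<lambda>k. F (G k s) (\<alpha> s)) \<longlonglongrightarrow> F (X s) (\<alpha> s)"
      using lim[OF s] by (rule isCont_tendsto_compose)
  qed
qed

lemma absolutely_integrable_bounded:
  fixes u :: "real \<Rightarrow> 'e::euclidean_space"
  assumes "u \<in> borel_measurable (lebesgue_on {t0..})" and "\<And>t. t \<ge> t0 \<Longrightarrow> norm (u t) \<le> M" and "t0 \<le> a"
  shows "u absolutely_integrable_on {a..b}"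
proof (rule measurable_bounded_by_integrable_imp_absolutely_integrable)
  have "u \<in> borel_measurable (restrict_space (lebesgue_on {t0..}) {a..b})"
    using assms(1) by (rule measurable_restrict_space1)
  also have "restrict_space (lebesgue_on {t0..}) {a..b} = lebesgue_on {a..b}"
    using assms(3) by (subst restrict_restrict_space) (auto simp: Int_absorb1)
  finally show "u \<in> borel_measurable (lebesgue_on {a..b})" .
  show "(\<lambda>_. M) integrable_on {a..b}" by (rule integrable_const_ivl)
qed (use assms in auto)

lemma measurable_time_shift:
  fixes u :: "real \<Rightarrow> 'x"
  assumes "u \<in> measurable (lebesgue_on {0..}) N" and "0 \<le> r"
  shows "(\<lambda>t. u (r + t)) \<in> measurable (lebesgue_on {0..}) N"
proof -
  have "(\<lambda>t::real. r + t) \<in> lebesgue \<rightarrow>\<^sub>M lebesgue"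
    using lebesgue_affine_measurable[where c = "\<lambda>_. 1::real" and t = r] by simp
  then have "(\<lambda>t::real. r + t) \<in> lebesgue_on {0..} \<rightarrow>\<^sub>M lebesgue"
    by (rule measurable_restrict_space1)
  then have "(\<lambda>t::real. r + t) \<in> lebesgue_on {0..} \<rightarrow>\<^sub>M lebesgue_on {0..}"
    using assms(2) by (intro measurable_restrict_space2) auto
  from measurable_compose[OF this assms(1)] show ?thesis .
qed

lemma set_integral_time_shift:
  fixes u :: "real \<Rightarrow> 'e::euclidean_space"
  shows "(LINT s:S|lebesgue. u s) = (LINT s:{s. r + s \<in> S}|lebesgue. u (r + s))"
  unfolding set_lebesgue_integral_def
  by (subst lebesgue_integral_real_affine[where c = 1 and t = r]) (auto simp: indicator_def)

section \<open>Controls and agreement up to null sets\<close>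

definition agree :: "real \<Rightarrow> (real \<Rightarrow> 'c) \<Rightarrow> (real \<Rightarrow> 'c) \<Rightarrow> bool" where
  "agree t \<alpha> \<beta> \<longleftrightarrow> (AE s in lebesgue_on {0..t}. \<alpha> s = \<beta> s)"

lemma agree_iff_negligible: "agree t \<alpha> \<beta> \<longleftrightarrow> negligible {s \<in> {0..t}. \<alpha> s \<noteq> \<beta> s}"
proof -
  have "agree t \<alpha> \<beta> \<longleftrightarrow> (AE s in lebesgue. s \<in> {0..t} \<longrightarrow> \<alpha> s = \<beta> s)"
    unfolding agree_def by (subst AE_restrict_space_iff) auto
  also have "\<dots> \<longleftrightarrow> (\<exists>N. negligible N \<and> {s. \<not> (s \<in> {0..t} \<longrightarrow> \<alpha> s = \<beta> s)} \<subseteq> N)"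
    by (rule eventually_ae_filter_negligible)
  also have "\<dots> \<longleftrightarrow> negligible {s \<in> {0..t}. \<alpha> s \<noteq> \<beta> s}"
    by (smt (verit, best) Collect_cong negligible_subset order_refl)
  finally show ?thesis .
qed

lemma agree_refl [simp]: "agree t \<alpha> \<alpha>"
  by (simp add: agree_def)

lemma agree_sym: "agree t \<alpha> \<beta> \<Longrightarrow> agree t \<beta> \<alpha>"
  by (simp add: agree_def eq_commute)

lemma agree_mono: "agree t \<alpha> \<beta> \<Longrightarrow> s \<le> t \<Longrightarrow> agree s \<alpha> \<beta>"
  unfolding agree_iff_negligible by (erule negligible_subset) auto

lemma agree_trans: "agree t \<alpha> \<beta> \<Longrightarrow> agree t \<beta> \<gamma> \<Longrightarrow> agree t \<alpha> \<gamma>"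
  unfolding agree_iff_negligible
  by (drule (1) negligible_Un, erule negligible_subset) auto

lemma agreeI: "(\<And>s. 0 \<le> s \<Longrightarrow> s \<le> t \<Longrightarrow> \<alpha> s = \<beta> s) \<Longrightarrow> agree t \<alpha> \<beta>"
  unfolding agree_iff_negligible by (rule negligible_subset[OF negligible_empty]) auto

definition shift :: "real \<Rightarrow> (real \<Rightarrow> 'c) \<Rightarrow> real \<Rightarrow> 'c" where
  "shift r \<alpha> t = \<alpha> (r + t)"

definition splice :: "real \<Rightarrow> (real \<Rightarrow> 'c) \<Rightarrow> (real \<Rightarrow> 'c) \<Rightarrow> real \<Rightarrow> 'c" where
  "splice r \<alpha> \<beta> t = (if t \<le> r then \<alpha> t else \<beta> (t - r))"

lemma shift_shift [simp]: "shift r (shift s \<alpha>) = shift (s + r) \<alpha>"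
  by (auto simp: shift_def add_ac)

lemma shift_0 [simp]: "shift 0 \<alpha> = \<alpha>"
  by (auto simp: shift_def)

lemma agree_shift:
  assumes "agree (r + t) \<alpha> \<beta>" and "0 \<le> r"
  shows "agree t (shift r \<alpha>) (shift r \<beta>)"
proof -
  have "negligible {s \<in> {0..r + t}. \<alpha> s \<noteq> \<beta> s}"
    using assms by (simp add: agree_iff_negligible)
  then have "negligible ((+) (- r) ` {s \<in> {0..r + t}. \<alpha> s \<noteq> \<beta> s})"
    by (rule negligible_translation)
  moreover have "{s \<in> {0..t}. shift r \<alpha> s \<noteq> shift r \<beta> s} \<subseteq> (+) (- r) ` {s \<in> {0..r + t}. \<alpha> s \<noteq> \<beta> s}"
  proof
    fix s assume "s \<in> {s \<in> {0..t}. shift r \<alpha> s \<noteq> shift r \<beta> s}"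
    then show "s \<in> (+) (- r) ` {s \<in> {0..r + t}. \<alpha> s \<noteq> \<beta> s}"
      using \<open>0 \<le> r\<close> by (intro image_eqI[of _ _ "r + s"]) (auto simp: shift_def)
  qed
  ultimately show ?thesis unfolding agree_iff_negligible by (rule negligible_subset)
qed

lemma agree_splice:
  assumes "agree (min r t) \<alpha> \<alpha>'" and "r < t \<Longrightarrow> agree (t - r) \<beta> \<beta>'" and "0 \<le> r"
  shows "agree t (splice r \<alpha> \<beta>) (splice r \<alpha>' \<beta>')"
proof (cases "r < t")
  case True
  let ?N = "{s \<in> {0..t - r}. \<beta> s \<noteq> \<beta>' s}"
  have "negligible ({s \<in> {0..min r t}. \<alpha> s \<noteq> \<alpha>' s} \<union> (+) r ` ?N)"
    using assms True by (intro negligible_Un negligible_translation) (auto simp: agree_iff_negligible)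
  moreover have "{s \<in> {0..t}. splice r \<alpha> \<beta> s \<noteq> splice r \<alpha>' \<beta>' s} \<subseteq> \<dots>"
  proof
    fix s assume s: "s \<in> {s \<in> {0..t}. splice r \<alpha> \<beta> s \<noteq> splice r \<alpha>' \<beta>' s}"
    show "s \<in> {s \<in> {0..min r t}. \<alpha> s \<noteq> \<alpha>' s} \<union> (+) r ` ?N"
    proof (cases "s \<le> r")
      case False
      with s have "s - r \<in> ?N" by (auto simp: splice_def)
      then show ?thesis by (intro UnI2 image_eqI[of _ _ "s - r"]) auto
    qed (use s in \<open>auto simp: splice_def\<close>)
  qed
  ultimately show ?thesis unfolding agree_iff_negligible by (rule negligible_subset)
next
  case False
  then have "agree t \<alpha> \<alpha>'" using assms by (simp add: min_def split: if_splits)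
  then show ?thesis unfolding agree_iff_negligible
    by (rule negligible_subset) (use False in \<open>auto simp: splice_def\<close>)
qed

lemma controls_in: "\<alpha> \<in> controls C \<Longrightarrow> 0 \<le> t \<Longrightarrow> \<alpha> t \<in> C"
  by (simp add: controls_def)

lemma controls_measurable: "\<alpha> \<in> controls C \<Longrightarrow> \<alpha> \<in> borel_measurable (lebesgue_on {0..})"
  by (simp add: controls_def)

lemma const_control: "c \<in> C \<Longrightarrow> (\<lambda>_. c) \<in> controls C"
  by (simp add: controls_def)

lemma shift_control: "\<alpha> \<in> controls C \<Longrightarrow> 0 \<le> r \<Longrightarrow> shift r \<alpha> \<in> controls C"
  unfolding controls_def shift_def by (auto intro: measurable_time_shift)

lemma If_control:
  assumes "\<alpha> \<in> controls C" "\<beta> \<in> controls C" and "{t \<in> {0..}. P t} \<in> sets lebesgue"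
  shows "(\<lambda>t. if P t then \<alpha> t else \<beta> t) \<in> controls C"
proof -
  have "{t \<in> space (lebesgue_on {0..}). P t} \<in> sets (lebesgue_on {0..})"
    using assms(3) by (auto simp: sets_restrict_space image_iff intro!: bexI[of _ "{t \<in> {0..}. P t}"])
  then show ?thesis using assms unfolding controls_def by (auto intro: measurable_If)
qed

lemma splice_control:
  assumes "\<alpha> \<in> controls C" "\<beta> \<in> controls C" "0 \<le> r"
  shows "splice r \<alpha> \<beta> \<in> controls C"
proof -
  have meas: "(\<lambda>t. t - r) \<in> lebesgue_on {r..} \<rightarrow>\<^sub>M lebesgue_on {0..}"
  proof -
    have "(\<lambda>t::real. - r + t) \<in> lebesgue \<rightarrow>\<^sub>M lebesgue"
      using lebesgue_affine_measurable[where c = "\<lambda>_. 1::real" and t = "- r"] by simp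
    then have "(\<lambda>t::real. t - r) \<in> lebesgue_on {r..} \<rightarrow>\<^sub>M lebesgue"
      by (intro measurable_restrict_space1) simp
    then show ?thesis by (intro measurable_restrict_space2) auto
  qed
  have 1: "(\<lambda>t. \<beta> (t - r)) \<in> borel_measurable (lebesgue_on {r..})"
    using measurable_compose[OF meas controls_measurable[OF assms(2)]] .
  have "splice r \<alpha> \<beta> \<in> borel_measurable (lebesgue_on {0..})"
    unfolding splice_def[abs_def]
  proof (subst measurable_If_restrict_space_iff)
    show "{x \<in> space (lebesgue_on {0..}). x \<le> r} \<in> sets (lebesgue_on {0..})"
      by (auto simp: sets_restrict_space image_iff intro!: bexI[of _ "{..r}"])
    have "restrict_space (lebesgue_on {0..}) {x. \<not> x \<le> r} = restrict_space (lebesgue_on {r..}) {x. \<not> x \<le> r}"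
      using assms(3) by (simp add: restrict_restrict_space) (intro arg_cong2[where f = restrict_space]; auto)
    moreover have "(\<lambda>t. \<beta> (t - r)) \<in> borel_measurable (restrict_space (lebesgue_on {r..}) {x. \<not> x \<le> r})"
      using 1 by (rule measurable_restrict_space1)
    ultimately show "\<alpha> \<in> borel_measurable (restrict_space (lebesgue_on {0..}) {x. x \<le> r}) \<and>
      (\<lambda>x. \<beta> (x - r)) \<in> borel_measurable (restrict_space (lebesgue_on {0..}) {x. \<not> x \<le> r})"
      using controls_measurable[OF assms(1)] by (auto intro: measurable_restrict_space1)
  qed
  then show ?thesis using assms by (auto simp: controls_def splice_def)
qed

lemma strategies_control: "\<gamma> \<in> strategies C D \<Longrightarrow> \<beta> \<in> controls C \<Longrightarrow> \<gamma> \<beta> \<in> controls D"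
  by (simp add: strategies_def)

lemma strategies_agree:
  "\<gamma> \<in> strategies C D \<Longrightarrow> \<beta> \<in> controls C \<Longrightarrow> \<beta>' \<in> controls C \<Longrightarrow> agree t \<beta> \<beta>' \<Longrightarrow> agree t (\<gamma> \<beta>) (\<gamma> \<beta>')"
  by (cases "0 \<le> t") (auto simp: strategies_def agree_def[symmetric] agree_iff_negligible[of t] not_le)

lemma strategiesI:
  assumes "\<And>\<beta>. \<beta> \<in> controls C \<Longrightarrow> \<gamma> \<beta> \<in> controls D"
    and "\<And>t \<beta> \<beta>'. 0 \<le> t \<Longrightarrow> \<beta> \<in> controls C \<Longrightarrow> \<beta>' \<in> controls C \<Longrightarrow> agree t \<beta> \<beta>' \<Longrightarrow> agree t (\<gamma> \<beta>) (\<gamma> \<beta>')"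
  shows "\<gamma> \<in> strategies C D"
  using assms by (auto simp: strategies_def agree_def)

section \<open>Comparison of integral curves\<close>

text \<open>On a window so short that the Lipschitz constant contributes at most a factor one half, the
  supremum of the distance is bounded by half of itself plus the data. The set \<open>S\<close> collects the
  times at which the two right-hand sides are unrelated, and \<open>N\<close> is a null set.\<close>

lemma integral_curves_close:
  fixes X Y :: "real \<Rightarrow> 'e::euclidean_space"
  assumes X: "\<And>t. t \<in> {a..b} \<Longrightarrow> X t = X a + integral {a..t} u"
    and Y: "\<And>t. t \<in> {a..b} \<Longrightarrow> Y t = Y a + integral {a..t} v"
    and u: "u integrable_on {a..b}" and v: "v integrable_on {a..b}"
    and N: "negligible N" and S: "S \<in> lmeasurable"
    and bound: "\<And>s. s \<in> {a..b} - N \<Longrightarrow> norm (u s - v s) \<le> L * norm (X s - Y s) + K * indicator S s"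
    and L: "0 \<le> L" "L * (b - a) \<le> 1 / 2" and K: "0 \<le> K"
    and t: "t \<in> {a..b}"
  shows "norm (X t - Y t) \<le> 2 * (norm (X a - Y a) + K * measure lebesgue S)"
proof -
  have contX: "continuous_on {a..b} X"
  proof -
    have "continuous_on {a..b} (\<lambda>t. X a + integral {a..t} u)"
      by (intro continuous_intros indefinite_integral_continuous_1 u)
    then show ?thesis by (rule continuous_on_eq) (rule X[symmetric])
  qed
  have contY: "continuous_on {a..b} Y"
  proof -
    have "continuous_on {a..b} (\<lambda>t. Y a + integral {a..t} v)"
      by (intro continuous_intros indefinite_integral_continuous_1 v)
    then show ?thesis by (rule continuous_on_eq) (rule Y[symmetric])
  qed
  have "continuous_on {a..b} (\<lambda>t. norm (X t - Y t))"
    by (intro continuous_intros contX contY)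
  then obtain c where c: "c \<in> {a..b}" and max: "\<And>t. t \<in> {a..b} \<Longrightarrow> norm (X t - Y t) \<le> norm (X c - Y c)"
    using continuous_attains_sup[of "{a..b}" "\<lambda>t. norm (X t - Y t)"] t by auto
  define m where "m = norm (X c - Y c)"
  define d where "d s = (if s \<in> N then 0 else u s - v s)" for s
  have intS: "(indicator S :: real \<Rightarrow> real) integrable_on T" if "T \<in> lmeasurable" for T
    using integrable_on_indicator[of S T] fmeasurable.Int[OF that S]
    by (simp add: lmeasurable_iff_integrable_on fmeasurableD Int_commute)
  have uv: "(\<lambda>s. u s - v s) integrable_on {a..c}"
    using c by (intro integrable_diff integrable_on_subinterval[OF u] integrable_on_subinterval[OF v]) auto
  have d_int: "d integrable_on {a..c}"
    by (rule integrable_spike[OF uv N]) (auto simp: d_def)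
  have g_int: "(\<lambda>s. L * m + K * indicator S s) integrable_on {a..c}"
    by (intro integrable_add integrable_const_ivl integrable_on_mult_right intS) auto
  have "X c - Y c = (X a - Y a) + integral {a..c} (\<lambda>s. u s - v s)"
    using X[OF c] Y[OF c] c
    by (subst Henstock_Kurzweil_Integration.integral_diff) (auto intro: integrable_on_subinterval[OF u] integrable_on_subinterval[OF v])
  also have "integral {a..c} (\<lambda>s. u s - v s) = integral {a..c} d"
    by (rule integral_spike[OF N]) (auto simp: d_def)
  finally have "m \<le> norm (X a - Y a) + norm (integral {a..c} d)"
    unfolding m_def by (simp add: norm_triangle_ineq)
  also have "norm (integral {a..c} d) \<le> integral {a..c} (\<lambda>s. L * m + K * indicator S s)"
  proof (rule integral_norm_bound_integral[OF d_int g_int])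
    fix s assume s: "s \<in> {a..c}"
    have "norm (X s - Y s) \<le> m" using max[of s] s c by (auto simp: m_def)
    then have "L * norm (X s - Y s) \<le> L * m" using L by (rule_tac mult_left_mono) auto
    moreover have "0 \<le> L * m" using L by (simp add: m_def)
    ultimately show "norm (d s) \<le> L * m + K * indicator S s"
      using bound[of s] s c K by (auto simp: d_def)
  qed
  also have "integral {a..c} (\<lambda>s. L * m + K * indicator S s) =
      L * m * (c - a) + K * integral {a..c} (indicator S)"
    using c intS[of "{a..c}"]
    by (subst Henstock_Kurzweil_Integration.integral_add) (auto intro!: integrable_on_mult_right)
  also have "integral {a..c} (indicator S) = measure lebesgue (S \<inter> {a..c})"
    using S by (intro Equivalence_Lebesgue_Henstock_Integration.integral_indicator) (simp add: fmeasurable_Int_fmeasurable)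
  also have "measure lebesgue (S \<inter> {a..c}) \<le> measure lebesgue S"
    using S by (intro measure_mono_fmeasurable) auto
  also have "L * m * (c - a) \<le> L * (b - a) * m"
    using mult_left_mono[of "c - a" "b - a" "L * m"] c L by (simp add: m_def mult_ac)
  also have "L * (b - a) * m \<le> 1 / 2 * m"
    using L by (intro mult_right_mono) (auto simp: m_def)
  finally have "m \<le> 2 * (norm (X a - Y a) + K * measure lebesgue S)"
    using K by (simp add: mult_left_mono)
  then show ?thesis using max[OF t] by (simp add: m_def)
qed

text \<open>Short windows cover the whole interval, and on each of them the curves start together.\<close>

lemma integral_curves_equal:
  fixes X Y :: "real \<Rightarrow> 'e::euclidean_space"
  assumes X: "\<And>t. t \<in> {a..b} \<Longrightarrow> X t = X a + integral {a..t} u"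
    and Y: "\<And>t. t \<in> {a..b} \<Longrightarrow> Y t = Y a + integral {a..t} v"
    and u: "u integrable_on {a..b}" and v: "v integrable_on {a..b}"
    and N: "negligible N"
    and bound: "\<And>s. s \<in> {a..b} - N \<Longrightarrow> norm (u s - v s) \<le> L * norm (X s - Y s)"
    and L: "0 < L" and start: "X a = Y a"
    and t: "t \<in> {a..b}"
  shows "X t = Y t"
proof -
  define h where "h = 1 / (2 * L)"
  have h: "0 < h" "L * h = 1 / 2" using L by (auto simp: h_def)
  have "\<forall>t\<in>{a..b}. t \<le> a + real n * h \<longrightarrow> X t = Y t" for n
  proof (induction n)
    case 0
    then show ?case using start by auto
  next
    case (Suc n)
    show ?case
    proof (intro ballI impI)
      fix t assume t: "t \<in> {a..b}" "t \<le> a + real (Suc n) * h"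
      show "X t = Y t"
      proof (cases "t \<le> a + real n * h")
        case False
        define c where "c = a + real n * h"
        have c: "a \<le> c" "c \<in> {a..b}" "c \<le> t" "t \<le> c + h"
          using False t h by (auto simp: c_def algebra_simps)
        have eqc: "X c = Y c" using Suc c by (auto simp: c_def)
        have restart: "Z s = Z c + integral {c..s} w"
          if "s \<in> {c..t}" "\<And>t. t \<in> {a..b} \<Longrightarrow> Z t = Z a + integral {a..t} w" "w integrable_on {a..b}"
          for Z :: "real \<Rightarrow> 'e" and w s
        proof -
          have "integral {a..c} w + integral {c..s} w = integral {a..s} w"
            using that c t by (intro Henstock_Kurzweil_Integration.integral_combine integrable_on_subinterval[OF that(3)]) auto
          then show ?thesis using that(2)[of s] that(2)[of c] that(1) c t by (auto simp: algebra_simps)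
        qed
        have "norm (X t - Y t) \<le> 2 * (norm (X c - Y c) + 0 * measure lebesgue ({} :: real set))"
        proof (rule integral_curves_close[where u = u and v = v and b = t and N = N and L = L])
          show "u integrable_on {c..t}" "v integrable_on {c..t}"
            using c t by (auto intro!: integrable_on_subinterval[OF u] integrable_on_subinterval[OF v])
          show "L * (t - c) \<le> 1 / 2"
            using mult_left_mono[of "t - c" h L] c h L by linarith
          show "X s = X c + integral {c..s} u" if "s \<in> {c..t}" for s
            using restart[OF that X u] .
          show "Y s = Y c + integral {c..s} v" if "s \<in> {c..t}" for s
            using restart[OF that Y v] .
          show "norm (u s - v s) \<le> L * norm (X s - Y s) + 0 * indicator {} s" if "s \<in> {c..t} - N" for s
            using bound[of s] that c t by auto
        qed (use c t L N in auto)
        then show ?thesis using eqc by simp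
      qed (use Suc t in auto)
    qed
  qed
  moreover obtain n where "t - a \<le> real n * h"
    using reals_Archimedean3[OF h(1)] by (meson less_imp_le)
  ultimately show ?thesis using t by (auto simp: algebra_simps)
qed

section \<open>Integral curves for measurable controls\<close>

lemma integral_time_shift:
  fixes u :: "real \<Rightarrow> 'e::euclidean_space"
  shows "integral {r + a..r + b} u = integral {a..b} (\<lambda>s. u (r + s))"
  using integral_shift_Icc_real[of a b u r] by (simp add: o_def add_ac)

lemma indefinite_integral_lipschitz:
  fixes h :: "real \<Rightarrow> 'e::euclidean_space"
  assumes h: "h \<in> borel_measurable (lebesgue_on {t0..})" and M: "\<And>t. t0 \<le> t \<Longrightarrow> norm (h t) \<le> M"
  shows "norm (integral {t0..t} h - integral {t0..s} h) \<le> M * \<bar>t - s\<bar>"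
proof -
  have int: "h integrable_on {a..b}" if "t0 \<le> a" for a b
    using absolutely_integrable_bounded[OF h M that] set_lebesgue_integral_eq_integral(1) by blast
  have M0: "0 \<le> M" using M[of t0] norm_ge_zero order_trans by blast
  have bd: "norm (integral {a..b} h) \<le> M * (b - a)" if "t0 \<le> a" "a \<le> b" for a b
    using integral_norm_bound_integral[OF int[OF that(1)] integrable_const_ivl, of b M] that M by (simp add: mult.commute)
  have "norm (integral {t0..t} h - integral {t0..s} h) \<le> M * (t - s)" if "s \<le> t" for s t
  proof (cases "t0 \<le> s")
    case True
    then have "integral {t0..s} h + integral {s..t} h = integral {t0..t} h"
      using that by (intro Henstock_Kurzweil_Integration.integral_combine int) auto
    then have "integral {t0..t} h - integral {t0..s} h = integral {s..t} h"
      by (metis add_diff_cancel_left')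
    then show ?thesis using bd[OF True that] by simp
  next
    case s: False
    show ?thesis
    proof (cases "t0 \<le> t")
      case True
      have "M * (t - t0) \<le> M * (t - s)" using s M0 by (intro mult_left_mono) auto
      then show ?thesis using s bd[of t0 t] True by simp
    next
      case False
      then show ?thesis using s M0 that by simp
    qed
  qed
  from this[of s t] this[of t s] show ?thesis
    by (cases "s \<le> t") (simp_all add: norm_minus_commute abs_if)
qed

lemma exp_integral:
  fixes k :: real
  assumes "0 < k" "a \<le> b"
  shows "((\<lambda>s. exp (k * (s - a))) has_integral ((exp (k * (b - a)) - 1) / k)) {a..b}"
proof -
  have "((\<lambda>s. exp (k * (s - a))) has_integral (exp (k * (b - a)) / k - exp (k * (a - a)) / k)) {a..b}"
    using assms
    by (intro fundamental_theorem_of_calculus)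
       (auto intro!: derivative_eq_intros simp: has_real_derivative_iff_has_vector_derivative[symmetric])
  then show ?thesis by (simp add: diff_divide_distrib)
qed

text \<open>Writing \<open>X = p + exp (k * \<tau>) *\<^sub>R u\<close> with \<open>k = 2 * L\<close> turns the Picard operator on the whole half-line
  into a contraction of bounded continuous functions with factor one half, so that Banach's theorem
  yields a global solution at once. The clock \<open>\<tau>\<close> stands still before \<open>t0\<close>, where the solution is constant.\<close>

lemma integral_curve_exists:
  fixes F :: "real \<Rightarrow> 'e::euclidean_space \<Rightarrow> 'e"
  assumes meas: "\<And>X. continuous_on UNIV X \<Longrightarrow> (\<lambda>s. F s (X s)) \<in> borel_measurable (lebesgue_on {t0..})"
    and bound: "\<And>s x. t0 \<le> s \<Longrightarrow> norm (F s x) \<le> M"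
    and lips: "\<And>s x y. t0 \<le> s \<Longrightarrow> norm (F s x - F s y) \<le> L * norm (x - y)" and L: "0 < L"
  shows "\<exists>X. continuous_on UNIV X \<and> (\<forall>t. X t = p + (LINT s:{t0..t}|lebesgue. F s (X s)))"
proof -
  define k where "k = 2 * L"
  have k: "0 < k" using L by (simp add: k_def)
  define \<tau> where "\<tau> t = max 0 (t - t0)" for t
  have \<tau>: "0 \<le> \<tau> t" "t0 \<le> t \<Longrightarrow> \<tau> t = t - t0" for t by (auto simp: \<tau>_def)
  define Q where "Q u t = p + exp (k * \<tau> t) *\<^sub>R apply_bcontfun u t" for u :: "real \<Rightarrow>\<^sub>C 'e" and t
  have Q_cont: "continuous_on UNIV (Q u)" for u
    unfolding Q_def \<tau>_def by (intro continuous_intros continuous_on_apply_bcontfun)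
  define I where "I u t = integral {t0..t} (\<lambda>s. F s (Q u s))" for u t
  have F_meas: "(\<lambda>s. F s (Q u s)) \<in> borel_measurable (lebesgue_on {t0..})" for u
    by (rule meas[OF Q_cont])
  have F_int: "(\<lambda>s. F s (Q u s)) absolutely_integrable_on {t0..t}" for u t
    by (rule absolutely_integrable_bounded[OF F_meas bound]) auto
  have F_int': "(\<lambda>s. F s (Q u s)) integrable_on {t0..t}" for u t
    using F_int set_lebesgue_integral_eq_integral(1) by blast
  have I_lip: "norm (I u t - I u s) \<le> M * \<bar>t - s\<bar>" for u t s
    unfolding I_def by (rule indefinite_integral_lipschitz[OF F_meas bound])
  have M0: "0 \<le> M" using bound[of t0 0] norm_ge_zero order_trans by blast
  have I_cont: "continuous_on UNIV (I u)" for u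
  proof (rule lipschitz_on_continuous_on)
    show "M-lipschitz_on UNIV (I u)"
      using I_lip[of u] M0 by (intro lipschitz_onI) (auto simp: dist_norm dist_real_def)
  qed
  have I_bd: "norm (I u t) \<le> M * \<tau> t" for u t
  proof (cases "t0 \<le> t")
    case True
    then show ?thesis using I_lip[of u t t0] by (simp add: I_def \<tau>_def)
  qed (simp add: I_def \<tau>_def M0)
  have "(\<lambda>t. exp (- k * \<tau> t) *\<^sub>R I u t) \<in> bcontfun" for u
  proof (rule bcontfun_normI)
    show "continuous_on UNIV (\<lambda>t. exp (- k * \<tau> t) *\<^sub>R I u t)"
      unfolding \<tau>_def by (intro continuous_intros I_cont)
    fix t
    have "k * \<tau> t \<le> exp (k * \<tau> t)"
      using exp_ge_add_one_self[of "k * \<tau> t"] by linarith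
    then have "exp (- k * \<tau> t) * \<tau> t \<le> 1 / k"
      using k by (simp add: exp_minus field_simps)
    then have *: "M * (exp (- k * \<tau> t) * \<tau> t) \<le> M * (1 / k)"
      using M0 by (rule mult_left_mono)
    have "norm (exp (- k * \<tau> t) *\<^sub>R I u t) = exp (- k * \<tau> t) * norm (I u t)" by simp
    also have "\<dots> \<le> exp (- k * \<tau> t) * (M * \<tau> t)"
      by (rule mult_left_mono[OF I_bd]) simp
    also have "\<dots> = M * (exp (- k * \<tau> t) * \<tau> t)" by (simp only: mult_ac)
    finally show "norm (exp (- k * \<tau> t) *\<^sub>R I u t) \<le> M * (1 / k)"
      using * by (rule order_trans)
  qed
  then have "\<exists>v. apply_bcontfun v = (\<lambda>t. exp (- k * \<tau> t) *\<^sub>R I u t)" for u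
    by (metis bcontfunE)
  then obtain P where P: "\<And>u t. apply_bcontfun (P u) t = exp (- k * \<tau> t) *\<^sub>R I u t"
    by metis
  have "dist (P u) (P v) \<le> 1 / 2 * dist u v" for u v
  proof (rule dist_bound)
    fix t
    show "dist (apply_bcontfun (P u) t) (apply_bcontfun (P v) t) \<le> 1 / 2 * dist u v"
    proof (cases "t0 \<le> t")
      case True
      have "I u t - I v t = integral {t0..t} (\<lambda>s. F s (Q u s) - F s (Q v s))"
        unfolding I_def by (rule Henstock_Kurzweil_Integration.integral_diff[symmetric]) (rule F_int')+
      also have "norm \<dots> \<le> integral {t0..t} (\<lambda>s. L * dist u v * exp (k * (s - t0)))"
      proof (rule integral_norm_bound_integral)
        show "(\<lambda>s. F s (Q u s) - F s (Q v s)) integrable_on {t0..t}"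
          by (intro integrable_diff F_int')
        show "(\<lambda>s. L * dist u v * exp (k * (s - t0))) integrable_on {t0..t}"
          using exp_integral[OF k True] by (intro integrable_on_mult_right) blast
        fix s assume s: "s \<in> {t0..t}"
        have "norm (F s (Q u s) - F s (Q v s)) \<le> L * norm (Q u s - Q v s)"
          using lips s by auto
        also have "norm (Q u s - Q v s) = exp (k * (s - t0)) * dist (apply_bcontfun u s) (apply_bcontfun v s)"
          using s by (simp add: Q_def \<tau>_def dist_norm scaleR_diff_right[symmetric])
        also have "L * \<dots> \<le> L * (exp (k * (s - t0)) * dist u v)"
          using L by (intro mult_left_mono dist_bounded) auto
        finally show "norm (F s (Q u s) - F s (Q v s)) \<le> L * dist u v * exp (k * (s - t0))"
          by (simp add: mult_ac)
      qed
      also have "\<dots> = L * dist u v * ((exp (k * (t - t0)) - 1) / k)"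
        using exp_integral[OF k True] by (simp add: integral_unique)
      also have "\<dots> \<le> 1 / 2 * dist u v * exp (k * (t - t0))"
        using L by (simp add: k_def field_simps mult_left_mono)
      finally have "exp (- k * (t - t0)) * norm (I u t - I v t)
          \<le> exp (- k * (t - t0)) * (1 / 2 * dist u v * exp (k * (t - t0)))"
        by (intro mult_left_mono) auto
      also have "\<dots> = 1 / 2 * dist u v" by (simp add: exp_minus)
      finally show ?thesis
        using True by (simp add: P dist_norm scaleR_diff_right[symmetric] \<tau>)
    qed (simp add: P I_def)
  qed
  then have "\<exists>!u. P u = u" by (intro banach_fix_type[of "1 / 2"]) auto
  then obtain u where u: "P u = u" by blast
  have "Q u t = p + (LINT s:{t0..t}|lebesgue. F s (Q u s))" for t
  proof -
    have "apply_bcontfun u t = exp (- k * \<tau> t) *\<^sub>R I u t" using P[of u t] u by simp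
    then have "Q u t = p + I u t" by (simp add: Q_def exp_minus)
    then show ?thesis by (simp add: I_def set_lebesgue_integral_eq_integral(2)[OF F_int])
  qed
  with Q_cont show ?thesis by blast
qed

section \<open>Motion with a frozen label\<close>

locale thermostat =
  fixes i :: "'n::finite" and \<rho> :: "int \<Rightarrow> real" and C :: "'c::metric_space set"
    and f :: "real ^ 'n \<Rightarrow> int \<Rightarrow> 'c \<Rightarrow> real ^ 'n" and M L :: real
  assumes thresholds: "\<rho> (-1) < \<rho> 1"
    and f_cont: "continuous_on (UNIV \<times> {-1, 1} \<times> C) (\<lambda>(x, w, a). f x w a)"
    and f_bound: "\<And>x v a. v \<in> {-1, 1} \<Longrightarrow> a \<in> C \<Longrightarrow> norm (f x v a) \<le> M"
    and f_lips: "\<And>x y v a. v \<in> {-1, 1} \<Longrightarrow> a \<in> C \<Longrightarrow> norm (f x v a - f y v a) \<le> L * norm (x - y)"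
    and M_pos: "0 < M" and L_pos: "0 < L"
    and controllability: "controllable i \<rho> C f"
begin

lemma f_measurable:
  assumes "X \<in> borel_measurable N" "\<alpha> \<in> borel_measurable N" "\<And>s. s \<in> space N \<Longrightarrow> \<alpha> s \<in> C" "v \<in> {-1, 1}"
  shows "(\<lambda>s. f (X s) v (\<alpha> s)) \<in> borel_measurable N"
proof (rule measurable_caratheodory[where C = C and F = "\<lambda>x a. f x v a"])
  have "continuous_on (UNIV \<times> C) (\<lambda>z. (\<lambda>(x, w, a). f x w a) (fst z, v, snd z))"
    by (rule continuous_on_compose2[OF f_cont]) (use assms in \<open>auto intro!: continuous_intros\<close>)
  then show "continuous_on (UNIV \<times> C) (\<lambda>(x, c). f x v c)" by (simp add: split_def)
qed (use assms in auto)

lemma rhs_measurable: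
  assumes "continuous_on UNIV X" "\<alpha> \<in> controls C" "v \<in> {-1, 1}" "0 \<le> t0"
  shows "(\<lambda>s. f (X s) v (\<alpha> s)) \<in> borel_measurable (lebesgue_on {t0..})"
proof (rule f_measurable)
  show "X \<in> borel_measurable (lebesgue_on {t0..})"
    using assms(1) by (intro continuous_imp_measurable_on_sets_lebesgue) (auto intro: continuous_on_subset)
  have "\<alpha> \<in> borel_measurable (restrict_space (lebesgue_on {0..}) {t0..})"
    using controls_measurable[OF assms(2)] by (rule measurable_restrict_space1)
  also have "restrict_space (lebesgue_on {0..}) {t0..} = lebesgue_on {t0..}"
    using assms(4) by (subst restrict_restrict_space) (auto simp: Int_absorb1)
  finally show "\<alpha> \<in> borel_measurable (lebesgue_on {t0..})" .
  show "\<alpha> s \<in> C" if "s \<in> space (lebesgue_on {t0..})" for s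
    using that assms by (intro controls_in) auto
qed (use assms in auto)

lemma rhs_absolutely_integrable:
  assumes "continuous_on UNIV X" "\<alpha> \<in> controls C" "v \<in> {-1, 1}" "0 \<le> a"
  shows "(\<lambda>s. f (X s) v (\<alpha> s)) absolutely_integrable_on {a..b}"
  by (rule absolutely_integrable_bounded[OF rhs_measurable[OF assms(1-3)], of 0 M])
     (use assms in \<open>auto intro!: f_bound controls_in\<close>)

lemma rhs_integrable:
  assumes "continuous_on UNIV X" "\<alpha> \<in> controls C" "v \<in> {-1, 1}" "0 \<le> a"
  shows "(\<lambda>s. f (X s) v (\<alpha> s)) integrable_on {a..b}"
  using rhs_absolutely_integrable[OF assms] set_lebesgue_integral_eq_integral(1) by blast

lemma flow_ex1:
  assumes \<alpha>: "\<alpha> \<in> controls C" and v: "v \<in> {-1, 1}" and t0: "0 \<le> t0"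
  shows "\<exists>!X. continuous_on UNIV X \<and> (\<forall>t. X t = p + (LINT s:{t0..t}|lebesgue. f (X s) v (\<alpha> s)))"
proof (rule ex_ex1I)
  show "\<exists>X. continuous_on UNIV X \<and> (\<forall>t. X t = p + (LINT s:{t0..t}|lebesgue. f (X s) v (\<alpha> s)))"
    by (rule integral_curve_exists[where M = M and L = L])
       (use assms L_pos in \<open>auto intro!: rhs_measurable f_bound f_lips controls_in\<close>)
next
  fix X Y
  assume X: "continuous_on UNIV X \<and> (\<forall>t. X t = p + (LINT s:{t0..t}|lebesgue. f (X s) v (\<alpha> s)))"
    and Y: "continuous_on UNIV Y \<and> (\<forall>t. Y t = p + (LINT s:{t0..t}|lebesgue. f (Y s) v (\<alpha> s)))"
  have Z: "Z t = p + integral {t0..t} (\<lambda>s. f (Z s) v (\<alpha> s))"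
    if "continuous_on UNIV Z \<and> (\<forall>t. Z t = p + (LINT s:{t0..t}|lebesgue. f (Z s) v (\<alpha> s)))" for Z t
    using that set_lebesgue_integral_eq_integral(2)[OF rhs_absolutely_integrable[OF _ \<alpha> v t0]] by metis
  have start: "X t = p" "Y t = p" if "t \<le> t0" for t
    using Z[OF X, of t] Z[OF Y, of t] that by (cases "t = t0"; simp)+
  show "X = Y"
  proof
    fix t
    show "X t = Y t"
    proof (cases "t0 \<le> t")
      case True
      show ?thesis
      proof (rule integral_curves_equal[where a = t0 and b = t and N = "{}" and L = L])
        show "X s = X t0 + integral {t0..s} (\<lambda>s. f (X s) v (\<alpha> s))" for s
          using Z[OF X, of s] start by simp
        show "Y s = Y t0 + integral {t0..s} (\<lambda>s. f (Y s) v (\<alpha> s))" for s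
          using Z[OF Y, of s] start by simp
        show "(\<lambda>s. f (X s) v (\<alpha> s)) integrable_on {t0..t}" "(\<lambda>s. f (Y s) v (\<alpha> s)) integrable_on {t0..t}"
          using X Y \<alpha> v t0 by (blast intro: rhs_integrable)+
        show "norm (f (X s) v (\<alpha> s) - f (Y s) v (\<alpha> s)) \<le> L * norm (X s - Y s)" if "s \<in> {t0..t} - {}" for s
          using that t0 by (intro f_lips v controls_in \<alpha>) auto
        show "X t0 = Y t0" using start[of t0] by simp
      qed (use True L_pos in auto)
    qed (use start in auto)
  qed
qed

abbreviation traj :: "(real \<Rightarrow> 'c) \<Rightarrow> real ^ 'n \<Rightarrow> int \<Rightarrow> real \<Rightarrow> real ^ 'n" where
  "traj \<alpha> p v \<equiv> flow f \<alpha> 0 p v"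

lemma
  assumes "\<alpha> \<in> controls C" "v \<in> {-1, 1}" "0 \<le> t0"
  shows flow_continuous: "continuous_on UNIV (flow f \<alpha> t0 p v)"
    and flow_equation: "flow f \<alpha> t0 p v t = p + (LINT s:{t0..t}|lebesgue. f (flow f \<alpha> t0 p v s) v (\<alpha> s))"
proof -
  have "continuous_on UNIV (flow f \<alpha> t0 p v) \<and>
      (\<forall>t. flow f \<alpha> t0 p v t = p + (LINT s:{t0..t}|lebesgue. f (flow f \<alpha> t0 p v s) v (\<alpha> s)))"
    unfolding flow_def by (rule theI'[OF flow_ex1[OF assms]])
  then show "continuous_on UNIV (flow f \<alpha> t0 p v)"
    and "flow f \<alpha> t0 p v t = p + (LINT s:{t0..t}|lebesgue. f (flow f \<alpha> t0 p v s) v (\<alpha> s))"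
    by (rule conjunct1, rule conjunct2[THEN spec])
qed

lemma flow_shift:
  assumes "\<alpha> \<in> controls C" "v \<in> {-1, 1}" "0 \<le> t0"
  shows "flow f \<alpha> t0 p v t = traj (shift t0 \<alpha>) p v (t - t0)"
proof -
  let ?Y = "\<lambda>t. traj (shift t0 \<alpha>) p v (t - t0)"
  have sh: "shift t0 \<alpha> \<in> controls C" using assms by (intro shift_control) auto
  have "continuous_on UNIV ?Y"
    by (rule continuous_on_compose2[OF flow_continuous[OF sh assms(2) order_refl]]) (auto intro!: continuous_intros)
  moreover have "\<forall>t. ?Y t = p + (LINT s:{t0..t}|lebesgue. f (?Y s) v (\<alpha> s))"
  proof
    fix t
    have "(LINT s:{t0..t}|lebesgue. f (?Y s) v (\<alpha> s)) =
        (LINT s:{0..t - t0}|lebesgue. f (traj (shift t0 \<alpha>) p v s) v (shift t0 \<alpha> s))"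
      by (subst set_integral_time_shift[where r = t0])
         (auto simp: shift_def set_lebesgue_integral_def indicator_def intro!: Bochner_Integration.integral_cong)
    then show "?Y t = p + (LINT s:{t0..t}|lebesgue. f (?Y s) v (\<alpha> s))"
      using flow_equation[OF sh assms(2) order_refl, of p "t - t0"] by metis
  qed
  moreover have "continuous_on UNIV (flow f \<alpha> t0 p v)" by (rule flow_continuous[OF assms])
  moreover have "\<forall>t. flow f \<alpha> t0 p v t = p + (LINT s:{t0..t}|lebesgue. f (flow f \<alpha> t0 p v s) v (\<alpha> s))"
    using flow_equation[OF assms] by (rule allI)
  ultimately have "flow f \<alpha> t0 p v = ?Y"
    using flow_ex1[OF assms, of p] by (elim ex1E) blast
  then show ?thesis by (rule fun_cong)
qed

lemma traj_integrable:
  assumes "\<alpha> \<in> controls C" "v \<in> {-1, 1}" "0 \<le> a"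
  shows "(\<lambda>s. f (traj \<alpha> p v s) v (\<alpha> s)) integrable_on {a..b}"
  using assms by (intro rhs_integrable flow_continuous) auto

lemma traj_integral:
  assumes "\<alpha> \<in> controls C" "v \<in> {-1, 1}"
  shows "traj \<alpha> p v t = p + integral {0..t} (\<lambda>s. f (traj \<alpha> p v s) v (\<alpha> s))"
  by (subst flow_equation)
     (use assms in \<open>auto simp: set_lebesgue_integral_eq_integral(2)[OF rhs_absolutely_integrable] flow_continuous\<close>)

lemma traj_0 [simp]:
  assumes "\<alpha> \<in> controls C" "v \<in> {-1, 1}"
  shows "traj \<alpha> p v 0 = p"
  by (subst traj_integral) (use assms in auto)

lemma traj_diff:
  assumes "\<alpha> \<in> controls C" "v \<in> {-1, 1}" "0 \<le> s" "s \<le> t"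
  shows "traj \<alpha> p v t = traj \<alpha> p v s + integral {s..t} (\<lambda>s. f (traj \<alpha> p v s) v (\<alpha> s))"
proof -
  have "integral {0..s} (\<lambda>s. f (traj \<alpha> p v s) v (\<alpha> s)) + integral {s..t} (\<lambda>s. f (traj \<alpha> p v s) v (\<alpha> s))
      = integral {0..t} (\<lambda>s. f (traj \<alpha> p v s) v (\<alpha> s))"
    using assms by (intro Henstock_Kurzweil_Integration.integral_combine traj_integrable) auto
  then show ?thesis
    using traj_integral[OF assms(1,2), of p t] traj_integral[OF assms(1,2), of p s] by simp
qed

lemma traj_lipschitz:
  assumes "\<alpha> \<in> controls C" "v \<in> {-1, 1}"
  shows "norm (traj \<alpha> p v t - traj \<alpha> p v s) \<le> M * \<bar>t - s\<bar>"
proof -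
  let ?h = "\<lambda>s. f (traj \<alpha> p v s) v (\<alpha> s)"
  have "norm (integral {0..t} ?h - integral {0..s} ?h) \<le> M * \<bar>t - s\<bar>"
  proof (rule indefinite_integral_lipschitz)
    show "?h \<in> borel_measurable (lebesgue_on {0..})"
      using assms by (intro rhs_measurable flow_continuous) auto
    show "norm (?h r) \<le> M" if "0 \<le> r" for r
      by (rule f_bound[OF assms(2) controls_in[OF assms(1) that]])
  qed
  moreover have "traj \<alpha> p v t - traj \<alpha> p v s = integral {0..t} ?h - integral {0..s} ?h"
    by (rule trans[OF arg_cong2[where f = "(-)", OF traj_integral[OF assms] traj_integral[OF assms]] add_diff_cancel_left])
  ultimately show ?thesis by simp
qed

text \<open>Here the control is known on \<open>{0..T}\<close> only, up to a null set; this is what makes trajectories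
  depend on the past of the control alone.\<close>

lemma traj_unique:
  assumes \<alpha>: "\<alpha> \<in> controls C" and v: "v \<in> {-1, 1}" and \<beta>: "\<beta> \<in> controls C" and ag: "agree T \<alpha> \<beta>"
    and Y: "\<And>t. t \<in> {0..T} \<Longrightarrow> Y t = p + integral {0..t} (\<lambda>s. f (Y s) v (\<beta> s))"
    and int: "(\<lambda>s. f (Y s) v (\<beta> s)) integrable_on {0..T}"
    and t: "t \<in> {0..T}"
  shows "Y t = traj \<alpha> p v t"
proof (rule integral_curves_equal[OF _ _ int _ _ _ L_pos _ t])
  have Y0: "Y 0 = p" using Y[of 0] t by auto
  show "Y t = Y 0 + integral {0..t} (\<lambda>s. f (Y s) v (\<beta> s))" if "t \<in> {0..T}" for t
    using Y[OF that] Y0 by simp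
  show "Y 0 = traj \<alpha> p v 0" using Y0 \<alpha> v by simp
  show "traj \<alpha> p v t = traj \<alpha> p v 0 + integral {0..t} (\<lambda>s. f (traj \<alpha> p v s) v (\<alpha> s))" for t
    unfolding traj_0[OF \<alpha> v] by (rule traj_integral[OF \<alpha> v])
  show "(\<lambda>s. f (traj \<alpha> p v s) v (\<alpha> s)) integrable_on {0..T}"
    using traj_integrable[OF \<alpha> v] by simp
  show "negligible {s \<in> {0..T}. \<alpha> s \<noteq> \<beta> s}" using ag by (simp add: agree_iff_negligible)
  show "norm (f (Y s) v (\<beta> s) - f (traj \<alpha> p v s) v (\<alpha> s)) \<le> L * norm (Y s - traj \<alpha> p v s)"
    if "s \<in> {0..T} - {s \<in> {0..T}. \<alpha> s \<noteq> \<beta> s}" for s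
    using that f_lips[OF v controls_in[OF \<alpha>], of s "Y s" "traj \<alpha> p v s"] by simp
qed

lemma traj_agree:
  assumes "\<alpha> \<in> controls C" "\<beta> \<in> controls C" "v \<in> {-1, 1}" "agree T \<alpha> \<beta>" "t \<in> {0..T}"
  shows "traj \<alpha> p v t = traj \<beta> p v t"
  by (rule traj_unique[OF assms(1,3,2,4) _ _ assms(5), symmetric])
     (use assms in \<open>auto intro: traj_integrable traj_integral\<close>)

lemma traj_restart:
  assumes \<alpha>: "\<alpha> \<in> controls C" and v: "v \<in> {-1, 1}" and r: "0 \<le> r" and t: "0 \<le> t"
  shows "traj \<alpha> p v (r + t) = traj (shift r \<alpha>) (traj \<alpha> p v r) v t"
proof (rule traj_unique[where \<beta> = "shift r \<alpha>" and T = t])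
  have cont: "continuous_on UNIV (\<lambda>s. traj \<alpha> p v (r + s))"
    by (rule continuous_on_compose2[OF flow_continuous[OF \<alpha> v order_refl]]) (auto intro!: continuous_intros)
  show "(\<lambda>s. f (traj \<alpha> p v (r + s)) v (shift r \<alpha> s)) integrable_on {0..t}"
    using shift_control[OF \<alpha> r] v cont by (intro rhs_integrable) auto
  fix s assume s: "s \<in> {0..t}"
  have "traj \<alpha> p v (r + s) = traj \<alpha> p v r + integral {r + 0..r + s} (\<lambda>s. f (traj \<alpha> p v s) v (\<alpha> s))"
    unfolding add_0_right by (rule traj_diff[OF \<alpha> v r]) (use s in auto)
  also have "integral {r + 0..r + s} (\<lambda>s. f (traj \<alpha> p v s) v (\<alpha> s)) =
      integral {0..s} (\<lambda>s. f (traj \<alpha> p v (r + s)) v (shift r \<alpha> s))"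
    unfolding shift_def by (rule integral_time_shift)
  finally show "traj \<alpha> p v (r + s) = traj \<alpha> p v r + integral {0..s} (\<lambda>s. f (traj \<alpha> p v (r + s)) v (shift r \<alpha> s))" .
next
  show "shift r \<alpha> \<in> controls C" "shift r \<alpha> \<in> controls C"
    using shift_control[OF \<alpha> r] by auto
qed (use v t in auto)

end

section \<open>Exit times\<close>

lemma ereal_eqI:
  assumes "\<And>u::real. a < ereal u \<longleftrightarrow> b < ereal u"
  shows "a = b"
proof (rule antisym)
  show "a \<le> b" using assms by (metis ereal_dense2 not_le less_le_not_le order_less_trans)
  show "b \<le> a" using assms by (metis ereal_dense2 not_le less_le_not_le order_less_trans)
qed

lemma ereal_add_less_iff: "ereal r + a < ereal u \<longleftrightarrow> a < ereal (u - r)"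
  by (cases a) auto

context thermostat
begin

definition gap :: real where "gap = \<rho> 1 - \<rho> (-1)"

text \<open>The distance to the threshold at which label \<open>w\<close> switches, counted positive inside the sector.\<close>

definition depth :: "int \<Rightarrow> real ^ 'n \<Rightarrow> real" where
  "depth w x = real_of_int w * (x $ i - \<rho> (- w))"

lemma gap_pos: "0 < gap"
  using thresholds by (simp add: gap_def)

lemma depth_opposite: "w \<in> {-1, 1} \<Longrightarrow> depth (- w) x = gap - depth w x"
  by (auto simp: depth_def gap_def)

lemma depth_diff: "w \<in> {-1, 1} \<Longrightarrow> \<bar>depth w x - depth w y\<bar> \<le> norm (x - y)"
  using component_le_norm_cart[of "x - y" i] by (auto simp: depth_def abs_if split: if_splits)

lemma depth_continuous: "continuous_on S X \<Longrightarrow> continuous_on S (\<lambda>t. depth w (X t))"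
  unfolding depth_def by (intro continuous_intros)

lemma closure_sector:
  assumes "w \<in> {-1, 1}"
  shows "closure (sector i \<rho> w) = {x. 0 \<le> depth w x}"
proof -
  have a: "axis i (1::real) \<noteq> 0" by (simp add: axis_eq_0_iff)
  have "sector i \<rho> 1 = {x. axis i 1 \<bullet> x > \<rho> (-1)}" "sector i \<rho> (-1) = {x. axis i 1 \<bullet> x < \<rho> 1}"
    by (auto simp: sector_def inner_axis')
  then show ?thesis
    using assms closure_halfspace_gt[OF a, of "\<rho> (-1)"] closure_halfspace_lt[OF a, of "\<rho> 1"]
    by (auto simp: depth_def inner_axis')
qed

lemma frontier_sector:
  assumes "w \<in> {-1, 1}"
  shows "frontier (sector i \<rho> w) = {x. depth w x = 0}"
proof -
  have a: "axis i (1::real) \<noteq> 0" by (simp add: axis_eq_0_iff)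
  have "sector i \<rho> 1 = {x. axis i 1 \<bullet> x > \<rho> (-1)}" "sector i \<rho> (-1) = {x. axis i 1 \<bullet> x < \<rho> 1}"
    by (auto simp: sector_def inner_axis')
  then show ?thesis
    using assms frontier_halfspace_gt[OF disjI1[OF a], of "\<rho> (-1)"] frontier_halfspace_lt[OF disjI1[OF a], of "\<rho> 1"]
    by (auto simp: depth_def inner_axis')
qed

abbreviation exit :: "(real \<Rightarrow> 'c) \<Rightarrow> real ^ 'n \<Rightarrow> int \<Rightarrow> ereal" where
  "exit \<alpha> p v \<equiv> first_switch i \<rho> f \<alpha> p v"

text \<open>The state is outside the closed sector on an open set of times. Hence an exit strictly before
  \<open>t\<close> is decided by the control on \<open>{0..t}\<close>, whereas an exit exactly at \<open>t\<close> is decided only by what the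
  control does immediately after \<open>t\<close>. All the care taken below about switching instants comes from this.\<close>

lemma exit_less_iff:
  assumes "v \<in> {-1, 1}"
  shows "exit \<alpha> p v < ereal t \<longleftrightarrow> (\<exists>s\<ge>0. s < t \<and> depth v (traj \<alpha> p v s) < 0)"
  by (auto simp: first_switch_def exit_time_def INF_less_iff closure_sector[OF assms] not_le)

lemma exit_geI:
  assumes "v \<in> {-1, 1}" and "\<And>s. 0 \<le> s \<Longrightarrow> s < t \<Longrightarrow> 0 \<le> depth v (traj \<alpha> p v s)"
  shows "ereal t \<le> exit \<alpha> p v"
  using assms(2) exit_less_iff[OF assms(1), of \<alpha> p t] by (auto simp: not_le[symmetric])

lemma exit_nonneg: "v \<in> {-1, 1} \<Longrightarrow> 0 \<le> exit \<alpha> p v"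
  using exit_geI[of v 0 \<alpha> p] by (simp add: zero_ereal_def)

lemma traj_depth_lipschitz:
  assumes "\<alpha> \<in> controls C" "v \<in> {-1, 1}" "u \<in> {-1, 1}"
  shows "\<bar>depth u (traj \<alpha> p v t) - depth u (traj \<alpha> p v s)\<bar> \<le> M * \<bar>t - s\<bar>"
  using depth_diff[OF assms(3)] traj_lipschitz[OF assms(1,2)] by (rule order_trans)

text \<open>A negative depth at time \<open>t\<close> would already be negative shortly before \<open>t\<close>, because the depth
  changes at speed at most \<open>M\<close>.\<close>

lemma inside_until_exit:
  assumes \<alpha>: "\<alpha> \<in> controls C" and v: "v \<in> {-1, 1}" and p: "0 \<le> depth v p"
    and t: "0 \<le> t" "ereal t \<le> exit \<alpha> p v"
  shows "0 \<le> depth v (traj \<alpha> p v t)"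
proof (rule ccontr)
  assume "\<not> 0 \<le> depth v (traj \<alpha> p v t)"
  then have neg: "depth v (traj \<alpha> p v t) < 0" by simp
  (* half of the time that the depth needs at least to return to 0 *)
  define s where "s = max 0 (t - (- depth v (traj \<alpha> p v t)) / (2 * M))"
  have "t \<noteq> 0" using neg p \<alpha> v by auto
  then have s: "0 \<le> s" "s < t" using t neg M_pos by (auto simp: s_def divide_neg_pos)
  have "M * \<bar>s - t\<bar> \<le> M * ((- depth v (traj \<alpha> p v t)) / (2 * M))"
    using s M_pos by (intro mult_left_mono) (auto simp: s_def)
  also have "\<dots> = - depth v (traj \<alpha> p v t) / 2" using M_pos by simp
  finally have "depth v (traj \<alpha> p v s) < 0"
    using traj_depth_lipschitz[OF \<alpha> v v, of p s t] neg by linarith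
  then have "exit \<alpha> p v < ereal t" using s by (auto simp: exit_less_iff[OF v])
  then show False using t by simp
qed

lemma outside_after_exit:
  assumes "v \<in> {-1, 1}" and "exit \<alpha> p v = ereal T" and "0 < e"
  obtains t where "T \<le> t" "t < T + e" "depth v (traj \<alpha> p v t) < 0"
proof -
  have "exit \<alpha> p v < ereal (T + e)" using assms by simp
  then obtain t where t: "0 \<le> t" "t < T + e" "depth v (traj \<alpha> p v t) < 0"
    unfolding exit_less_iff[OF assms(1)] by auto
  moreover have "T \<le> t"
  proof (rule ccontr)
    assume "\<not> T \<le> t"
    then have "exit \<alpha> p v < ereal T" using t by (auto simp: exit_less_iff[OF assms(1)])
    then show False using assms by simp
  qed
  ultimately show ?thesis using that by blast
qed

lemma depth_at_exit:
  assumes \<alpha>: "\<alpha> \<in> controls C" and v: "v \<in> {-1, 1}" and p: "0 \<le> depth v p"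
    and T: "exit \<alpha> p v = ereal T"
  shows "depth v (traj \<alpha> p v T) = 0"
proof (rule ccontr)
  assume ne: "depth v (traj \<alpha> p v T) \<noteq> 0"
  have T0: "0 \<le> T" using exit_nonneg[OF v, of \<alpha> p] T by simp
  define d where "d = depth v (traj \<alpha> p v T)"
  have d: "0 < d" using inside_until_exit[OF \<alpha> v p T0] T ne by (simp add: d_def)
  obtain t where t: "T \<le> t" "t < T + d / M" "depth v (traj \<alpha> p v t) < 0"
    using outside_after_exit[OF v T] d M_pos by (metis divide_pos_pos)
  have "M * \<bar>t - T\<bar> \<le> M * (d / M)" using t M_pos by (intro mult_left_mono) auto
  then have "M * \<bar>t - T\<bar> \<le> d" using M_pos by simp
  then show False using traj_depth_lipschitz[OF \<alpha> v v, of p t T] t by (simp add: d_def[symmetric])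
qed

text \<open>The two thresholds differ, so a trajectory that has just switched lies a full gap inside its new
  sector.\<close>

lemma depth_after_switch:
  assumes "\<alpha> \<in> controls C" "v \<in> {-1, 1}" "0 \<le> depth v p" "exit \<alpha> p v = ereal T"
  shows "depth (- v) (traj \<alpha> p v T) = gap"
  using depth_at_exit[OF assms] depth_opposite[OF assms(2)] by simp

text \<open>Together with the depth after a switching, this keeps successive switchings at least
  \<open>gap / M\<close> apart.\<close>

lemma exit_lower_bound:
  assumes \<alpha>: "\<alpha> \<in> controls C" and v: "v \<in> {-1, 1}"
  shows "ereal (depth v p / M) \<le> exit \<alpha> p v"
proof (rule exit_geI[OF v])
  fix s assume s: "0 \<le> s" "s < depth v p / M"
  then have "M * s \<le> depth v p" using M_pos by (simp add: field_simps)
  then show "0 \<le> depth v (traj \<alpha> p v s)"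
    using traj_depth_lipschitz[OF \<alpha> v v, of p s 0] s \<alpha> v by simp
qed

lemma exit_less_agree:
  assumes "\<alpha> \<in> controls C" "\<beta> \<in> controls C" "v \<in> {-1, 1}" "agree t \<alpha> \<beta>" "u \<le> t" "exit \<alpha> p v < ereal u"
  shows "exit \<beta> p v < ereal u"
  using assms(6) traj_agree[OF assms(1-4)] assms(5) unfolding exit_less_iff[OF assms(3)] by fastforce

lemma exit_agree_ge:
  assumes "\<alpha> \<in> controls C" "\<beta> \<in> controls C" "v \<in> {-1, 1}" "agree t \<alpha> \<beta>" "ereal t \<le> exit \<alpha> p v"
  shows "ereal t \<le> exit \<beta> p v"
  using exit_less_agree[OF assms(2,1,3) agree_sym[OF assms(4)] order_refl, of p] assms(5) by (meson not_le)

text \<open>Strictness matters: with \<open>exit \<alpha> p v = t\<close> the two exit times may differ.\<close>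

lemma exit_agree:
  assumes "\<alpha> \<in> controls C" "\<beta> \<in> controls C" "v \<in> {-1, 1}" "agree t \<alpha> \<beta>" "exit \<alpha> p v < ereal t"
  shows "exit \<beta> p v = exit \<alpha> p v"
proof (rule ereal_eqI)
  fix u :: real
  have b: "exit \<beta> p v < ereal t" using exit_less_agree[OF assms(1-4) order_refl assms(5)] .
  show "exit \<beta> p v < ereal u \<longleftrightarrow> exit \<alpha> p v < ereal u"
  proof (cases "u \<le> t")
    case True
    then show ?thesis
      using exit_less_agree[OF assms(1-4)] exit_less_agree[OF assms(2,1,3) agree_sym[OF assms(4)]] by blast
  next
    case False
    then have "ereal t < ereal u" by simp
    then show ?thesis using b assms(5) by (meson less_trans)
  qed
qed

lemma exit_shift:
  assumes \<alpha>: "\<alpha> \<in> controls C" and v: "v \<in> {-1, 1}" and r: "0 \<le> r" "ereal r \<le> exit \<alpha> p v"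
  shows "ereal r + exit (shift r \<alpha>) (traj \<alpha> p v r) v = exit \<alpha> p v"
proof (rule ereal_eqI)
  fix u :: real
  have "exit \<alpha> p v < ereal u \<longleftrightarrow> (\<exists>s\<ge>0. s < u - r \<and> depth v (traj \<alpha> p v (r + s)) < 0)"
  proof
    assume "exit \<alpha> p v < ereal u"
    then obtain s where s: "0 \<le> s" "s < u" "depth v (traj \<alpha> p v s) < 0"
      unfolding exit_less_iff[OF v] by auto
    have "r \<le> s"
    proof (rule ccontr)
      assume "\<not> r \<le> s"
      then have "exit \<alpha> p v < ereal r" using s by (auto simp: exit_less_iff[OF v])
      then show False using r by simp
    qed
    then show "\<exists>s\<ge>0. s < u - r \<and> depth v (traj \<alpha> p v (r + s)) < 0"
      using s by (intro exI[of _ "s - r"]) auto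
  next
    assume "\<exists>s\<ge>0. s < u - r \<and> depth v (traj \<alpha> p v (r + s)) < 0"
    then obtain s where "0 \<le> s" "s < u - r" "depth v (traj \<alpha> p v (r + s)) < 0" by auto
    then show "exit \<alpha> p v < ereal u"
      unfolding exit_less_iff[OF v] using r by (intro exI[of _ "r + s"]) auto
  qed
  then show "ereal r + exit (shift r \<alpha>) (traj \<alpha> p v r) v < ereal u \<longleftrightarrow> exit \<alpha> p v < ereal u"
    unfolding ereal_add_less_iff exit_less_iff[OF v] using traj_restart[OF \<alpha> v r(1), of _ p] by auto
qed

lemma exit_time_shift:
  assumes "\<alpha> \<in> controls C" "v \<in> {-1, 1}" "0 \<le> t0"
  shows "exit_time i \<rho> f \<alpha> t0 p v = ereal t0 + exit (shift t0 \<alpha>) p v"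
proof (rule ereal_eqI)
  fix u :: real
  have "exit_time i \<rho> f \<alpha> t0 p v < ereal u \<longleftrightarrow> (\<exists>t\<ge>t0. t < u \<and> depth v (traj (shift t0 \<alpha>) p v (t - t0)) < 0)"
    by (auto simp: exit_time_def INF_less_iff closure_sector[OF assms(2)] not_le flow_shift[OF assms])
  also have "\<dots> \<longleftrightarrow> (\<exists>s\<ge>0. s < u - t0 \<and> depth v (traj (shift t0 \<alpha>) p v s) < 0)"
  proof
    assume "\<exists>t\<ge>t0. t < u \<and> depth v (traj (shift t0 \<alpha>) p v (t - t0)) < 0"
    then obtain t where "t0 \<le> t" "t < u" "depth v (traj (shift t0 \<alpha>) p v (t - t0)) < 0" by auto
    then show "\<exists>s\<ge>0. s < u - t0 \<and> depth v (traj (shift t0 \<alpha>) p v s) < 0"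
      by (intro exI[of _ "t - t0"]) auto
  next
    assume "\<exists>s\<ge>0. s < u - t0 \<and> depth v (traj (shift t0 \<alpha>) p v s) < 0"
    then obtain s where "0 \<le> s" "s < u - t0" "depth v (traj (shift t0 \<alpha>) p v s) < 0" by auto
    then show "\<exists>t\<ge>t0. t < u \<and> depth v (traj (shift t0 \<alpha>) p v (t - t0)) < 0"
      by (intro exI[of _ "t0 + s"]) auto
  qed
  finally show "exit_time i \<rho> f \<alpha> t0 p v < ereal u \<longleftrightarrow> ereal t0 + exit (shift t0 \<alpha>) p v < ereal u"
    unfolding ereal_add_less_iff exit_less_iff[OF assms(2)] .
qed

section \<open>Phases between switchings\<close>

abbreviation ph :: "(real \<Rightarrow> 'c) \<Rightarrow> real ^ 'n \<Rightarrow> int \<Rightarrow> nat \<Rightarrow> ereal \<times> (real ^ 'n) \<times> int" where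
  "ph \<equiv> phase i \<rho> f"

lemma phase_label: "w \<in> {-1, 1} \<Longrightarrow> snd (snd (ph \<alpha> x w k)) \<in> {-1, 1}"
  by (induction k) (auto split: prod.splits simp: Let_def)

lemma phase_nonneg:
  assumes "\<alpha> \<in> controls C" "w \<in> {-1, 1}"
  shows "0 \<le> fst (ph \<alpha> x w k)"
proof (induction k)
  case (Suc k)
  obtain T p v where Tpv: "ph \<alpha> x w k = (T, p, v)" by (metis prod.exhaust)
  have v: "v \<in> {-1, 1}" using phase_label[OF assms(2), of \<alpha> x k] Tpv by simp
  show ?case
  proof (cases T)
    case (real r)
    then have "0 \<le> r" using Suc Tpv by simp
    then show ?thesis using Tpv real v
      by (simp add: Let_def exit_time_shift[OF assms(1) v] exit_nonneg)
  qed (use Suc Tpv in \<open>auto simp: Let_def\<close>)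
qed simp

text \<open>Phase \<open>Suc k\<close> is phase \<open>k\<close> of the motion restarted at the first exit. The starting points are
  compared only for phases that begin at a finite time; otherwise they are default values.\<close>

lemma phase_shift:
  assumes \<alpha>: "\<alpha> \<in> controls C" and w: "w \<in> {-1, 1}" and r: "exit \<alpha> x w = ereal r"
  defines "ph' \<equiv> ph (shift r \<alpha>) (traj \<alpha> x w r) (- w)"
  shows "fst (ph \<alpha> x w (Suc k)) = ereal r + fst (ph' k)
    \<and> snd (snd (ph \<alpha> x w (Suc k))) = snd (snd (ph' k))
    \<and> (fst (ph' k) \<noteq> \<infinity> \<longrightarrow> fst (snd (ph \<alpha> x w (Suc k))) = fst (snd (ph' k)))"
proof (induction k)
  case 0
  then show ?case using r by (simp add: ph'_def first_switch_def Let_def)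
next
  case (Suc k)
  have r0: "0 \<le> r" using exit_nonneg[OF w, of \<alpha> x] r by simp
  have sh: "shift r \<alpha> \<in> controls C" using \<alpha> r0 by (rule shift_control)
  have w': "- w \<in> {-1, 1}" using w by auto
  obtain T p v where 1: "ph \<alpha> x w (Suc k) = (T, p, v)" by (metis prod.exhaust)
  obtain T' p' v' where 2: "ph' k = (T', p', v')" by (metis prod.exhaust)
  have eq: "T = ereal r + T'" "v = v'" "T' \<noteq> \<infinity> \<Longrightarrow> p = p'" using Suc 1 2 by auto
  have v': "v' \<in> {-1, 1}" using phase_label[OF w', of "shift r \<alpha>" "traj \<alpha> x w r" k] 2 by (simp add: ph'_def)
  have T'0: "0 \<le> T'" using phase_nonneg[OF sh w', of "traj \<alpha> x w r" k] 2 by (simp add: ph'_def)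
  have step1: "ph \<alpha> x w (Suc (Suc k)) =
      (let T'' = (if T = \<infinity> then \<infinity> else exit_time i \<rho> f \<alpha> (real_of_ereal T) p v)
       in (T'', flow f \<alpha> (real_of_ereal T) p v (real_of_ereal T''), - v))"
    using 1 by (subst phase.simps) (simp del: phase.simps)
  have step2: "ph' (Suc k) =
      (let T'' = (if T' = \<infinity> then \<infinity> else exit_time i \<rho> f (shift r \<alpha>) (real_of_ereal T') p' v')
       in (T'', flow f (shift r \<alpha>) (real_of_ereal T') p' v' (real_of_ereal T''), - v'))"
    using 2 unfolding ph'_def by (subst phase.simps) (simp del: phase.simps)
  show ?case
  proof (cases "T' = \<infinity>")
    case True
    then show ?thesis unfolding step1 step2 using eq by (simp add: Let_def)
  next
    case False
    then obtain t' where t': "T' = ereal t'" "0 \<le> t'" using T'0 by (cases T') auto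
    have p: "p = p'" using eq t' by simp
    have e: "exit_time i \<rho> f \<alpha> (r + t') p' v' = ereal r + exit_time i \<rho> f (shift r \<alpha>) t' p' v'"
      using t' r0 by (simp add: exit_time_shift[OF \<alpha> v'] exit_time_shift[OF sh v'] add.assoc flip: plus_ereal.simps)
    have fl: "flow f \<alpha> (r + t') p' v' (real_of_ereal (ereal r + E)) = flow f (shift r \<alpha>) t' p' v' (real_of_ereal E)"
      if "E \<noteq> \<infinity>" "0 \<le> E" for E
      using t' r0 that by (cases E) (auto simp: flow_shift[OF \<alpha> v'] flow_shift[OF sh v'])
    have E0: "0 \<le> exit_time i \<rho> f (shift r \<alpha>) t' p' v'"
      using t' exit_nonneg[OF v'] by (simp add: exit_time_shift[OF sh v'])
    show ?thesis unfolding step1 step2 using eq t' p fl[OF _ E0] by (simp add: Let_def e)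
  qed
qed

lemma archimedean_gap: "\<exists>n. t \<le> d + real n * (gap / M)"
proof -
  obtain n where "t - d \<le> real n * (gap / M)"
    using reals_Archimedean3[of "gap / M"] gap_pos M_pos by (meson divide_pos_pos less_imp_le)
  then show ?thesis by (intro exI[of _ n]) simp
qed

text \<open>This drives inductions over switchings. The time still to be covered is measured in units of
  \<open>gap / M\<close>, and every switching uses up one unit; the summand \<open>depth w x / M\<close> accounts for a first phase
  that may be shorter.\<close>

lemma elapsed_after_exit:
  assumes "\<alpha> \<in> controls C" "w \<in> {-1, 1}" "0 \<le> depth w x"
    and "t \<le> depth w x / M + real (Suc n) * (gap / M)" "exit \<alpha> x w = ereal r"
  shows "0 \<le> depth (- w) (traj \<alpha> x w r)"
    and "t - r \<le> depth (- w) (traj \<alpha> x w r) / M + real n * (gap / M)"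
proof -
  have "depth w x / M \<le> r" using exit_lower_bound[OF assms(1,2), of x] assms(5) by simp
  moreover have "real (Suc n) * (gap / M) = gap / M + real n * (gap / M)"
    by (simp add: distrib_right add_divide_distrib)
  moreover note depth_after_switch[OF assms(1-3,5)]
  ultimately show "0 \<le> depth (- w) (traj \<alpha> x w r)"
    and "t - r \<le> depth (- w) (traj \<alpha> x w r) / M + real n * (gap / M)"
    using assms(4) gap_pos by auto
qed

text \<open>Switching instants do not accumulate, so the least phase that reaches a given time exists.\<close>

lemma phase_reaches:
  assumes "\<alpha> \<in> controls C" "w \<in> {-1, 1}" "0 \<le> depth w x"
  shows "\<exists>k. ereal t \<le> fst (ph \<alpha> x w (Suc k))"
proof -
  have first: "fst (ph \<alpha> x w (Suc 0)) = exit \<alpha> x w" for \<alpha> x w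
    by (simp add: first_switch_def Let_def)
  have "\<exists>k. ereal t \<le> fst (ph \<alpha> x w (Suc k))" if "t \<le> depth w x / M + real n * (gap / M)" for n
    using assms that
  proof (induction n arbitrary: \<alpha> x w t)
    case 0
    then have "ereal t \<le> ereal (depth w x / M)" by simp
    also have "\<dots> \<le> exit \<alpha> x w" by (rule exit_lower_bound[OF 0(1,2)])
    finally show ?case using first by metis
  next
    case (Suc n)
    note p = Suc.prems
    show ?case
    proof (cases "ereal t \<le> exit \<alpha> x w")
      case True
      then show ?thesis using first by metis
    next
      case False
      then obtain r where r: "exit \<alpha> x w = ereal r" "0 \<le> r"
        using exit_nonneg[OF p(2), of \<alpha> x] by (cases "exit \<alpha> x w") auto
      have "- w \<in> {-1, 1}" using p(2) by auto
      from Suc.IH[OF shift_control[OF p(1) r(2)] this elapsed_after_exit[OF p r(1)]]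
      obtain k where "ereal (t - r) \<le> fst (ph (shift r \<alpha>) (traj \<alpha> x w r) (- w) (Suc k))" ..
      then have "ereal t \<le> fst (ph \<alpha> x w (Suc (Suc k)))"
        using phase_shift[OF p(1,2) r(1), of "Suc k"]
        by (cases "fst (ph (shift r \<alpha>) (traj \<alpha> x w r) (- w) (Suc k))") (auto simp del: phase.simps)
      then show ?thesis by blast
    qed
  qed
  then show ?thesis using archimedean_gap[of t "depth w x / M"] by blast
qed

abbreviation st :: "(real \<Rightarrow> 'c) \<Rightarrow> real ^ 'n \<Rightarrow> int \<Rightarrow> real \<Rightarrow> real ^ 'n" where
  "st \<equiv> state i \<rho> f"

abbreviation lb :: "(real \<Rightarrow> 'c) \<Rightarrow> real ^ 'n \<Rightarrow> int \<Rightarrow> real \<Rightarrow> int" where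
  "lb \<equiv> label i \<rho> f"

lemma
  assumes "ereal t \<le> exit \<alpha> x w"
  shows state_until_exit: "st \<alpha> x w t = traj \<alpha> x w t"
    and label_until_exit: "lb \<alpha> x w t = w"
proof -
  have "ereal t \<le> fst (ph \<alpha> x w (Suc 0))" using assms by (simp add: first_switch_def Let_def)
  then have "(LEAST k. ereal t \<le> fst (ph \<alpha> x w (Suc k))) = 0"
    by (rule Least_eq_0)
  then have "phase_at i \<rho> f \<alpha> x w t = (0, x, w)" by (simp add: phase_at_def del: phase.simps(2))
  then show "st \<alpha> x w t = traj \<alpha> x w t" "lb \<alpha> x w t = w"
    by (simp_all add: state_def label_def)
qed

lemma
  assumes \<alpha>: "\<alpha> \<in> controls C" and w: "w \<in> {-1, 1}" and x: "0 \<le> depth w x"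
    and r: "exit \<alpha> x w = ereal r" "r < t"
  shows state_after_exit: "st \<alpha> x w t = st (shift r \<alpha>) (traj \<alpha> x w r) (- w) (t - r)"
    and label_after_exit: "lb \<alpha> x w t = lb (shift r \<alpha>) (traj \<alpha> x w r) (- w) (t - r)"
proof -
  define ph' where "ph' = ph (shift r \<alpha>) (traj \<alpha> x w r) (- w)"
  define P where "P k \<longleftrightarrow> ereal t \<le> fst (ph \<alpha> x w (Suc k))" for k
  define P' where "P' k \<longleftrightarrow> ereal (t - r) \<le> fst (ph' (Suc k))" for k
  note sh = phase_shift[OF \<alpha> w r(1), folded ph'_def]
  have r0: "0 \<le> r" using exit_nonneg[OF w, of \<alpha> x] r by simp
  have shc: "shift r \<alpha> \<in> controls C" using \<alpha> r0 by (rule shift_control)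
  have w': "- w \<in> {-1, 1}" using w by auto
  have "P (Suc k) \<longleftrightarrow> P' k" for k
    using sh[of "Suc k"] unfolding P_def P'_def by (cases "fst (ph' (Suc k))") (auto simp del: phase.simps)
  then have PP': "(\<lambda>k. P (Suc k)) = P'" by auto
  have not0: "\<not> P 0" using r by (simp add: P_def first_switch_def Let_def)
  obtain k where "P k" using phase_reaches[OF \<alpha> w x] unfolding P_def by blast
  then have "(LEAST k. P k) = Suc (LEAST k. P' k)"
    using Least_Suc[of P k] not0 PP' by simp
  moreover define n where "n = (LEAST k. P' k)"
  ultimately have 1: "phase_at i \<rho> f \<alpha> x w t = ph \<alpha> x w (Suc n)"
    by (simp add: phase_at_def P_def del: phase.simps)
  have 2: "phase_at i \<rho> f (shift r \<alpha>) (traj \<alpha> x w r) (- w) (t - r) = ph' n"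
    by (simp add: phase_at_def n_def P'_def ph'_def del: phase.simps)
  have fin: "fst (ph' n) \<noteq> \<infinity>"
  proof (cases n)
    case 0
    then show ?thesis by (simp add: ph'_def)
  next
    case (Suc m)
    then have "\<not> P' m" using not_less_Least[of m P'] by (simp add: n_def)
    then show ?thesis using Suc by (auto simp: P'_def)
  qed
  obtain T p v where Tpv: "ph' n = (T, p, v)" by (metis prod.exhaust)
  have v: "v \<in> {-1, 1}" using phase_label[OF w', of "shift r \<alpha>" "traj \<alpha> x w r" n] Tpv by (simp add: ph'_def)
  have T0: "0 \<le> T" using phase_nonneg[OF shc w', of "traj \<alpha> x w r" n] Tpv by (simp add: ph'_def)
  then obtain s where s: "T = ereal s" "0 \<le> s" using fin Tpv by (cases T) auto
  have 3: "ph \<alpha> x w (Suc n) = (ereal (r + s), p, v)"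
    using sh[of n] Tpv s by (cases "ph \<alpha> x w (Suc n)") (auto simp del: phase.simps)
  show "lb \<alpha> x w t = lb (shift r \<alpha>) (traj \<alpha> x w r) (- w) (t - r)"
    unfolding label_def 1 2 3 Tpv by simp
  show "st \<alpha> x w t = st (shift r \<alpha>) (traj \<alpha> x w r) (- w) (t - r)"
    unfolding state_def 1 2 3 Tpv using s r0
    by (simp add: flow_shift[OF \<alpha> v] flow_shift[OF shc v] diff_diff_eq)
qed

text \<open>At the first exit time the motion may be restarted with either label: with the old one it exits
  at once and continues with the new one. Times \<open>t = 0\<close> are excluded since the label is left-continuous
  and still has its old value at the switching.\<close>

lemma
  assumes \<alpha>: "\<alpha> \<in> controls C" and w: "w \<in> {-1, 1}" and x: "0 \<le> depth w x"
    and r: "0 \<le> r" "ereal r \<le> exit \<alpha> x w" and t: "0 < t"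
    and w': "w' = w \<or> w' = - w \<and> exit \<alpha> x w = ereal r"
  shows state_restart: "st \<alpha> x w (r + t) = st (shift r \<alpha>) (traj \<alpha> x w r) w' t"
    and label_restart: "lb \<alpha> x w (r + t) = lb (shift r \<alpha>) (traj \<alpha> x w r) w' t"
proof -
  let ?y = "traj \<alpha> x w r"
  have shc: "shift r \<alpha> \<in> controls C" using \<alpha> r by (intro shift_control) auto
  have y: "0 \<le> depth w ?y" by (rule inside_until_exit[OF \<alpha> w x r])
  have "st \<alpha> x w (r + t) = st (shift r \<alpha>) ?y w' t \<and> lb \<alpha> x w (r + t) = lb (shift r \<alpha>) ?y w' t"
    using w'
  proof
    assume [simp]: "w' = w"
    note ex = exit_shift[OF \<alpha> w r]
    show ?thesis
    proof (cases "ereal (r + t) \<le> exit \<alpha> x w")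
      case True
      then have "ereal t \<le> exit (shift r \<alpha>) ?y w"
        using ex by (cases "exit (shift r \<alpha>) ?y w"; cases "exit \<alpha> x w") auto
      then show ?thesis using True t
        by (simp add: state_until_exit label_until_exit traj_restart[OF \<alpha> w r(1)])
    next
      case False
      then obtain R where R: "exit \<alpha> x w = ereal R" "R < r + t" "r \<le> R"
        using r by (cases "exit \<alpha> x w") auto
      then have R': "exit (shift r \<alpha>) ?y w = ereal (R - r)"
        using ex by (cases "exit (shift r \<alpha>) ?y w") auto
      have "traj (shift r \<alpha>) ?y w (R - r) = traj \<alpha> x w R"
        using traj_restart[OF \<alpha> w r(1), of "R - r" x] R by simp
      then show ?thesis
        using state_after_exit[OF \<alpha> w x R(1,2)] state_after_exit[OF shc w y R', of t]
          label_after_exit[OF \<alpha> w x R(1,2)] label_after_exit[OF shc w y R', of t] R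
        by (simp add: algebra_simps)
    qed
  next
    assume "w' = - w \<and> exit \<alpha> x w = ereal r"
    then show ?thesis
      using state_after_exit[OF \<alpha> w x, of r "r + t"] label_after_exit[OF \<alpha> w x, of r "r + t"] t by simp
  qed
  then show "st \<alpha> x w (r + t) = st (shift r \<alpha>) ?y w' t" "lb \<alpha> x w (r + t) = lb (shift r \<alpha>) ?y w' t"
    by auto
qed

lemma label_cases:
  assumes "w \<in> {-1, 1}"
  shows "lb \<alpha> x w t \<in> {-1, 1}"
  unfolding label_def phase_at_def by (rule phase_label[OF assms])

lemma
  assumes \<alpha>: "\<alpha> \<in> controls C" and w: "w \<in> {-1, 1}"
  shows state_measurable: "st \<alpha> x w \<in> borel_measurable (lebesgue_on {0..})"
    and label_measurable: "lb \<alpha> x w \<in> measurable (lebesgue_on {0..}) (count_space UNIV)"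
proof -
  define k where "k t = (LEAST k. ereal t \<le> fst (ph \<alpha> x w (Suc k)))" for t
  have "(\<lambda>t::real. ereal t) \<in> borel_measurable (lebesgue_on {0..})"
    by (intro measurable_restrict_space1 measurable_completion) simp
  then have "Measurable.pred (lebesgue_on {0..}) (\<lambda>t. ereal t \<le> c)" for c
    by measurable
  then have k: "k \<in> measurable (lebesgue_on {0..}) (count_space UNIV)"
    unfolding k_def[abs_def] by (intro measurable_Least)
  define F where "F k t = (case ph \<alpha> x w k of (T, p, v) \<Rightarrow> flow f \<alpha> (real_of_ereal T) p v t)" for k t
  have F: "F k \<in> borel_measurable (lebesgue_on {0..})" for k
  proof -
    obtain T p v where Tpv: "ph \<alpha> x w k = (T, p, v)" by (metis prod.exhaust)
    have v: "v \<in> {-1, 1}" using phase_label[OF w, of \<alpha> x k] Tpv by simp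
    have "0 \<le> T" using phase_nonneg[OF \<alpha> w, of x k] Tpv by simp
    then have "0 \<le> real_of_ereal T" by (rule real_of_ereal_pos)
    then show ?thesis unfolding F_def[abs_def] Tpv prod.case
      by (intro continuous_imp_measurable_on_sets_lebesgue)
         (auto intro: continuous_on_subset[OF flow_continuous[OF \<alpha> v]])
  qed
  have "st \<alpha> x w = (\<lambda>t. F (k t) t)"
    by (simp add: fun_eq_iff state_def phase_at_def F_def k_def)
  then show "st \<alpha> x w \<in> borel_measurable (lebesgue_on {0..})"
    using measurable_compose_countable[OF F k] by simp
  have "lb \<alpha> x w = (\<lambda>t. snd (snd (ph \<alpha> x w (k t))))"
    by (simp add: fun_eq_iff label_def phase_at_def k_def)
  then show "lb \<alpha> x w \<in> measurable (lebesgue_on {0..}) (count_space UNIV)"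
    using measurable_compose[OF k, of "\<lambda>k. snd (snd (ph \<alpha> x w k))" "count_space UNIV"] by simp
qed

end

section \<open>Continuations and restarts\<close>

text \<open>A strategy may change course at a time that depends on the opponent's control, provided that the
  time and the continuation are determined by the past as soon as the time has strictly passed. Nothing
  is asked at the time itself, because the splice still follows \<open>\<Gamma>\<close> there.\<close>

lemma splice_strategy:
  fixes \<sigma> :: "(real \<Rightarrow> 'c::metric_space) \<Rightarrow> ereal" and \<Gamma> \<Psi> :: "(real \<Rightarrow> 'c) \<Rightarrow> real \<Rightarrow> 'd::metric_space"
  assumes \<Gamma>: "\<Gamma> \<in> strategies C D" and \<Psi>: "\<And>\<beta>. \<beta> \<in> controls C \<Longrightarrow> \<Psi> \<beta> \<in> controls D"
    and \<sigma>0: "\<And>\<beta>. \<beta> \<in> controls C \<Longrightarrow> 0 \<le> \<sigma> \<beta>"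
    and causal: "\<And>\<beta> \<beta>' t. \<beta> \<in> controls C \<Longrightarrow> \<beta>' \<in> controls C \<Longrightarrow> agree t \<beta> \<beta>' \<Longrightarrow> \<sigma> \<beta> < ereal t \<Longrightarrow>
      \<sigma> \<beta>' = \<sigma> \<beta> \<and> agree (t - real_of_ereal (\<sigma> \<beta>)) (\<Psi> \<beta>) (\<Psi> \<beta>')"
  shows "(\<lambda>\<beta>. if \<sigma> \<beta> = \<infinity> then \<Gamma> \<beta> else splice (real_of_ereal (\<sigma> \<beta>)) (\<Gamma> \<beta>) (\<Psi> \<beta>)) \<in> strategies C D"
    (is "?\<Delta> \<in> _")
proof (rule strategiesI)
  fix \<beta> assume \<beta>: "\<beta> \<in> controls C"
  then have "0 \<le> real_of_ereal (\<sigma> \<beta>)" using \<sigma>0 by (intro real_of_ereal_pos)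
  then show "?\<Delta> \<beta> \<in> controls D"
    using \<beta> strategies_control[OF \<Gamma>] \<Psi> by (auto intro: splice_control)
next
  fix t \<beta> \<beta>'
  assume t: "(0::real) \<le> t" and \<beta>: "\<beta> \<in> controls C" "\<beta>' \<in> controls C" and ag: "agree t \<beta> \<beta>'"
  have early: "agree t (?\<Delta> \<beta>) (\<Gamma> \<beta>)" if "ereal t \<le> \<sigma> \<beta>" for \<beta>
    using that by (cases "\<sigma> \<beta>") (auto intro!: agreeI simp: splice_def)
  have \<Gamma>ag: "agree s (\<Gamma> \<beta>) (\<Gamma> \<beta>')" if "s \<le> t" for s
    using strategies_agree[OF \<Gamma> \<beta> agree_mono[OF ag that]] .
  show "agree t (?\<Delta> \<beta>) (?\<Delta> \<beta>')"
  proof (cases "\<sigma> \<beta> < ereal t")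
    case True
    then have *: "\<sigma> \<beta>' = \<sigma> \<beta>" "agree (t - real_of_ereal (\<sigma> \<beta>)) (\<Psi> \<beta>) (\<Psi> \<beta>')"
      using causal[OF \<beta> ag] by auto
    obtain r where r: "\<sigma> \<beta> = ereal r" "0 \<le> r"
      using True \<sigma>0[OF \<beta>(1)] by (cases "\<sigma> \<beta>") auto
    show ?thesis using * r \<Gamma>ag[of "min r t"] by (simp add: agree_splice)
  next
    case False
    moreover have "\<not> \<sigma> \<beta>' < ereal t"
      using causal[OF \<beta>(2,1) agree_sym[OF ag]] False by auto
    ultimately show ?thesis
      using early[of \<beta>] early[of \<beta>'] \<Gamma>ag[OF order_refl] by (meson agree_sym agree_trans not_less)
  qed
qed

lemma id_strategy: "(\<lambda>\<beta>. \<beta>) \<in> strategies C C"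
  by (rule strategiesI)

context thermostat
begin

text \<open>Exit times before \<open>s\<close> coincide, so the two motions can be compared phase by phase.\<close>

lemma state_agree:
  assumes "\<alpha> \<in> controls C" "\<beta> \<in> controls C" "w \<in> {-1, 1}" "0 \<le> depth w x"
    "agree t \<alpha> \<beta>" "0 \<le> s" "s \<le> t"
  shows "st \<alpha> x w s = st \<beta> x w s \<and> lb \<alpha> x w s = lb \<beta> x w s"
proof -
  have "st \<alpha> x w s = st \<beta> x w s \<and> lb \<alpha> x w s = lb \<beta> x w s" if "s \<le> depth w x / M + real n * (gap / M)" for n
    using assms that
  proof (induction n arbitrary: \<alpha> \<beta> w x s t)
    case (0 \<alpha> \<beta> w x s t)
    then have s: "ereal s \<le> ereal (depth w x / M)" by simp
    show ?case
      using traj_agree[OF 0(1,2,3,5), of s x] 0(6,7)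
        order_trans[OF s exit_lower_bound[OF 0(1,3)]] order_trans[OF s exit_lower_bound[OF 0(2,3)]]
      by (simp add: state_until_exit label_until_exit)
  next
    case (Suc n)
    note p = Suc.prems
    have ags: "agree s \<alpha> \<beta>" using p by (auto intro: agree_mono)
    show ?case
    proof (cases "ereal s \<le> exit \<alpha> x w")
      case True
      then have "ereal s \<le> exit \<beta> x w" by (rule exit_agree_ge[OF p(1,2,3) ags])
      then show ?thesis
        using traj_agree[OF p(1,2,3,5), of s x] p True by (simp add: state_until_exit label_until_exit)
    next
      case False
      then obtain r where r: "exit \<alpha> x w = ereal r" "r < s" "0 \<le> r"
        using exit_nonneg[OF p(3), of \<alpha> x] by (cases "exit \<alpha> x w") auto
      have r': "exit \<beta> x w = ereal r" using exit_agree[OF p(1,2,3) ags, of x] r by simp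
      have eq: "traj \<alpha> x w r = traj \<beta> x w r"
        using traj_agree[OF p(1,2,3,5), of r x] p r by simp
      have w': "- w \<in> {-1, 1}" using p by auto
      note el = elapsed_after_exit[OF p(1,3,4,8) r(1)]
      have "agree (s - r) (shift r \<alpha>) (shift r \<beta>)" using ags r by (intro agree_shift) auto
      from Suc.IH[OF shift_control[OF p(1) r(3)] shift_control[OF p(2) r(3)] w' el(1) this _ order_refl el(2)]
      show ?thesis
        using state_after_exit[OF p(1,3,4) r(1,2)] state_after_exit[OF p(2,3,4) r' r(2)]
          label_after_exit[OF p(1,3,4) r(1,2)] label_after_exit[OF p(2,3,4) r' r(2)] eq r by simp
    qed
  qed
  then show ?thesis using archimedean_gap[of s "depth w x / M"] by blast
qed

text \<open>Positive times only: at \<open>t = 0\<close> the labels differ if a switching takes place.\<close>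

definition restarts :: "real \<Rightarrow> (real \<Rightarrow> 'c) \<Rightarrow> real ^ 'n \<Rightarrow> int \<Rightarrow> real ^ 'n \<Rightarrow> int \<Rightarrow> bool" where
  "restarts r \<beta> q z p v \<longleftrightarrow>
     (\<forall>t>0. st \<beta> q z (r + t) = st (shift r \<beta>) p v t \<and> lb \<beta> q z (r + t) = lb (shift r \<beta>) p v t)"

lemma restartsI:
  assumes "\<beta> \<in> controls C" "z \<in> {-1, 1}" "0 \<le> depth z q" "0 \<le> r" "ereal r \<le> exit \<beta> q z"
    "v = z \<or> v = - z \<and> exit \<beta> q z = ereal r"
  shows "restarts r \<beta> q z (traj \<beta> q z r) v"
  using state_restart[OF assms(1-5) _ assms(6)] label_restart[OF assms(1-5) _ assms(6)]
  by (auto simp: restarts_def)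

lemma restarts_trans:
  assumes "restarts r \<beta> q z p v" "restarts s (shift r \<beta>) p v p' v'" "0 \<le> s"
  shows "restarts (r + s) \<beta> q z p' v'"
  using assms unfolding restarts_def by (auto simp: add.assoc add_nonneg_pos)

text \<open>The exceptional set \<open>E\<close> contains the times at which the follower uses a control value of its
  own or has a different label.\<close>

definition tracks ::
    "real \<Rightarrow> real \<Rightarrow> (real \<Rightarrow> 'c) \<Rightarrow> real ^ 'n \<Rightarrow> int \<Rightarrow> (real \<Rightarrow> 'c) \<Rightarrow> real ^ 'n \<Rightarrow> int \<Rightarrow> bool" where
  "tracks T e \<beta> q z \<beta>' q' z' \<longleftrightarrow>
     (\<exists>E. E \<in> lmeasurable \<and> measure lebesgue E \<le> e \<and>
       (\<forall>t. 0 < t \<and> t \<le> T \<and> t \<notin> E \<longrightarrow>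
          lb \<beta> q z t = lb \<beta>' q' z' t \<and> \<beta> t = \<beta>' t \<and> norm (st \<beta> q z t - st \<beta>' q' z' t) \<le> e))"

lemma tracks_mono:
  assumes "tracks T e \<beta> q z \<beta>' q' z'" "T' \<le> T" "e \<le> e'"
  shows "tracks T' e' \<beta> q z \<beta>' q' z'"
proof -
  obtain E where "E \<in> lmeasurable" "measure lebesgue E \<le> e"
    "\<And>t. 0 < t \<Longrightarrow> t \<le> T \<Longrightarrow> t \<notin> E \<Longrightarrow>
          lb \<beta> q z t = lb \<beta>' q' z' t \<and> \<beta> t = \<beta>' t \<and> norm (st \<beta> q z t - st \<beta>' q' z' t) \<le> e"
    using assms(1) unfolding tracks_def by blast
  then show ?thesis unfolding tracks_def using assms(2,3)
    by (intro exI[of _ E]) (fastforce intro: order_trans)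
qed

lemma tracks_agree:
  assumes "tracks r e \<beta> q z \<beta>' q' z'" and "agree r \<beta>' \<beta>''" and "\<beta>' \<in> controls C" "\<beta>'' \<in> controls C"
    and "z' \<in> {-1, 1}" "0 \<le> depth z' q'"
  shows "tracks r e \<beta> q z \<beta>'' q' z'"
proof -
  obtain E where E: "E \<in> lmeasurable" "measure lebesgue E \<le> e"
    and tr: "\<And>t. 0 < t \<Longrightarrow> t \<le> r \<Longrightarrow> t \<notin> E \<Longrightarrow>
          lb \<beta> q z t = lb \<beta>' q' z' t \<and> \<beta> t = \<beta>' t \<and> norm (st \<beta> q z t - st \<beta>' q' z' t) \<le> e"
    using assms(1) unfolding tracks_def by blast
  define N where "N = {s \<in> {0..r}. \<beta>' s \<noteq> \<beta>'' s}"
  have N: "negligible N" using assms(2) by (simp add: N_def agree_iff_negligible)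
  have "measure lebesgue (E \<union> N) = measure lebesgue E"
    by (rule measure_negligible_symdiff[OF E(1)]) (rule negligible_subset[OF N], auto)
  moreover have "E \<union> N \<in> lmeasurable" using E N by (simp add: fmeasurable.Un negligible_imp_measurable)
  moreover have "lb \<beta> q z t = lb \<beta>'' q' z' t \<and> \<beta> t = \<beta>'' t \<and> norm (st \<beta> q z t - st \<beta>'' q' z' t) \<le> e"
    if "0 < t" "t \<le> r" "t \<notin> E \<union> N" for t
    using tr[of t] that state_agree[OF assms(3-6,2), of t] by (auto simp: N_def)
  ultimately show ?thesis unfolding tracks_def using E by (intro exI[of _ "E \<union> N"]) auto
qed

lemma tracks_append:
  assumes 1: "tracks r e1 \<beta> q z \<beta>' q' z'" and 2: "tracks T e2 (shift r \<beta>) p v (shift r \<beta>') p' v'"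
    and R: "restarts r \<beta> q z p v" "restarts r \<beta>' q' z' p' v'" and "0 \<le> e1" "0 \<le> e2"
  shows "tracks (r + T) (e1 + e2) \<beta> q z \<beta>' q' z'"
proof -
  obtain E1 where E1: "E1 \<in> lmeasurable" "measure lebesgue E1 \<le> e1"
    and t1: "\<And>t. 0 < t \<Longrightarrow> t \<le> r \<Longrightarrow> t \<notin> E1 \<Longrightarrow>
          lb \<beta> q z t = lb \<beta>' q' z' t \<and> \<beta> t = \<beta>' t \<and> norm (st \<beta> q z t - st \<beta>' q' z' t) \<le> e1"
    using 1 unfolding tracks_def by blast
  obtain E2 where E2: "E2 \<in> lmeasurable" "measure lebesgue E2 \<le> e2"
    and t2: "\<And>t. 0 < t \<Longrightarrow> t \<le> T \<Longrightarrow> t \<notin> E2 \<Longrightarrow>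
          lb (shift r \<beta>) p v t = lb (shift r \<beta>') p' v' t \<and> shift r \<beta> t = shift r \<beta>' t \<and>
          norm (st (shift r \<beta>) p v t - st (shift r \<beta>') p' v' t) \<le> e2"
    using 2 unfolding tracks_def by blast
  let ?E = "E1 \<union> (+) r ` E2"
  have m: "(+) r ` E2 \<in> lmeasurable" "measure lebesgue ((+) r ` E2) = measure lebesgue E2"
    using E2 by (auto simp: measurable_translation measure_translation)
  have "?E \<in> lmeasurable" using E1 m by (intro fmeasurable.Un)
  moreover have "measure lebesgue ?E \<le> e1 + e2"
    using measure_Un_le[of E1 lebesgue "(+) r ` E2"] E1 E2 m by (auto simp: fmeasurableD)
  moreover have "lb \<beta> q z t = lb \<beta>' q' z' t \<and> \<beta> t = \<beta>' t \<and> norm (st \<beta> q z t - st \<beta>' q' z' t) \<le> e1 + e2"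
    if t: "0 < t" "t \<le> r + T" "t \<notin> ?E" for t
  proof (cases "t \<le> r")
    case True
    then show ?thesis using t1[of t] t assms by auto
  next
    case False
    then have "t - r \<notin> E2" using t by (auto simp: image_iff)
    then show ?thesis using t2[of "t - r"] R[unfolded restarts_def, rule_format, of "t - r"] False t assms
      by (auto simp: shift_def)
  qed
  ultimately show ?thesis unfolding tracks_def by blast
qed

section \<open>Pushing towards and across a threshold\<close>

text \<open>The speed at which \<open>depth z\<close> grows along a trajectory with label \<open>z\<close>.\<close>

definition rate :: "int \<Rightarrow> real ^ 'n \<Rightarrow> 'c \<Rightarrow> real" where
  "rate z y b = real_of_int z * f y z b $ i"

lemma rate_lipschitz:
  assumes "z \<in> {-1, 1}" "b \<in> C"
  shows "\<bar>rate z x b - rate z y b\<bar> \<le> L * norm (x - y)"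
proof -
  have "\<bar>rate z x b - rate z y b\<bar> = \<bar>(f x z b - f y z b) $ i\<bar>"
    using assms(1) by (auto simp: rate_def)
  also have "\<dots> \<le> norm (f x z b - f y z b)" by (rule component_le_norm_cart)
  also have "\<dots> \<le> L * norm (x - y)" using assms by (rule f_lips)
  finally show ?thesis .
qed

lemma controls_nonempty: "C \<noteq> {}"
proof -
  have "depth 1 (axis i (\<rho> (-1))) = 0" by (simp add: depth_def axis_def)
  then show ?thesis using controllability frontier_sector[of 1] unfolding controllable_def by fastforce
qed

text \<open>Controllability is a condition at each point of an unbounded hyperplane. On a bounded piece of it,
  finitely many control values with a common margin suffice by compactness.\<close>

lemma rate_uniform_on_compact:
  assumes z: "z \<in> {-1, 1}" and s: "s \<in> {-1, 1::real}"
  obtains c F where "0 < c" "finite F" "F \<subseteq> C"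
    "\<And>y. norm y \<le> R \<Longrightarrow> depth z y = 0 \<Longrightarrow> \<exists>b\<in>F. c \<le> s * rate z y b"
proof -
  define K where "K = {y. norm y \<le> R \<and> depth z y = 0}"
  have "K = cball 0 R \<inter> {y. depth z y = 0}" by (auto simp: K_def)
  moreover have "closed {y. depth z y = 0}"
    unfolding depth_def by (intro closed_Collect_eq continuous_intros)
  ultimately have K: "compact K" by (simp add: compact_Int_closed)
  have "\<exists>b\<in>C. 0 < s * rate z y b" if y: "y \<in> K" for y
  proof -
    have "y \<in> frontier (sector i \<rho> z)" using y by (simp add: frontier_sector[OF z] K_def)
    then obtain a1 a2 where "a1 \<in> C" "a2 \<in> C" "f y z a1 $ i < 0" "0 < f y z a2 $ i"
      using controllability z unfolding controllable_def by blast
    then show ?thesis using z s by (auto simp: rate_def)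
  qed
  then obtain B where B: "\<And>y. y \<in> K \<Longrightarrow> B y \<in> C" "\<And>y. y \<in> K \<Longrightarrow> 0 < s * rate z y (B y)" by metis
  define D where "D y = s * rate z y (B y) / (2 * L)" for y
  have D: "0 < D y" if "y \<in> K" for y using B that L_pos by (simp add: D_def)
  have "K \<subseteq> (\<Union>y\<in>K. ball y (D y))" using D by auto
  then obtain G where G: "G \<subseteq> K" "finite G" "K \<subseteq> (\<Union>y\<in>G. ball y (D y))"
    using compactE_image[OF K, of K "\<lambda>y. ball y (D y)"] by auto
  define c where "c = Min (insert 1 ((\<lambda>y. L * D y) ` G))"
  have c: "0 < c" unfolding c_def using G D L_pos by (subst Min_gr_iff) auto
  have "\<exists>b\<in>B ` G. c \<le> s * rate z y b" if y: "norm y \<le> R" "depth z y = 0" for y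
  proof -
    obtain g where g: "g \<in> G" "norm (g - y) < D g"
      using G(3) y by (force simp: K_def dist_norm)
    have "c \<le> L * D g" unfolding c_def using g G by (intro Min_le) auto
    moreover have "2 * (L * D g) = s * rate z g (B g)" using L_pos by (simp add: D_def)
    moreover have "\<bar>rate z g (B g) - rate z y (B g)\<bar> \<le> L * D g"
      using order_trans[OF rate_lipschitz[OF z B(1), of g g y] mult_left_mono[of "norm (g - y)" "D g" L]] g G L_pos by auto
    ultimately have "c \<le> s * rate z y (B g)" using s by auto
    then show ?thesis using g by blast
  qed
  moreover have "finite (B ` G)" "B ` G \<subseteq> C" using G B by auto
  ultimately show ?thesis using that c by blast
qed

text \<open>Taking the first suitable value from a finite list keeps the selection measurable along every
  continuous curve.\<close>

lemma finite_selection: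
  assumes z: "z \<in> {-1, 1}" and "finite F" "F \<subseteq> C"
  shows "\<exists>sel. (\<forall>y. (\<exists>b\<in>F. c \<le> s * rate z y b) \<longrightarrow> c \<le> s * rate z y (sel y)) \<and>
    (\<forall>y. sel y \<in> C) \<and> (\<forall>X. continuous_on UNIV X \<longrightarrow> (\<lambda>t. sel (X t)) \<in> controls C)"
  using assms(2,3)
proof (induction F)
  case empty
  obtain b where "b \<in> C" using controls_nonempty by blast
  then show ?case by (intro exI[of _ "\<lambda>_. b"]) (auto intro: const_control)
next
  case (insert b F)
  then obtain sel where sel: "\<And>y. (\<exists>b\<in>F. c \<le> s * rate z y b) \<Longrightarrow> c \<le> s * rate z y (sel y)"
    "\<And>y. sel y \<in> C" "\<And>X. continuous_on UNIV X \<Longrightarrow> (\<lambda>t. sel (X t)) \<in> controls C" by auto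
  define sel' where "sel' y = (if c \<le> s * rate z y b then b else sel y)" for y
  have "(\<lambda>t. sel' (X t)) \<in> controls C" if X: "continuous_on UNIV X" for X
    unfolding sel'_def
  proof (rule If_control)
    show "(\<lambda>t. b) \<in> controls C" using insert by (auto intro: const_control)
    show "(\<lambda>t. sel (X t)) \<in> controls C" using sel X by auto
    have "(\<lambda>t. f (X t) z b) \<in> borel_measurable (lebesgue_on {0..})"
      by (rule rhs_measurable[OF X _ z]) (use insert in \<open>auto intro: const_control\<close>)
    moreover have "(\<lambda>x::real^'n. x $ i) \<in> borel_measurable borel"
      by (intro borel_measurable_continuous_onI continuous_intros)
    ultimately have "(\<lambda>t. f (X t) z b $ i) \<in> borel_measurable (lebesgue_on {0..})"
      by (rule measurable_compose)
    then have "(\<lambda>t. s * rate z (X t) b) \<in> borel_measurable (lebesgue_on {0..})"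
      unfolding rate_def by measurable
    then have "{t \<in> space (lebesgue_on {0..}). c \<le> s * rate z (X t) b} \<in> sets (lebesgue_on {0..})"
      by measurable
    then show "{t \<in> {0..}. c \<le> s * rate z (X t) b} \<in> sets lebesgue"
      by (simp add: sets_restrict_space_iff)
  qed
  then show ?case
    using sel insert by (intro exI[of _ sel']) (auto simp: sel'_def)
qed

text \<open>For \<open>s = 1\<close> the selected control value drives the state into the sector, for \<open>s = -1\<close> out of it.\<close>

definition push :: "real \<Rightarrow> real \<Rightarrow> real \<Rightarrow> bool" where
  "push R c d \<longleftrightarrow> (\<forall>z\<in>{-1, 1}. \<forall>s\<in>{-1, 1}. \<exists>sel.
     (\<forall>y. norm y \<le> R \<longrightarrow> \<bar>depth z y\<bar> \<le> d \<longrightarrow> c \<le> s * rate z y (sel y)) \<and>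
     (\<forall>y. sel y \<in> C) \<and> (\<forall>X. continuous_on UNIV X \<longrightarrow> (\<lambda>t. sel (X t)) \<in> controls C))"

text \<open>The Lipschitz condition extends the margin from the threshold to a strip around it, and the
  smallest margin serves both labels and both directions.\<close>

lemma push_exists: "\<exists>c>0. \<exists>d>0. push R c d"
proof -
  define Q where "Q z s c d \<longleftrightarrow> (\<exists>sel.
     (\<forall>y. norm y \<le> R \<longrightarrow> \<bar>depth z y\<bar> \<le> d \<longrightarrow> c \<le> s * rate z y (sel y)) \<and>
     (\<forall>y. sel y \<in> C) \<and> (\<forall>X. continuous_on UNIV X \<longrightarrow> (\<lambda>t. sel (X t)) \<in> controls C))" for z and s c d :: real
  have one: "\<exists>c0>0. \<forall>c d. c \<le> c0 \<longrightarrow> d \<le> 1 \<longrightarrow> L * d \<le> c \<longrightarrow> Q z s c d"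
    if z: "z \<in> {-1, 1}" and s: "s \<in> {-1, 1::real}" for z s
  proof -
    obtain c F where cF: "0 < c" "finite F" "F \<subseteq> C"
      "\<And>y. norm y \<le> R + 1 \<Longrightarrow> depth z y = 0 \<Longrightarrow> \<exists>b\<in>F. c \<le> s * rate z y b"
      using rate_uniform_on_compact[OF z s] by metis
    have "Q z s c' d"
      if c': "c' \<le> c / 2" and d: "d \<le> 1" "L * d \<le> c'" for c' d
    proof -
      have "\<exists>b\<in>F. c' \<le> s * rate z y b" if y: "norm y \<le> R" "\<bar>depth z y\<bar> \<le> d" for y
      proof -
        (* the projection of y to the threshold *)
        define y0 where "y0 = y - (real_of_int z * depth z y) *\<^sub>R axis i 1"
        have "norm (y0 - y) = \<bar>depth z y\<bar>" using z by (auto simp: y0_def)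
        then have n: "norm (y0 - y) \<le> d" using y by simp
        have "norm y0 \<le> R + 1" using norm_triangle_ineq2[of y0 y] n y d by linarith
        moreover have "depth z y0 = 0" using z by (auto simp: y0_def depth_def axis_def)
        ultimately obtain b where b: "b \<in> F" "c \<le> s * rate z y0 b" using cF by blast
        have "\<bar>rate z y0 b - rate z y b\<bar> \<le> L * d"
          using order_trans[OF rate_lipschitz[OF z, of b y0 y] mult_left_mono[OF n, of L]] b cF L_pos by auto
        then have "c' \<le> s * rate z y b" using b c' d s by auto
        then show ?thesis using b by blast
      qed
      then show ?thesis using finite_selection[OF z cF(2,3), of c' s] unfolding Q_def by meson
    qed
    then show ?thesis using cF(1) by (intro exI[of _ "c / 2"]) auto
  qed
  obtain c1 where c1: "0 < c1" "\<And>c d. c \<le> c1 \<Longrightarrow> d \<le> 1 \<Longrightarrow> L * d \<le> c \<Longrightarrow> Q (1) (1) c d"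
    using one[of "1" "1"] by auto
  obtain c2 where c2: "0 < c2" "\<And>c d. c \<le> c2 \<Longrightarrow> d \<le> 1 \<Longrightarrow> L * d \<le> c \<Longrightarrow> Q (1) (-1) c d"
    using one[of "1" "-1"] by auto
  obtain c3 where c3: "0 < c3" "\<And>c d. c \<le> c3 \<Longrightarrow> d \<le> 1 \<Longrightarrow> L * d \<le> c \<Longrightarrow> Q (-1) (1) c d"
    using one[of "-1" "1"] by auto
  obtain c4 where c4: "0 < c4" "\<And>c d. c \<le> c4 \<Longrightarrow> d \<le> 1 \<Longrightarrow> L * d \<le> c \<Longrightarrow> Q (-1) (-1) c d"
    using one[of "-1" "-1"] by auto
  define c where "c = min (min c1 c2) (min c3 c4)"
  define d where "d = min 1 (c / L)"
  have "0 < c" using c1(1) c2(1) c3(1) c4(1) by (simp add: c_def)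
  moreover have "0 < d" using \<open>0 < c\<close> L_pos by (simp add: d_def)
  moreover have "L * d \<le> c" "d \<le> 1" using L_pos mult_left_mono[of d "c / L" L] by (auto simp: d_def)
  ultimately have "\<forall>z\<in>{-1, 1}. \<forall>s\<in>{-1, 1}. Q z s c d"
    using c1(2)[of c d] c2(2)[of c d] c3(2)[of c d] c4(2)[of c d] by (auto simp: c_def)
  then have "push R c d" unfolding push_def Q_def .
  then show ?thesis using \<open>0 < c\<close> \<open>0 < d\<close> by blast
qed

lemma rate_bound:
  assumes "\<alpha> \<in> controls C" "z \<in> {-1, 1}" "0 \<le> s" "s \<le> t"
  shows "depth z (traj \<alpha> q z t) - depth z (traj \<alpha> q z s) = integral {s..t} (\<lambda>r. rate z (traj \<alpha> q z r) (\<alpha> r))"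
    and "(\<lambda>r. rate z (traj \<alpha> q z r) (\<alpha> r)) integrable_on {s..t}"
proof -
  have lin: "bounded_linear (\<lambda>x::real^'n. real_of_int z * x $ i)"
    by (intro bounded_linear_const_mult bounded_linear_vec_nth)
  note int = traj_integrable[OF assms(1-3), of q t]
  show "(\<lambda>r. rate z (traj \<alpha> q z r) (\<alpha> r)) integrable_on {s..t}"
    using integrable_linear[OF int lin] by (simp add: o_def rate_def)
  have "integral {s..t} (\<lambda>r. rate z (traj \<alpha> q z r) (\<alpha> r)) =
      real_of_int z * integral {s..t} (\<lambda>r. f (traj \<alpha> q z r) z (\<alpha> r)) $ i"
    using integral_linear[OF int lin] by (simp add: o_def rate_def)
  also have "integral {s..t} (\<lambda>r. f (traj \<alpha> q z r) z (\<alpha> r)) = traj \<alpha> q z t - traj \<alpha> q z s"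
    by (simp only: traj_diff[OF assms, of q] add_diff_cancel_left')
  finally show "depth z (traj \<alpha> q z t) - depth z (traj \<alpha> q z s) = integral {s..t} (\<lambda>r. rate z (traj \<alpha> q z r) (\<alpha> r))"
    by (simp add: depth_def algebra_simps)
qed

lemma traj_close:
  assumes \<alpha>: "\<alpha> \<in> controls C" "\<beta> \<in> controls C" and z: "z \<in> {-1, 1}" and ag: "agree T \<alpha> \<beta>"
    and T: "2 * L * T \<le> 1" and t: "t \<in> {0..T}"
  shows "norm (traj \<alpha> p z t - traj \<beta> q z t) \<le> 2 * norm (p - q)"
proof -
  have "norm (traj \<alpha> p z t - traj \<beta> q z t) \<le>
      2 * (norm (traj \<alpha> p z 0 - traj \<beta> q z 0) + 0 * measure lebesgue ({} :: real set))"
  proof (rule integral_curves_close[where N = "{s \<in> {0..T}. \<alpha> s \<noteq> \<beta> s}" and L = L])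
    show "traj \<alpha> p z t = traj \<alpha> p z 0 + integral {0..t} (\<lambda>s. f (traj \<alpha> p z s) z (\<alpha> s))" for t
      unfolding traj_0[OF \<alpha>(1) z] by (rule traj_integral[OF \<alpha>(1) z])
    show "traj \<beta> q z t = traj \<beta> q z 0 + integral {0..t} (\<lambda>s. f (traj \<beta> q z s) z (\<beta> s))" for t
      unfolding traj_0[OF \<alpha>(2) z] by (rule traj_integral[OF \<alpha>(2) z])
    show "norm (f (traj \<alpha> p z s) z (\<alpha> s) - f (traj \<beta> q z s) z (\<beta> s)) \<le>
        L * norm (traj \<alpha> p z s - traj \<beta> q z s) + 0 * indicator {} s"
      if "s \<in> {0..T} - {s \<in> {0..T}. \<alpha> s \<noteq> \<beta> s}" for s
      using that f_lips[OF z controls_in[OF \<alpha>(1)], of s] by auto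
  qed (use assms L_pos in \<open>auto intro: traj_integrable simp: agree_iff_negligible\<close>)
  then show ?thesis using \<alpha> z by simp
qed

end

section \<open>Tracking over one window\<close>

context thermostat
begin

lemma pushE:
  assumes "push R c d" "z \<in> {-1, 1}" "s \<in> {-1, 1}"
  obtains sel where "\<And>y. norm y \<le> R \<Longrightarrow> \<bar>depth z y\<bar> \<le> d \<Longrightarrow> c \<le> s * rate z y (sel y)"
    "\<And>y. sel y \<in> C" "\<And>X. continuous_on UNIV X \<Longrightarrow> (\<lambda>t. sel (X t)) \<in> controls C"
proof -
  obtain sel where sel: "(\<forall>y. norm y \<le> R \<longrightarrow> \<bar>depth z y\<bar> \<le> d \<longrightarrow> c \<le> s * rate z y (sel y)) \<and>
     (\<forall>y. sel y \<in> C) \<and> (\<forall>X. continuous_on UNIV X \<longrightarrow> (\<lambda>t. sel (X t)) \<in> controls C)"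
    using assms(1)[unfolded push_def, rule_format, OF assms(2,3)] by blast
  show ?thesis by (rule that[of sel]) (use sel in blast)+
qed

text \<open>A leader starts at \<open>q\<close> with control \<open>\<beta>\<close>, a follower nearby at \<open>q'\<close> with the same label. The
  follower must not switch before the leader. It copies \<open>\<beta>\<close>, except that it pushes inward while the leader
  is in the strip near the threshold and \<open>\<beta>\<close> does not itself drive the leader inward with speed \<open>c / 2\<close>;
  the total pushing time is limited by a budget \<open>\<kappa>\<close> of the order of \<open>e\<close>. As long as the budget lasts, the
  follower moves inward whenever it is at the threshold. Each unit of pushing makes the follower gain on the
  leader at a fixed rate, so once the budget is spent it is at least as deep as the leader for the rest of
  the window. The rule looks only at the leader, so the modified control is an explicit causal function
  of \<open>\<beta>\<close> and does not depend on \<open>q'\<close>. The constant \<open>K\<close> combines the factor two from \<open>integral_curves_close\<close> with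
  the displacement \<open>2 * M * \<kappa>\<close> that the pushing may cause.\<close>

lemma match_step:
  assumes P: "push R c d" and c: "0 < c" and z: "z \<in> {-1, 1}"
    and \<theta>: "0 < \<theta>" "2 * L * \<theta> \<le> 1" "32 * L * M * \<theta> \<le> c"
    and q: "0 \<le> depth z q" "norm q + M * \<theta> \<le> R"
    and e: "0 < e" and K: "K = 2 + 32 * M / c" and small: "L * (K * e) \<le> c / 2" "K * e \<le> d"
  shows "\<exists>\<Phi>\<in>strategies C C. \<forall>\<beta>\<in>controls C. \<forall>\<beta>'\<in>controls C. \<forall>q' r.
    0 \<le> depth z q' \<longrightarrow> norm (q - q') \<le> e \<longrightarrow> 0 \<le> r \<longrightarrow> r \<le> \<theta> \<longrightarrow> ereal r \<le> exit \<beta> q z \<longrightarrow>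
    agree r (\<Phi> \<beta>) \<beta>' \<longrightarrow>
      ereal r \<le> exit \<beta>' q' z \<and> norm (traj \<beta> q z r - traj \<beta>' q' z r) \<le> K * e \<and>
      tracks r ((K + 8 / c) * e) \<beta> q z \<beta>' q' z"
proof -
  have K2: "2 \<le> K" using K c M_pos by simp
  obtain sel where sel: "\<And>y. norm y \<le> R \<Longrightarrow> \<bar>depth z y\<bar> \<le> d \<Longrightarrow> c \<le> rate z y (sel y)"
    "\<And>y. sel y \<in> C" "\<And>X. continuous_on UNIV X \<Longrightarrow> (\<lambda>t. sel (X t)) \<in> controls C"
    using pushE[OF P z, of 1] by auto
  define S where "S \<beta> = {t \<in> {0..\<theta>}. \<bar>depth z (traj \<beta> q z t)\<bar> \<le> d \<and> rate z (traj \<beta> q z t) (\<beta> t) < c / 2}" for \<beta>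
  define m where "m \<beta> t = measure lebesgue (S \<beta> \<inter> {0..t})" for \<beta> t
  (* gaining at rate c / 2 for this time makes up for 4 * e: the initial lag e, a drift 2 * e, and a reserve *)
  define \<kappa> where "\<kappa> = 8 * e / c"
  have \<kappa>: "0 < \<kappa>" using e c by (simp add: \<kappa>_def)
  define \<Phi> where "\<Phi> \<beta> t = (if t \<in> S \<beta> \<and> m \<beta> t \<le> \<kappa> then sel (traj \<beta> q z t) else \<beta> t)" for \<beta> t
  have cont: "continuous_on UNIV (traj \<beta> q z)" if "\<beta> \<in> controls C" for \<beta> q
    using that z by (intro flow_continuous) auto
  have S_meas: "S \<beta> \<in> sets lebesgue" if \<beta>: "\<beta> \<in> controls C" for \<beta>
  proof -
    have comp: "(\<lambda>x::real^'n. x $ i) \<in> borel_measurable borel"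
      by (intro borel_measurable_continuous_onI continuous_intros)
    have "(\<lambda>t. f (traj \<beta> q z t) z (\<beta> t)) \<in> borel_measurable (lebesgue_on {0..})"
      using \<beta> z by (intro rhs_measurable cont) auto
    from measurable_compose[OF this comp]
    have 1: "(\<lambda>t. rate z (traj \<beta> q z t) (\<beta> t)) \<in> borel_measurable (lebesgue_on {0..})"
      unfolding rate_def by measurable
    have 2: "(\<lambda>t. depth z (traj \<beta> q z t)) \<in> borel_measurable (lebesgue_on {0..})"
      using cont[OF \<beta>]
      by (intro continuous_imp_measurable_on_sets_lebesgue depth_continuous) (auto intro: continuous_on_subset)
    have 3: "(\<lambda>t::real. t) \<in> borel_measurable (lebesgue_on {0..})"
      by (intro continuous_imp_measurable_on_sets_lebesgue continuous_intros) auto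
    have "{t \<in> space (lebesgue_on {0..}). t \<le> \<theta> \<and> \<bar>depth z (traj \<beta> q z t)\<bar> \<le> d \<and> rate z (traj \<beta> q z t) (\<beta> t) < c / 2}
        \<in> sets (lebesgue_on {0..})"
      using 1 2 3 by measurable
    moreover have "{t \<in> space (lebesgue_on {0..}). t \<le> \<theta> \<and> \<bar>depth z (traj \<beta> q z t)\<bar> \<le> d \<and> rate z (traj \<beta> q z t) (\<beta> t) < c / 2} = S \<beta>"
      by (auto simp: S_def)
    ultimately show ?thesis by (simp add: sets_restrict_space_iff)
  qed
  have S_lm: "S \<beta> \<inter> {0..t} \<in> lmeasurable" if "\<beta> \<in> controls C" for \<beta> t
    using S_meas[OF that] by (intro fmeasurable_Int_fmeasurable[of "{0..t}", THEN subst[OF Int_commute, of "\<lambda>X. X \<in> lmeasurable"]]) auto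
  have m_mono: "m \<beta> s \<le> m \<beta> t" if "\<beta> \<in> controls C" "s \<le> t" for \<beta> s t
    unfolding m_def using that S_lm S_meas by (intro measure_mono_fmeasurable) (auto simp: fmeasurableD)
  have m_lip: "m \<beta> t \<le> m \<beta> s + (t - s)" if \<beta>: "\<beta> \<in> controls C" and "s \<le> t" for \<beta> s t
  proof -
    have "m \<beta> t \<le> measure lebesgue ((S \<beta> \<inter> {0..s}) \<union> {s..t})"
      unfolding m_def using S_lm[OF \<beta>] by (intro measure_mono_fmeasurable) (auto simp: fmeasurableD intro!: fmeasurable.Un)
    also have "\<dots> \<le> m \<beta> s + measure lebesgue {s..t}"
      unfolding m_def using S_lm[OF \<beta>] by (intro measure_Un_le) (auto simp: fmeasurableD)
    finally show ?thesis using that by simp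
  qed
  have m_cont: "continuous_on UNIV (m \<beta>)" if \<beta>: "\<beta> \<in> controls C" for \<beta>
  proof (rule lipschitz_on_continuous_on[of 1])
    show "1-lipschitz_on UNIV (m \<beta>)"
    proof (rule lipschitz_onI)
      fix s t
      show "dist (m \<beta> s) (m \<beta> t) \<le> 1 * dist s t"
        using m_mono[OF \<beta>, of s t] m_mono[OF \<beta>, of t s] m_lip[OF \<beta>, of s t] m_lip[OF \<beta>, of t s]
        by (cases "s \<le> t") (auto simp: dist_real_def)
    qed simp
  qed
  have \<Phi>_ctrl: "\<Phi> \<beta> \<in> controls C" if \<beta>: "\<beta> \<in> controls C" for \<beta>
    unfolding \<Phi>_def[abs_def]
  proof (rule If_control[OF sel(3)[OF cont[OF \<beta>]] \<beta>])
    have "closed {t. m \<beta> t \<le> \<kappa>}"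
      using m_cont[OF \<beta>] by (intro closed_Collect_le) auto
    moreover have "{t \<in> {0..}. t \<in> S \<beta> \<and> m \<beta> t \<le> \<kappa>} = S \<beta> \<inter> {t. m \<beta> t \<le> \<kappa>}" by (auto simp: S_def)
    ultimately show "{t \<in> {0..}. t \<in> S \<beta> \<and> m \<beta> t \<le> \<kappa>} \<in> sets lebesgue"
      using S_meas[OF \<beta>] by (simp add: sets.Int borel_closed)
  qed
  have \<Phi>: "\<Phi> \<in> strategies C C"
  proof (rule strategiesI[OF \<Phi>_ctrl])
    fix t \<beta> \<beta>' assume t: "(0::real) \<le> t" and \<beta>: "\<beta> \<in> controls C" "\<beta>' \<in> controls C" and ag: "agree t \<beta> \<beta>'"
    define N where "N = {s \<in> {0..t}. \<beta> s \<noteq> \<beta>' s}"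
    have N: "negligible N" using ag by (simp add: N_def agree_iff_negligible)
    have tr: "traj \<beta> q z s = traj \<beta>' q z s" if "s \<in> {0..t}" for s
      using traj_agree[OF \<beta> z ag that] .
    have SS: "s \<in> S \<beta> \<longleftrightarrow> s \<in> S \<beta>'" if "s \<in> {0..t}" "s \<notin> N" for s
      using that tr[of s] by (auto simp: S_def N_def)
    have mm: "m \<beta> s = m \<beta>' s" if "s \<in> {0..t}" for s
      unfolding m_def
      by (rule measure_negligible_symdiff[OF S_lm[OF \<beta>(2)]], rule negligible_subset[OF N])
         (use SS that in auto)
    show "agree t (\<Phi> \<beta>) (\<Phi> \<beta>')"
      unfolding agree_iff_negligible
      by (rule negligible_subset[OF N]) (use SS tr mm in \<open>auto simp: \<Phi>_def N_def\<close>)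
  qed
  have core: "ereal r \<le> exit (\<Phi> \<beta>) q' z \<and> norm (traj \<beta> q z r - traj (\<Phi> \<beta>) q' z r) \<le> K * e \<and>
      tracks r ((K + 8 / c) * e) \<beta> q z (\<Phi> \<beta>) q' z"
    if \<beta>: "\<beta> \<in> controls C" and q': "0 \<le> depth z q'" "norm (q - q') \<le> e"
      and r: "0 \<le> r" "r \<le> \<theta>" "ereal r \<le> exit \<beta> q z" for \<beta> q' r
  proof -
    define Y where "Y = traj \<beta> q z"
    define Y' where "Y' = traj (\<Phi> \<beta>) q' z"
    note \<Phi>\<beta> = \<Phi>_ctrl[OF \<beta>]
    have "compact {t \<in> {0..\<theta>}. m \<beta> t \<le> \<kappa>}"
    proof -
      have "closed {t. m \<beta> t \<le> \<kappa>}" using m_cont[OF \<beta>] by (intro closed_Collect_le) auto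
      moreover have "{t \<in> {0..\<theta>}. m \<beta> t \<le> \<kappa>} = {0..\<theta>} \<inter> {t. m \<beta> t \<le> \<kappa>}" by auto
      ultimately show ?thesis by (metis compact_Int_closed compact_Icc)
    qed
    moreover have "0 \<in> {t \<in> {0..\<theta>}. m \<beta> t \<le> \<kappa>}"
    proof -
      have "negligible (S \<beta> \<inter> {0..0})" by (rule negligible_subset[of "{0}"]) auto
      then have "m \<beta> 0 = 0" unfolding m_def by (rule negligible_imp_measure0)
      then show ?thesis using \<theta> \<kappa> by simp
    qed
    (* T is the last time in the window at which the budget is not exceeded *)
    ultimately obtain T where T: "T \<in> {0..\<theta>}" "m \<beta> T \<le> \<kappa>"
      and Tmax: "\<And>t. t \<in> {0..\<theta>} \<Longrightarrow> m \<beta> t \<le> \<kappa> \<Longrightarrow> t \<le> T"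
      using compact_attains_sup[of "{t \<in> {0..\<theta>}. m \<beta> t \<le> \<kappa>}"] by blast
    define Sk where "Sk = S \<beta> \<inter> {0..T}"
    have Sk: "t \<in> S \<beta> \<and> m \<beta> t \<le> \<kappa> \<longleftrightarrow> t \<in> Sk" for t
      using Tmax[of t] m_mono[OF \<beta>, of t T] T by (auto simp: Sk_def S_def)
    have Sk_m: "Sk \<in> lmeasurable" "measure lebesgue Sk \<le> \<kappa>"
      using S_lm[OF \<beta>] T by (auto simp: Sk_def m_def)
    have \<Phi>_eq: "\<Phi> \<beta> t = (if t \<in> Sk then sel (Y t) else \<beta> t)" for t
      using Sk[of t] by (simp add: \<Phi>_def Y_def)
    have full: "m \<beta> T = \<kappa>" if "T < \<theta>"
    proof (rule ccontr)
      assume "m \<beta> T \<noteq> \<kappa>"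
      then have lt: "m \<beta> T < \<kappa>" using T by simp
      define t where "t = min \<theta> (T + (\<kappa> - m \<beta> T))"
      have "m \<beta> t \<le> \<kappa>" using m_lip[OF \<beta>, of T t] lt that by (auto simp: t_def min_def split: if_splits)
      then have "t \<le> T" using Tmax[of t] T lt that by (auto simp: t_def)
      then show False using lt that by (auto simp: t_def min_def split: if_splits)
    qed
    have close: "norm (Y t - Y' t) \<le> K * e" if t: "t \<in> {0..\<theta>}" for t
    proof -
      have "norm (Y t - Y' t) \<le> 2 * (norm (Y 0 - Y' 0) + 2 * M * measure lebesgue Sk)"
      proof (rule integral_curves_close[where N = "{}" and L = L and b = \<theta>])
        show "Y t = Y 0 + integral {0..t} (\<lambda>s. f (Y s) z (\<beta> s))" for t
          unfolding Y_def traj_0[OF \<beta> z] by (rule traj_integral[OF \<beta> z])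
        show "Y' t = Y' 0 + integral {0..t} (\<lambda>s. f (Y' s) z (\<Phi> \<beta> s))" for t
          unfolding Y'_def traj_0[OF \<Phi>\<beta> z] by (rule traj_integral[OF \<Phi>\<beta> z])
        show "(\<lambda>s. f (Y s) z (\<beta> s)) integrable_on {0..\<theta>}" "(\<lambda>s. f (Y' s) z (\<Phi> \<beta> s)) integrable_on {0..\<theta>}"
          unfolding Y_def Y'_def using \<beta> \<Phi>\<beta> z by (auto intro: traj_integrable)
        fix s assume s: "s \<in> {0..\<theta>} - {}"
        have inC: "\<beta> s \<in> C" "\<Phi> \<beta> s \<in> C" using s \<beta> \<Phi>\<beta> by (auto intro: controls_in)
        have n0: "0 \<le> L * norm (Y s - Y' s)" using L_pos by simp
        show "norm (f (Y s) z (\<beta> s) - f (Y' s) z (\<Phi> \<beta> s)) \<le> L * norm (Y s - Y' s) + 2 * M * indicator Sk s"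
        proof (cases "s \<in> Sk")
          case True
          have "norm (f (Y s) z (\<beta> s) - f (Y' s) z (\<Phi> \<beta> s)) \<le> M + M"
            using norm_triangle_ineq4 f_bound[OF z inC(1)] f_bound[OF z inC(2)] by (meson add_mono order_trans)
          then show ?thesis using True n0 by simp
        next
          case False
          then show ?thesis using f_lips[OF z inC(1)] by (simp add: \<Phi>_eq)
        qed
      qed (use Sk_m L_pos M_pos \<theta> t in auto)
      also have "\<dots> \<le> 2 * (e + 2 * M * \<kappa>)"
        using Sk_m M_pos q' \<beta> \<Phi>\<beta> z by (intro mult_left_mono add_mono) (auto simp: Y_def Y'_def)
      also have "\<dots> = K * e" using c by (simp add: K \<kappa>_def field_simps)
      finally show ?thesis .
    qed
    have Y_norm: "norm (Y t) \<le> R" if t: "t \<in> {0..\<theta>}" for t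
    proof -
      have "norm (Y t - q) \<le> M * \<bar>t - 0\<bar>"
        using traj_lipschitz[OF \<beta> z, of q t 0] \<beta> z by (simp add: Y_def)
      also have "\<dots> \<le> M * \<theta>" using t M_pos by simp
      finally show ?thesis using norm_triangle_ineq2[of "Y t" q] q by linarith
    qed
    have Ldiff: "\<bar>rate z (Y t) b - rate z (Y' t) b\<bar> \<le> L * (K * e)" if t: "t \<in> {0..\<theta>}" "b \<in> C" for t b
      using order_trans[OF rate_lipschitz[OF z t(2)] mult_left_mono[OF close[OF t(1)]]] L_pos by auto
    have inside: "0 \<le> depth z (Y t)" if "t \<in> {0..r}" for t
      unfolding Y_def using that r
      by (intro inside_until_exit[OF \<beta> z q(1)]) (auto elim!: order_trans[rotated])
    have gapKe: "L * (K * e) * \<theta> \<le> 2 * e"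
    proof -
      have "L * (K * e) * \<theta> = (2 * L * \<theta> + (32 * L * M * \<theta>) / c) * e" by (simp add: K field_simps)
      also have "\<dots> \<le> (1 + 1) * e"
        using \<theta> c e by (intro mult_right_mono add_mono) (auto simp: divide_le_eq)
      finally show ?thesis by simp
    qed
    (* up to T the follower cannot cross the threshold; after T it is at least as deep as the leader *)
    have stay: "0 \<le> depth z (Y' s)" if s: "0 \<le> s" "s < r" for s
    proof (cases "s \<le> T")
      case True
      show ?thesis
      proof (rule ccontr)
        assume "\<not> 0 \<le> depth z (Y' s)"
        then have neg: "depth z (Y' s) < 0" by simp
        have "compact ({0..s} \<inter> {t. 0 \<le> depth z (Y' t)})"
          unfolding Y'_def
          by (intro compact_Int_closed compact_Icc closed_Collect_le depth_continuous cont[OF \<Phi>\<beta>]) auto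
        moreover have "0 \<in> {0..s} \<inter> {t. 0 \<le> depth z (Y' t)}"
          using s q' \<Phi>\<beta> z by (simp add: Y'_def)
        ultimately obtain s0 where s0: "s0 \<in> {0..s}" "0 \<le> depth z (Y' s0)"
          and last: "\<And>t. t \<in> {0..s} \<Longrightarrow> 0 \<le> depth z (Y' t) \<Longrightarrow> t \<le> s0"
          using compact_attains_sup[of "{0..s} \<inter> {t. 0 \<le> depth z (Y' t)}"] by blast
        (* from its last time s0 inside until s the follower would move inward *)
        define g where "g t = (if t = s0 then 0 else rate z (Y' t) (\<Phi> \<beta> t))" for t
        have "depth z (Y' s) - depth z (Y' s0) = integral {s0..s} (\<lambda>t. rate z (Y' t) (\<Phi> \<beta> t))"
          unfolding Y'_def using s0 by (intro rate_bound(1)[OF \<Phi>\<beta> z]) auto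
        also have "\<dots> = integral {s0..s} g"
          by (rule integral_spike[of "{s0}"]) (auto simp: g_def)
        also have "0 \<le> \<dots>"
        proof (rule Henstock_Kurzweil_Integration.integral_nonneg)
          have "(\<lambda>t. rate z (Y' t) (\<Phi> \<beta> t)) integrable_on {s0..s}"
            unfolding Y'_def using s0 by (intro rate_bound(2)[OF \<Phi>\<beta> z]) auto
          then show "g integrable_on {s0..s}"
            by (rule integrable_spike[of _ _ "{s0}"]) (auto simp: g_def)
          fix t assume t: "t \<in> {s0..s}"
          show "0 \<le> g t"
          proof (cases "t = s0")
            case False
            then have "depth z (Y' t) < 0" using last[of t] t s0 by (auto simp: not_le[symmetric])
            moreover have tr: "t \<in> {0..r}" "t \<in> {0..\<theta>}" "t \<le> T" using t s0 s r True by auto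
            moreover have "\<bar>depth z (Y t) - depth z (Y' t)\<bar> \<le> K * e"
              using order_trans[OF depth_diff[OF z] close[OF tr(2)]] .
            ultimately have near: "\<bar>depth z (Y t)\<bar> \<le> d" using inside[of t] small by linarith
            have "0 \<le> rate z (Y' t) (\<Phi> \<beta> t)"
            proof (cases "rate z (Y t) (\<beta> t) < c / 2")
              case True
              then have "t \<in> Sk" using tr near by (auto simp: Sk_def S_def Y_def)
              then show ?thesis
                using sel(1)[OF Y_norm[OF tr(2)] near] Ldiff[OF tr(2) sel(2)[of "Y t"]] small c by (simp add: \<Phi>_eq)
            next
              case False
              then have "t \<notin> Sk" by (auto simp: Sk_def S_def Y_def)
              then show ?thesis
                using Ldiff[OF tr(2) controls_in[OF \<beta>, of t]] False small c tr by (simp add: \<Phi>_eq)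
            qed
            then show ?thesis using False by (simp add: g_def)
          qed (simp add: g_def)
        qed
        finally show False using neg s0 by simp
      qed
    next
      case False
      then have Tlt: "T < \<theta>" "T < s" using s r by auto
      have s\<theta>: "s \<in> {0..\<theta>}" using s r by auto
      have intSk: "(indicator Sk :: real \<Rightarrow> real) integrable_on {0..s}"
        using Sk_m by (simp add: integrable_on_indicator fmeasurable_Int_fmeasurable fmeasurableD)
      have SkT: "Sk \<inter> {0..s} = Sk" using Tlt by (auto simp: Sk_def)
      have "integral {0..s} (\<lambda>t. c / 2 * indicator Sk t - L * (K * e))
          = c / 2 * measure lebesgue Sk - L * (K * e) * s"
        using intSk s SkT Sk_m
        by (subst Henstock_Kurzweil_Integration.integral_diff)
           (auto simp: Equivalence_Lebesgue_Henstock_Integration.integral_indicator intro!: integrable_on_mult_right)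
      moreover have "integral {0..s} (\<lambda>t. c / 2 * indicator Sk t - L * (K * e))
          \<le> integral {0..s} (\<lambda>t. rate z (Y' t) (\<Phi> \<beta> t) - rate z (Y t) (\<beta> t))"
      proof (rule integral_le)
        show "(\<lambda>t. c / 2 * indicator Sk t - L * (K * e)) integrable_on {0..s}"
          by (intro integrable_diff integrable_on_mult_right intSk) auto
        show "(\<lambda>t. rate z (Y' t) (\<Phi> \<beta> t) - rate z (Y t) (\<beta> t)) integrable_on {0..s}"
          unfolding Y_def Y'_def using s
          by (intro integrable_diff rate_bound(2)[OF \<Phi>\<beta> z] rate_bound(2)[OF \<beta> z]) auto
        fix t assume "t \<in> {0..s}"
        then have t: "t \<in> {0..\<theta>}" using s\<theta> by auto
        show "c / 2 * indicator Sk t - L * (K * e) \<le> rate z (Y' t) (\<Phi> \<beta> t) - rate z (Y t) (\<beta> t)"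
        proof (cases "t \<in> Sk")
          case True
          then have "\<bar>depth z (Y t)\<bar> \<le> d" "rate z (Y t) (\<beta> t) < c / 2" by (auto simp: Sk_def S_def Y_def)
          then show ?thesis
            using sel(1)[OF Y_norm[OF t]] Ldiff[OF t sel(2)[of "Y t"]] True by (simp add: \<Phi>_eq)
        next
          case False
          then show ?thesis using Ldiff[OF t controls_in[OF \<beta>, of t]] t by (simp add: \<Phi>_eq)
        qed
      qed
      moreover have "integral {0..s} (\<lambda>t. rate z (Y' t) (\<Phi> \<beta> t) - rate z (Y t) (\<beta> t)) =
          (depth z (Y' s) - depth z (Y' 0)) - (depth z (Y s) - depth z (Y 0))"
        unfolding Y_def Y'_def using s
        by (subst Henstock_Kurzweil_Integration.integral_diff)
           (auto simp: rate_bound(1)[OF \<Phi>\<beta> z] rate_bound(1)[OF \<beta> z] intro!: rate_bound(2)[OF \<Phi>\<beta> z] rate_bound(2)[OF \<beta> z])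
      moreover have "c / 2 * measure lebesgue Sk = 4 * e"
        using full[OF Tlt(1)] c by (simp add: Sk_def m_def \<kappa>_def)
      moreover have "L * (K * e) * s \<le> 2 * e"
        using order_trans[OF mult_left_mono[of s \<theta> "L * (K * e)"] gapKe] s\<theta> L_pos K2 e by auto
      moreover have "\<bar>depth z (Y 0) - depth z (Y' 0)\<bar> \<le> e"
        using order_trans[OF depth_diff[OF z, of q q'] q'(2)] \<beta> \<Phi>\<beta> z by (simp add: Y_def Y'_def)
      moreover have "0 \<le> depth z (Y s)" using inside[of s] s by simp
      ultimately show ?thesis using e by linarith
    qed
    have ex': "ereal r \<le> exit (\<Phi> \<beta>) q' z"
      using stay by (intro exit_geI[OF z]) (auto simp: Y'_def)
    have "tracks r ((K + 8 / c) * e) \<beta> q z (\<Phi> \<beta>) q' z"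
      unfolding tracks_def
    proof (intro exI[of _ Sk] conjI allI impI)
      show "Sk \<in> lmeasurable" by (rule Sk_m)
      have le: "\<kappa> \<le> (K + 8 / c) * e" "K * e \<le> (K + 8 / c) * e"
        using K2 e c by (auto simp: \<kappa>_def algebra_simps)
      then show "measure lebesgue Sk \<le> (K + 8 / c) * e" using Sk_m by linarith
      fix t assume t: "0 < t \<and> t \<le> r \<and> t \<notin> Sk"
      then have "ereal t \<le> ereal r" by simp
      then have te: "ereal t \<le> exit \<beta> q z" "ereal t \<le> exit (\<Phi> \<beta>) q' z"
        using r ex' order_trans by blast+
      show "lb \<beta> q z t = lb (\<Phi> \<beta>) q' z t" using te by (simp add: label_until_exit)
      show "\<beta> t = \<Phi> \<beta> t" using t by (simp add: \<Phi>_eq)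
      show "norm (st \<beta> q z t - st (\<Phi> \<beta>) q' z t) \<le> (K + 8 / c) * e"
        using close[of t] t r te le by (simp add: state_until_exit Y_def Y'_def)
    qed
    then show ?thesis using ex' close[of r] r by (simp add: Y_def Y'_def)
  qed
  show ?thesis
  proof (intro bexI[OF _ \<Phi>] ballI allI impI)
    fix \<beta> \<beta>' q' r
    assume *: "\<beta> \<in> controls C" "\<beta>' \<in> controls C" "0 \<le> depth z q'" "norm (q - q') \<le> e" "0 \<le> r" "r \<le> \<theta>"
      "ereal r \<le> exit \<beta> q z" "agree r (\<Phi> \<beta>) \<beta>'"
    note c = core[OF *(1,3-7)]
    note \<Phi>\<beta> = \<Phi>_ctrl[OF *(1)]
    show "ereal r \<le> exit \<beta>' q' z \<and> norm (traj \<beta> q z r - traj \<beta>' q' z r) \<le> K * e \<and>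
      tracks r ((K + 8 / c) * e) \<beta> q z \<beta>' q' z"
      using c exit_agree_ge[OF \<Phi>\<beta> *(2) z *(8), of q'] traj_agree[OF \<Phi>\<beta> *(2) z *(8), of r q'] *(5)
        tracks_agree[OF _ *(8) \<Phi>\<beta> *(2) z *(3)] by auto
  qed
qed

text \<open>Now the leader has just switched to \<open>- z\<close> near the threshold and the follower still has label
  \<open>z\<close>. A constant outward push makes the follower cross the threshold within a time of the order of the
  distance; afterwards both have the same label, are far from the next threshold, and use the same control.\<close>

lemma mismatch_step:
  assumes P: "push R c d" and c: "0 < c" and z: "z \<in> {-1, 1}"
    and \<theta>: "0 < \<theta>" "2 * L * \<theta> \<le> 1" "M * \<theta> \<le> gap / 2"
    and q: "\<bar>depth z q\<bar> \<le> e" "norm q \<le> R"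
    and e: "0 < e" "e \<le> d" "e \<le> gap / 2" "8 * e / c \<le> \<theta>" "L * (e + M * (8 * e / c)) \<le> c / 2"
    and K: "K = 2 + 32 * M / c"
  shows "\<exists>\<Phi>\<in>strategies C C. \<forall>\<beta>\<in>controls C. \<forall>\<beta>'\<in>controls C. \<forall>q'.
    0 \<le> depth z q' \<longrightarrow> norm (q - q') \<le> e \<longrightarrow> agree \<theta> (\<Phi> \<beta>) \<beta>' \<longrightarrow>
      tracks \<theta> ((K + 8 / c) * e) \<beta> q (- z) \<beta>' q' z \<and>
      restarts \<theta> \<beta> q (- z) (traj \<beta> q (- z) \<theta>) (- z) \<and> 0 \<le> depth (- z) (traj \<beta> q (- z) \<theta>) \<and>
      (\<exists>p'. 0 \<le> depth (- z) p' \<and> norm (traj \<beta> q (- z) \<theta> - p') \<le> K * e \<and> restarts \<theta> \<beta>' q' z p' (- z))"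
proof -
  have K2: "2 \<le> K" using K c M_pos by simp
  have z': "- z \<in> {-1, 1}" using z by auto
  obtain sel where sel: "\<And>y. norm y \<le> R \<Longrightarrow> \<bar>depth z y\<bar> \<le> d \<Longrightarrow> c \<le> - 1 * rate z y (sel y)" "\<And>y. sel y \<in> C"
    by (rule pushE[OF P z, of "- 1"]) blast+
  define h where "h = 8 * e / c"
  have h: "0 < h" "h \<le> \<theta>" using e c by (auto simp: h_def)
  define b where "b = sel q"
  have b: "b \<in> C" "c \<le> - rate z q b" using sel[of q] q e by (auto simp: b_def)
  define B where "B = (\<lambda>_::real. b)"
  have B: "B \<in> controls C" unfolding B_def using b by (rule_tac const_control) auto
  define \<Phi> where "\<Phi> \<beta> t = (if t \<le> h then B t else \<beta> t)" for \<beta> t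
  have \<Phi>_ctrl: "\<Phi> \<beta> \<in> controls C" if \<beta>: "\<beta> \<in> controls C" for \<beta>
  proof -
    have "{t \<in> {0..}. t \<le> h} = {0..h}" by auto
    then have "{t \<in> {0..}. t \<le> h} \<in> sets lebesgue" by simp
    then show ?thesis unfolding \<Phi>_def[abs_def] by (rule If_control[OF B \<beta>])
  qed
  have \<Phi>: "\<Phi> \<in> strategies C C"
  proof (rule strategiesI[OF \<Phi>_ctrl])
    fix t and \<beta> \<beta>' :: "real \<Rightarrow> 'c" assume ag: "agree t \<beta> \<beta>'"
    show "agree t (\<Phi> \<beta>) (\<Phi> \<beta>')"
      using ag unfolding agree_iff_negligible by (rule negligible_subset) (auto simp: \<Phi>_def)
  qed
  show ?thesis
  proof (intro bexI[OF _ \<Phi>] ballI allI impI)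
    fix \<beta> \<beta>' q'
    assume \<beta>: "\<beta> \<in> controls C" and \<beta>': "\<beta>' \<in> controls C" and q': "0 \<le> depth z q'" "norm (q - q') \<le> e"
      and ag: "agree \<theta> (\<Phi> \<beta>) \<beta>'"
    have agB: "agree h B \<beta>'"
    proof -
      have "agree h B (\<Phi> \<beta>)" by (rule agreeI) (auto simp: \<Phi>_def)
      then show ?thesis using agree_mono[OF ag h(2)] by (rule agree_trans)
    qed
    (* depth at most 2 * e at the start, decreasing at rate at least c / 2: outside after 6 * e / c *)
    have "exit B q' z < ereal h"
      unfolding exit_less_iff[OF z]
    proof (intro exI[of _ "6 * e / c"] conjI)
      let ?s = "6 * e / c"
      show s0: "0 \<le> ?s" and "?s < h" using e c by (auto simp: h_def field_simps)
      have "integral {0..?s} (\<lambda>r. rate z (traj B q' z r) (B r)) \<le> integral {0..?s} (\<lambda>r. - c / 2)"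
      proof (rule integral_le)
        show "(\<lambda>r. rate z (traj B q' z r) (B r)) integrable_on {0..?s}"
          using s0 by (intro rate_bound(2)[OF B z]) auto
        fix r assume r: "r \<in> {0..?s}"
        have "norm (traj B q' z r - q') \<le> M * \<bar>r - 0\<bar>"
          using traj_lipschitz[OF B z, of q' r 0] B z by simp
        also have "\<dots> \<le> M * h" using r M_pos \<open>?s < h\<close> by (intro mult_left_mono) auto
        finally have "norm (traj B q' z r - q) \<le> e + M * h"
          using q'(2) norm_triangle_ineq[of "traj B q' z r - q'" "q' - q"] by (simp add: norm_minus_commute)
        then have "L * norm (traj B q' z r - q) \<le> c / 2"
          using order_trans[OF mult_left_mono e(5)] L_pos by (auto simp: h_def)
        then have "\<bar>rate z (traj B q' z r) b - rate z q b\<bar> \<le> c / 2"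
          using rate_lipschitz[OF z b(1), of "traj B q' z r" q] by linarith
        then show "rate z (traj B q' z r) (B r) \<le> - c / 2"
          unfolding B_def using b(2) by linarith
      qed auto
      also have "\<dots> = - (3 * e)" using s0 c by simp
      also have "integral {0..?s} (\<lambda>r. rate z (traj B q' z r) (B r)) = depth z (traj B q' z ?s) - depth z q'"
        using rate_bound(1)[OF B z order_refl s0, of q'] B z by simp
      finally show "depth z (traj B q' z ?s) < 0"
        using order_trans[OF depth_diff[OF z] q'(2)] q e by fastforce
    qed
    then have "exit B q' z = exit \<beta>' q' z" "exit \<beta>' q' z < ereal h"
      using exit_agree[OF B \<beta>' z agB, of q'] by auto
    then obtain T where T: "exit \<beta>' q' z = ereal T" "T < h" "0 \<le> T"
      using exit_nonneg[OF z, of \<beta>' q'] by (cases "exit \<beta>' q' z") auto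
    define p1 where "p1 = traj \<beta>' q' z T"
    have sT: "shift T \<beta>' \<in> controls C" using \<beta>' T by (intro shift_control) auto
    have p1: "depth (- z) p1 = gap" unfolding p1_def by (rule depth_after_switch[OF \<beta>' z q'(1) T(1)])
    have \<theta>gap: "\<theta> \<le> gap / 2 / M" using \<theta> M_pos by (simp add: field_simps)
    have exq: "ereal \<theta> \<le> exit \<beta> q (- z)"
    proof -
      have "gap / 2 \<le> depth (- z) q" using q e depth_opposite[OF z, of q] by simp
      then have "\<theta> \<le> depth (- z) q / M" using \<theta>gap divide_right_mono[of "gap / 2" "depth (- z) q" M] M_pos by simp
      then show ?thesis using exit_lower_bound[OF \<beta> z', of q] by (meson ereal_less_eq(3) order_trans)
    qed
    have exp1: "ereal \<theta> \<le> exit (shift T \<beta>') p1 (- z)"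
    proof -
      have "gap / 2 \<le> gap" using gap_pos by simp
      then have "\<theta> \<le> depth (- z) p1 / M" using \<theta>gap divide_right_mono[of "gap / 2" gap M] M_pos p1 by simp
      then show ?thesis using exit_lower_bound[OF sT z', of p1] by (meson ereal_less_eq(3) order_trans)
    qed
    have q0: "0 \<le> depth (- z) q" using q e depth_opposite[OF z, of q] gap_pos by simp
    define X where "X = traj \<beta> q (- z)"
    define X' where "X' t = traj (shift T \<beta>') p1 (- z) (t - T)" for t
    have close: "norm (X t - X' t) \<le> K * e" if t: "h \<le> t" "t \<le> \<theta>" for t
    proof -
      have shh: "shift h \<beta> \<in> controls C" "shift h \<beta>' \<in> controls C" using \<beta> \<beta>' h by (auto intro: shift_control)
      have 1: "X t = traj (shift h \<beta>) (X h) (- z) (t - h)"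
        using traj_restart[OF \<beta> z', of h "t - h" q] h t by (simp add: X_def)
      have 2: "X' t = traj (shift h \<beta>') (X' h) (- z) (t - h)"
        using traj_restart[OF sT z', of "h - T" "t - h" p1] T t by (simp add: X'_def)
      have "agree (\<theta> - h) (shift h (\<Phi> \<beta>)) (shift h \<beta>)"
        unfolding agree_iff_negligible by (rule negligible_subset[of "{0}"]) (auto simp: shift_def \<Phi>_def)
      moreover have "agree (\<theta> - h) (shift h (\<Phi> \<beta>)) (shift h \<beta>')"
        using ag h by (intro agree_shift) auto
      ultimately have ag': "agree (\<theta> - h) (shift h \<beta>) (shift h \<beta>')" by (meson agree_sym agree_trans)
      have "L * (\<theta> - h) \<le> L * \<theta>" using h L_pos by simp
      then have "2 * L * (\<theta> - h) \<le> 1" using \<theta> by simp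
      then have d0: "norm (X t - X' t) \<le> 2 * norm (X h - X' h)"
        unfolding 1 2 using t by (intro traj_close[OF shh z' ag']) auto
      have d1: "norm (X h - X' h) \<le> norm (X h - q) + norm (q - q') + norm (p1 - q') + norm (X' h - p1)"
        using norm_triangle_ineq4[of "(X h - q) + (q - q')" "(p1 - q') + (X' h - p1)"]
          norm_triangle_ineq[of "X h - q" "q - q'"] norm_triangle_ineq[of "p1 - q'" "X' h - p1"] by simp
      have d2: "norm (X h - q) \<le> M * h"
        using traj_lipschitz[OF \<beta> z', of q h 0] \<beta> z' h by (simp add: X_def)
      have d3: "norm (p1 - q') \<le> M * T"
        using traj_lipschitz[OF \<beta>' z, of q' T 0] \<beta>' z T by (simp add: p1_def)
      have d4: "norm (X' h - p1) \<le> M * (h - T)"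
        using traj_lipschitz[OF sT z', of p1 "h - T" 0] sT z' T by (simp add: X'_def)
      have "norm (X t - X' t) \<le> 2 * (M * h + e + M * T + M * (h - T))"
        by (rule order_trans[OF d0 mult_left_mono[OF order_trans[OF d1 add_mono[OF add_mono[OF add_mono[OF d2 q'(2)] d3] d4]]]]) simp
      also have "\<dots> = K * e" using c by (simp add: K h_def field_simps)
      finally show ?thesis .
    qed
    have after: "st \<beta>' q' z t = X' t" "lb \<beta>' q' z t = - z" if t: "h \<le> t" "t \<le> \<theta>" for t
    proof -
      have "ereal (t - T) \<le> ereal \<theta>" using t T by simp
      then have "ereal (t - T) \<le> exit (shift T \<beta>') p1 (- z)" using exp1 by (rule order_trans)
      then show "st \<beta>' q' z t = X' t" "lb \<beta>' q' z t = - z"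
        using state_after_exit[OF \<beta>' z q'(1) T(1), of t] label_after_exit[OF \<beta>' z q'(1) T(1), of t] t T
        by (auto simp: p1_def[symmetric] X'_def state_until_exit label_until_exit)
    qed
    have le: "h \<le> (K + 8 / c) * e" "K * e \<le> (K + 8 / c) * e"
      using K2 e c by (auto simp: h_def algebra_simps)
    have "tracks \<theta> ((K + 8 / c) * e) \<beta> q (- z) \<beta>' q' z"
    proof -
      define N where "N = {s \<in> {0..\<theta>}. \<Phi> \<beta> s \<noteq> \<beta>' s}"
      have N: "negligible N" using ag by (simp add: N_def agree_iff_negligible)
      have m: "measure lebesgue ({0..h} \<union> N) = measure lebesgue {0..h}"
        by (rule measure_negligible_symdiff) (simp, rule negligible_subset[OF N], auto)
      show ?thesis unfolding tracks_def
      proof (intro exI[of _ "{0..h} \<union> N"] conjI allI impI)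
        show "{0..h} \<union> N \<in> lmeasurable"
          using negligible_imp_measurable[OF N] by (intro fmeasurable.Un) auto
        show "measure lebesgue ({0..h} \<union> N) \<le> (K + 8 / c) * e" using m le h by simp
        fix t assume t: "0 < t \<and> t \<le> \<theta> \<and> t \<notin> {0..h} \<union> N"
        then have th: "h \<le> t" "t \<le> \<theta>" by auto
        have "ereal t \<le> ereal \<theta>" using th by simp
        then have te: "ereal t \<le> exit \<beta> q (- z)" using exq by (rule order_trans)
        show "lb \<beta> q (- z) t = lb \<beta>' q' z t" using te after[OF th] by (simp add: label_until_exit)
        show "\<beta> t = \<beta>' t" using t by (auto simp: N_def \<Phi>_def)
        show "norm (st \<beta> q (- z) t - st \<beta>' q' z t) \<le> (K + 8 / c) * e"
          using close[OF th] le after[OF th] te by (simp add: state_until_exit X_def)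
      qed
    qed
    moreover have "restarts \<theta> \<beta> q (- z) (traj \<beta> q (- z) \<theta>) (- z)"
      using \<theta> by (intro restartsI[OF \<beta> z' q0 _ exq]) auto
    moreover have "0 \<le> depth (- z) (traj \<beta> q (- z) \<theta>)"
      using \<theta> by (intro inside_until_exit[OF \<beta> z' q0 _ exq]) auto
    moreover have "restarts \<theta> \<beta>' q' z (X' \<theta>) (- z)"
    proof -
      have lt: "ereal (\<theta> - T) \<le> exit (shift T \<beta>') p1 (- z)"
        using exp1 T by (intro order_trans[OF _ exp1]) auto
      have "restarts T \<beta>' q' z p1 (- z)"
        unfolding p1_def using T by (intro restartsI[OF \<beta>' z q'(1)]) auto
      moreover have "restarts (\<theta> - T) (shift T \<beta>') p1 (- z) (X' \<theta>) (- z)"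
        unfolding X'_def using T h p1 gap_pos by (intro restartsI[OF sT z' _ _ lt]) auto
      ultimately show ?thesis using restarts_trans[of T \<beta>' q' z p1 "- z" "\<theta> - T"] T h by simp
    qed
    moreover have "0 \<le> depth (- z) (X' \<theta>)"
    proof -
      have lt: "ereal (\<theta> - T) \<le> exit (shift T \<beta>') p1 (- z)"
        using exp1 T by (intro order_trans[OF _ exp1]) auto
      show ?thesis unfolding X'_def using T h p1 gap_pos by (intro inside_until_exit[OF sT z' _ _ lt]) auto
    qed
    moreover have "norm (traj \<beta> q (- z) \<theta> - X' \<theta>) \<le> K * e" using close[of \<theta>] h by (simp add: X_def)
    ultimately show "tracks \<theta> ((K + 8 / c) * e) \<beta> q (- z) \<beta>' q' z \<and>
      restarts \<theta> \<beta> q (- z) (traj \<beta> q (- z) \<theta>) (- z) \<and> 0 \<le> depth (- z) (traj \<beta> q (- z) \<theta>) \<and>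
      (\<exists>p'. 0 \<le> depth (- z) p' \<and> norm (traj \<beta> q (- z) \<theta> - p') \<le> K * e \<and> restarts \<theta> \<beta>' q' z p' (- z))"
      by blast
  qed
qed

end

section \<open>Tracking over a finite horizon\<close>

lemma agree_splice_self: "agree r (splice r \<alpha> \<beta>) \<alpha>"
  by (rule agreeI) (simp add: splice_def)

lemma agree_shift_splice: "agree t (shift r (splice r \<alpha> \<beta>)) \<beta>"
  unfolding agree_iff_negligible by (rule negligible_subset[of "{0}"]) (auto simp: shift_def splice_def)

text \<open>Several upper bounds on a small parameter can be met at once by taking it from this filter.\<close>

lemma eventually_small_multiple: "0 < b \<Longrightarrow> \<forall>\<^sub>F x in at_right (0::real). a * x \<le> b"
proof -
  assume b: "0 < b"
  have "((\<lambda>x. a * x) \<longlongrightarrow> 0) (at_right (0::real))" by (auto intro!: tendsto_eq_intros)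
  then have "\<forall>\<^sub>F x in at_right (0::real). a * x < b" by (rule order_tendstoD(2)) (rule b)
  then show ?thesis by (rule eventually_mono) simp
qed

context thermostat
begin

text \<open>The control \<open>\<beta>'\<close> stands for \<open>\<Phi> \<beta>\<close> up to null sets and beyond the horizon \<open>T\<close>, so that \<open>\<Phi> \<beta>\<close> can be
  used as the continuation of a spliced control.\<close>

definition trackable :: "real \<Rightarrow> real \<Rightarrow> real ^ 'n \<Rightarrow> int \<Rightarrow> int \<Rightarrow> real \<Rightarrow> ((real \<Rightarrow> 'c) \<Rightarrow> (real \<Rightarrow> 'c)) \<Rightarrow> bool" where
  "trackable T e q z z' \<delta> \<Phi> \<longleftrightarrow> \<Phi> \<in> strategies C C \<and> (\<forall>\<beta>\<in>controls C. \<forall>\<beta>'\<in>controls C. \<forall>q'.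
     agree T (\<Phi> \<beta>) \<beta>' \<longrightarrow> 0 \<le> depth z' q' \<longrightarrow> norm (q - q') \<le> \<delta> \<longrightarrow> tracks T e \<beta> q z \<beta>' q' z')"

lemma trackableI:
  assumes "\<Phi> \<in> strategies C C" "z' \<in> {-1, 1}"
    and "\<And>\<beta> q'. \<beta> \<in> controls C \<Longrightarrow> 0 \<le> depth z' q' \<Longrightarrow> norm (q - q') \<le> \<delta> \<Longrightarrow> tracks T e \<beta> q z (\<Phi> \<beta>) q' z'"
  shows "trackable T e q z z' \<delta> \<Phi>"
  using assms strategies_control[OF assms(1)] unfolding trackable_def by (auto intro: tracks_agree)

lemma trackable_mono:
  assumes "trackable T e q z z' \<delta> \<Phi>" "e \<le> e'" "\<delta>' \<le> \<delta>"
  shows "trackable T e' q z z' \<delta>' \<Phi>"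
  unfolding trackable_def
proof (intro conjI ballI allI impI)
  show "\<Phi> \<in> strategies C C" using assms(1) by (simp add: trackable_def)
  fix \<beta> \<beta>' q'
  assume *: "\<beta> \<in> controls C" "\<beta>' \<in> controls C" "agree T (\<Phi> \<beta>) \<beta>'" "0 \<le> depth z' q'" "norm (q - q') \<le> \<delta>'"
  have "norm (q - q') \<le> \<delta>" using *(5) assms(3) by (rule order_trans)
  then have "tracks T e \<beta> q z \<beta>' q' z'" using assms(1) * unfolding trackable_def by blast
  then show "tracks T e' \<beta> q z \<beta>' q' z'" using order_refl assms(2) by (rule tracks_mono)
qed

text \<open>Outside the domain in which tracking is known to be possible, the leader's control is copied, so that
  \<open>tracker\<close> is a strategy unconditionally.\<close>

definition tracker where
  "tracker T e q z z' \<delta> = (if \<exists>\<Phi>. trackable T e q z z' \<delta> \<Phi> then SOME \<Phi>. trackable T e q z z' \<delta> \<Phi> else (\<lambda>\<beta>. \<beta>))"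

lemma tracker_trackable:
  assumes "\<exists>\<Phi>. trackable T e q z z' \<delta> \<Phi>"
  shows "trackable T e q z z' \<delta> (tracker T e q z z' \<delta>)"
  unfolding tracker_def if_P[OF assms] by (rule someI_ex[OF assms])

lemma tracker_strategy: "tracker T e q z z' \<delta> \<in> strategies C C"
  using tracker_trackable[of T e q z z' \<delta>]
  by (cases "\<exists>\<Phi>. trackable T e q z z' \<delta> \<Phi>") (auto simp: trackable_def tracker_def id_strategy)

lemma tracker_control: "\<beta> \<in> controls C \<Longrightarrow> tracker T e q z z' \<delta> \<beta> \<in> controls C"
  by (rule strategies_control[OF tracker_strategy])

lemma trackerD:
  assumes "\<exists>\<Phi>. trackable T e q z z' \<delta> \<Phi>" "\<beta> \<in> controls C" "\<beta>' \<in> controls C"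
    "\<And>t. agree t \<beta>' (tracker T e q z z' \<delta> \<beta>)" "0 \<le> depth z' q'" "norm (q - q') \<le> \<delta>"
  shows "tracks T e \<beta> q z \<beta>' q' z'"
  using tracker_trackable[OF assms(1)] assms(2-6) agree_sym unfolding trackable_def by metis

text \<open>Induction on the number of windows of length \<open>\<theta>\<close>. A window with equal labels ends after time \<open>\<theta>\<close> or
  when the leader switches, whichever comes first; in the second case a window with different labels
  follows, which takes exactly time \<open>\<theta>\<close> and restores equality. So each unit of \<open>n\<close> costs at most two windows,
  and \<open>2 * real n * (M * \<theta>)\<close> bounds the distance travelled, which keeps everything in the ball of radius \<open>R\<close>
  in which the push is available.\<close>

lemma tracking_steps:
  assumes P: "push R c d" and c: "0 < c" and d: "0 < d"
    and \<theta>: "0 < \<theta>" "2 * L * \<theta> \<le> 1" "32 * L * M * \<theta> \<le> c" "M * \<theta> \<le> gap / 2" and e: "0 < e"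
  shows "\<exists>\<delta>>0.
    (\<forall>q. \<forall>z\<in>{-1, 1}. 0 \<le> depth z q \<longrightarrow> norm q + 2 * real n * (M * \<theta>) \<le> R \<longrightarrow>
       (\<exists>\<Phi>. trackable (real n * \<theta>) e q z z \<delta> \<Phi>)) \<and>
    (\<forall>q. \<forall>z\<in>{-1, 1}. \<bar>depth z q\<bar> \<le> \<delta> \<longrightarrow> norm q + 2 * real n * (M * \<theta>) \<le> R + M * \<theta> \<longrightarrow>
       (\<exists>\<Phi>. trackable (real n * \<theta>) e q (- z) z \<delta> \<Phi>))"
  using e
proof (induction n arbitrary: e)
  case 0
  have "trackable (real 0 * \<theta>) e q z z' \<delta> (\<lambda>\<beta>. \<beta>)" for q z z' \<delta>
    using 0 by (auto simp: trackable_def id_strategy tracks_def intro!: exI[of _ "{}"])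
  then have "\<exists>\<Phi>. trackable (real 0 * \<theta>) e q z z' \<delta> \<Phi>" for q z z' \<delta> by blast
  then show ?case by (intro exI[of _ "1::real"] conjI allI ballI impI) auto
next
  case (Suc n)
  define K where "K = 2 + 32 * M / c"
  have K2: "2 \<le> K" using c M_pos by (simp add: K_def)
  have M\<theta>: "0 < M * \<theta>" using M_pos \<theta> by simp
  obtain \<delta>' where \<delta>': "0 < \<delta>'"
    and match: "\<And>q z. z \<in> {-1, 1} \<Longrightarrow> 0 \<le> depth z q \<Longrightarrow> norm q + 2 * real n * (M * \<theta>) \<le> R \<Longrightarrow>
       \<exists>\<Phi>. trackable (real n * \<theta>) (e / 3) q z z \<delta>' \<Phi>"
    using Suc.IH[of "e / 3"] Suc.prems by auto
  have Sn: "real (Suc n) * \<theta> = \<theta> + real n * \<theta>" by (simp add: algebra_simps)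
  have "\<forall>\<^sub>F x in at_right (0::real). 1 * x \<le> d \<and> 1 * x \<le> gap / 2 \<and> (8 / c) * x \<le> \<theta> \<and>
      L * (1 + M * (8 / c)) * x \<le> c / 2 \<and> (K + 8 / c) * x \<le> e / 3 \<and> K * x \<le> \<delta>'"
    using Suc.prems c d gap_pos \<theta> \<delta>' by (intro eventually_conj eventually_small_multiple) auto
  then have "\<forall>\<^sub>F x in at_right (0::real). (1 * x \<le> d \<and> 1 * x \<le> gap / 2 \<and> (8 / c) * x \<le> \<theta> \<and>
      L * (1 + M * (8 / c)) * x \<le> c / 2 \<and> (K + 8 / c) * x \<le> e / 3 \<and> K * x \<le> \<delta>') \<and> 0 < x"
    using eventually_at_right_less[of "0::real"] by eventually_elim auto
  (* e1 is the admissible distance when the labels differ, e2 when they agree *)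
  then obtain e1 where *: "(1 * e1 \<le> d \<and> 1 * e1 \<le> gap / 2 \<and> (8 / c) * e1 \<le> \<theta> \<and>
      L * (1 + M * (8 / c)) * e1 \<le> c / 2 \<and> (K + 8 / c) * e1 \<le> e / 3 \<and> K * e1 \<le> \<delta>') \<and> 0 < e1"
    using eventually_happens'[OF trivial_limit_at_right_real] by blast
  have eq: "L * (1 + M * (8 / c)) * e1 = L * (e1 + M * (8 * e1 / c))" by (simp add: algebra_simps)
  have "L * (e1 + M * (8 * e1 / c)) \<le> c / 2" using * unfolding eq by blast
  with * have e1: "0 < e1" "e1 \<le> d" "e1 \<le> gap / 2" "8 * e1 / c \<le> \<theta>"
      "L * (e1 + M * (8 * e1 / c)) \<le> c / 2" "(K + 8 / c) * e1 \<le> e / 3" "K * e1 \<le> \<delta>'"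
    by simp_all
  have mismatch: "\<exists>\<Phi>. trackable (real (Suc n) * \<theta>) (2 * e / 3) q (- z) z e1 \<Phi>"
    if z: "z \<in> {-1, 1}" and q: "\<bar>depth z q\<bar> \<le> e1" "norm q + 2 * real (Suc n) * (M * \<theta>) \<le> R + M * \<theta>" for q z
  proof -
    have z': "- z \<in> {-1, 1}" using z by auto
    have nM: "0 \<le> real n * (M * \<theta>)" using M\<theta> by simp
    have "norm q \<le> R" using q(2) M\<theta> nM by (simp add: algebra_simps)
    from mismatch_step[OF P c z \<theta>(1,2,4) q(1) this e1(1-5) K_def]
    obtain \<Phi>1 where \<Phi>1: "\<Phi>1 \<in> strategies C C"
      and step: "\<And>\<beta> \<beta>' q'. \<beta> \<in> controls C \<Longrightarrow> \<beta>' \<in> controls C \<Longrightarrow> 0 \<le> depth z q' \<Longrightarrow> norm (q - q') \<le> e1 \<Longrightarrow>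
        agree \<theta> (\<Phi>1 \<beta>) \<beta>' \<Longrightarrow>
        tracks \<theta> ((K + 8 / c) * e1) \<beta> q (- z) \<beta>' q' z \<and>
        restarts \<theta> \<beta> q (- z) (traj \<beta> q (- z) \<theta>) (- z) \<and> 0 \<le> depth (- z) (traj \<beta> q (- z) \<theta>) \<and>
        (\<exists>p'. 0 \<le> depth (- z) p' \<and> norm (traj \<beta> q (- z) \<theta> - p') \<le> K * e1 \<and> restarts \<theta> \<beta>' q' z p' (- z))"
      by blast
    define F where "F \<beta> = tracker (real n * \<theta>) (e / 3) (traj \<beta> q (- z) \<theta>) (- z) (- z) \<delta>'" for \<beta>
    define \<Psi> where "\<Psi> \<beta> = F \<beta> (shift \<theta> \<beta>)" for \<beta>
    define \<Phi> where "\<Phi> \<beta> = splice \<theta> (\<Phi>1 \<beta>) (\<Psi> \<beta>)" for \<beta>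
    have \<Psi>: "\<Psi> \<beta> \<in> controls C" if "\<beta> \<in> controls C" for \<beta>
      unfolding \<Psi>_def F_def using that \<theta> by (intro tracker_control shift_control) auto
    have "(\<lambda>\<beta>. if ereal \<theta> = \<infinity> then \<Phi>1 \<beta> else splice (real_of_ereal (ereal \<theta>)) (\<Phi>1 \<beta>) (\<Psi> \<beta>)) \<in> strategies C C"
    proof (rule splice_strategy[OF \<Phi>1 \<Psi>])
      fix \<beta> \<beta>' t
      assume \<beta>: "\<beta> \<in> controls C" "\<beta>' \<in> controls C" and ag: "agree t \<beta> \<beta>'" and lt: "ereal \<theta> < ereal t"
      have "traj \<beta> q (- z) \<theta> = traj \<beta>' q (- z) \<theta>"
        using traj_agree[OF \<beta> z' ag, of \<theta>] \<theta> lt by simp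
      moreover have "agree (t - \<theta>) (shift \<theta> \<beta>) (shift \<theta> \<beta>')" using ag \<theta> by (intro agree_shift) auto
      ultimately show "ereal \<theta> = ereal \<theta> \<and> agree (t - real_of_ereal (ereal \<theta>)) (\<Psi> \<beta>) (\<Psi> \<beta>')"
        unfolding \<Psi>_def F_def using strategies_agree[OF tracker_strategy] \<beta> \<theta> by (simp add: shift_control)
    qed (use \<theta> in auto)
    then have \<Phi>: "\<Phi> \<in> strategies C C" by (simp add: \<Phi>_def[abs_def])
    have "trackable (real (Suc n) * \<theta>) (2 * e / 3) q (- z) z e1 \<Phi>"
    proof (rule trackableI[OF \<Phi> z])
      fix \<beta> q' assume \<beta>: "\<beta> \<in> controls C" and q': "0 \<le> depth z q'" "norm (q - q') \<le> e1"
      note \<Phi>\<beta> = strategies_control[OF \<Phi> \<beta>]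
      let ?p = "traj \<beta> q (- z) \<theta>"
      have "agree \<theta> (\<Phi>1 \<beta>) (\<Phi> \<beta>)" unfolding \<Phi>_def by (intro agree_sym[OF agree_splice_self])
      from step[OF \<beta> \<Phi>\<beta> q' this] obtain p' where
        s: "tracks \<theta> ((K + 8 / c) * e1) \<beta> q (- z) (\<Phi> \<beta>) q' z" "restarts \<theta> \<beta> q (- z) ?p (- z)"
          "0 \<le> depth (- z) ?p" and p': "0 \<le> depth (- z) p'" "norm (?p - p') \<le> K * e1" "restarts \<theta> (\<Phi> \<beta>) q' z p' (- z)"
        by blast
      have "norm (?p - q) \<le> M * \<theta>"
        using traj_lipschitz[OF \<beta> z', of q \<theta> 0] \<beta> z' \<theta> by simp
      then have "norm ?p \<le> norm q + M * \<theta>" using norm_triangle_ineq2[of ?p q] by linarith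
      then have "norm ?p + 2 * real n * (M * \<theta>) \<le> R" using q(2) by (simp add: algebra_simps)
      then have "\<exists>\<Phi>. trackable (real n * \<theta>) (e / 3) ?p (- z) (- z) \<delta>' \<Phi>" by (rule match[OF z' s(3)])
      then have "tracks (real n * \<theta>) (e / 3) (shift \<theta> \<beta>) ?p (- z) (shift \<theta> (\<Phi> \<beta>)) p' (- z)"
      proof (rule trackerD)
        show "agree t (shift \<theta> (\<Phi> \<beta>)) (tracker (real n * \<theta>) (e / 3) ?p (- z) (- z) \<delta>' (shift \<theta> \<beta>))" for t
          unfolding \<Phi>_def \<Psi>_def F_def by (rule agree_shift_splice)
      qed (use \<beta> \<Phi>\<beta> \<theta> p' e1 in \<open>auto intro: shift_control\<close>)
      then have "tracks (\<theta> + real n * \<theta>) (e / 3 + e / 3) \<beta> q (- z) (\<Phi> \<beta>) q' z"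
        using Suc.prems e1 by (intro tracks_append[OF tracks_mono[OF s(1) order_refl] _ s(2) p'(3)]) auto
      then show "tracks (real (Suc n) * \<theta>) (2 * e / 3) \<beta> q (- z) (\<Phi> \<beta>) q' z" unfolding Sn by simp
    qed
    then show ?thesis by blast
  qed
  have "\<forall>\<^sub>F x in at_right (0::real). (L * K) * x \<le> c / 2 \<and> K * x \<le> d \<and> K * x \<le> e1 \<and>
      K * x \<le> \<delta>' \<and> (K + 8 / c) * x \<le> e / 3"
    using Suc.prems c d e1 \<delta>' by (intro eventually_conj eventually_small_multiple) auto
  then have "\<forall>\<^sub>F x in at_right (0::real). ((L * K) * x \<le> c / 2 \<and> K * x \<le> d \<and> K * x \<le> e1 \<and>
      K * x \<le> \<delta>' \<and> (K + 8 / c) * x \<le> e / 3) \<and> 0 < x"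
    using eventually_at_right_less[of "0::real"] by eventually_elim auto
  then obtain e2 where *: "((L * K) * e2 \<le> c / 2 \<and> K * e2 \<le> d \<and> K * e2 \<le> e1 \<and>
      K * e2 \<le> \<delta>' \<and> (K + 8 / c) * e2 \<le> e / 3) \<and> 0 < e2"
    using eventually_happens'[OF trivial_limit_at_right_real] by blast
  then have e2: "0 < e2" "L * (K * e2) \<le> c / 2" "K * e2 \<le> d" "K * e2 \<le> e1" "K * e2 \<le> \<delta>'"
      "(K + 8 / c) * e2 \<le> e / 3"
    by (simp_all add: mult.assoc)
  have "e2 \<le> K * e2" using K2 e2(1) by simp
  then have e21: "e2 \<le> e1" using e2 by linarith
  have matched: "\<exists>\<Phi>. trackable (real (Suc n) * \<theta>) e q z z e2 \<Phi>"
    if z: "z \<in> {-1, 1}" and q: "0 \<le> depth z q" "norm q + 2 * real (Suc n) * (M * \<theta>) \<le> R" for q z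
  proof -
    have z': "- z \<in> {-1, 1}" using z by auto
    have nM: "0 \<le> real n * (M * \<theta>)" using M\<theta> by simp
    have "norm q + M * \<theta> \<le> R" using q(2) M\<theta> nM by (simp add: algebra_simps)
    from match_step[OF P c z \<theta>(1-3) q(1) this e2(1) K_def e2(2,3)]
    obtain \<Phi>1 where \<Phi>1: "\<Phi>1 \<in> strategies C C"
      and step: "\<And>\<beta> \<beta>' q' r. \<beta> \<in> controls C \<Longrightarrow> \<beta>' \<in> controls C \<Longrightarrow> 0 \<le> depth z q' \<Longrightarrow> norm (q - q') \<le> e2 \<Longrightarrow>
        0 \<le> r \<Longrightarrow> r \<le> \<theta> \<Longrightarrow> ereal r \<le> exit \<beta> q z \<Longrightarrow> agree r (\<Phi>1 \<beta>) \<beta>' \<Longrightarrow>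
        ereal r \<le> exit \<beta>' q' z \<and> norm (traj \<beta> q z r - traj \<beta>' q' z r) \<le> K * e2 \<and>
        tracks r ((K + 8 / c) * e2) \<beta> q z \<beta>' q' z"
      by blast
    define \<sigma> where "\<sigma> \<beta> = min (exit \<beta> q z) (ereal \<theta>)" for \<beta>
    define r where "r \<beta> = real_of_ereal (\<sigma> \<beta>)" for \<beta>
    have \<sigma>_r: "\<sigma> \<beta> = ereal (r \<beta>)" and r0: "0 \<le> r \<beta>" "r \<beta> \<le> \<theta>" and r_ex: "ereal (r \<beta>) \<le> exit \<beta> q z"
      and r_lt: "exit \<beta> q z < ereal \<theta> \<Longrightarrow> exit \<beta> q z = ereal (r \<beta>)"
      and r_ge: "\<not> exit \<beta> q z < ereal \<theta> \<Longrightarrow> r \<beta> = \<theta>" for \<beta>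
      using exit_nonneg[OF z, of \<beta> q] \<theta>
      by (cases "exit \<beta> q z"; auto simp: \<sigma>_def r_def min_def)+
    define F where "F \<beta> = (if exit \<beta> q z < ereal \<theta>
      then tracker (real (Suc n) * \<theta>) (2 * e / 3) (traj \<beta> q z (r \<beta>)) (- z) z e1
      else tracker (real n * \<theta>) (e / 3) (traj \<beta> q z (r \<beta>)) z z \<delta>')" for \<beta>
    have F: "F \<beta> \<in> strategies C C" for \<beta> unfolding F_def by (simp add: tracker_strategy)
    define \<Psi> where "\<Psi> \<beta> = F \<beta> (shift (r \<beta>) \<beta>)" for \<beta>
    define \<Phi> where "\<Phi> \<beta> = splice (r \<beta>) (\<Phi>1 \<beta>) (\<Psi> \<beta>)" for \<beta>
    have \<Psi>: "\<Psi> \<beta> \<in> controls C" if "\<beta> \<in> controls C" for \<beta>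
      unfolding \<Psi>_def using that r0 by (intro strategies_control[OF F] shift_control) auto
    have "(\<lambda>\<beta>. if \<sigma> \<beta> = \<infinity> then \<Phi>1 \<beta> else splice (real_of_ereal (\<sigma> \<beta>)) (\<Phi>1 \<beta>) (\<Psi> \<beta>)) \<in> strategies C C"
    proof (rule splice_strategy[OF \<Phi>1 \<Psi>])
      fix \<beta> \<beta>' t
      assume \<beta>: "\<beta> \<in> controls C" "\<beta>' \<in> controls C" and ag: "agree t \<beta> \<beta>'" and lt: "\<sigma> \<beta> < ereal t"
      have rt: "r \<beta> < t" using lt by (simp add: \<sigma>_r)
      have eq: "\<sigma> \<beta>' = \<sigma> \<beta>" and iff: "exit \<beta>' q z < ereal \<theta> \<longleftrightarrow> exit \<beta> q z < ereal \<theta>"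
      proof -
        have "\<sigma> \<beta>' = \<sigma> \<beta> \<and> (exit \<beta>' q z < ereal \<theta> \<longleftrightarrow> exit \<beta> q z < ereal \<theta>)"
        proof (cases "exit \<beta> q z < ereal \<theta>")
          case True
          then have "exit \<beta> q z < ereal t" using r_lt[OF True] rt by simp
          then show ?thesis using exit_agree[OF \<beta> z ag] by (simp add: \<sigma>_def)
        next
          case False
          then have "\<theta> < t" using r_ge[OF False] rt by simp
          then have "ereal \<theta> \<le> exit \<beta>' q z"
            using exit_agree_ge[OF \<beta> z agree_mono[OF ag], of \<theta> q] False by (simp add: not_less)
          then show ?thesis using False by (auto simp: \<sigma>_def min_def not_less)
        qed
        then show "\<sigma> \<beta>' = \<sigma> \<beta>" "exit \<beta>' q z < ereal \<theta> \<longleftrightarrow> exit \<beta> q z < ereal \<theta>" by auto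
      qed
      have req: "r \<beta>' = r \<beta>" by (simp add: r_def eq)
      have "traj \<beta> q z (r \<beta>) = traj \<beta>' q z (r \<beta>)"
        using traj_agree[OF \<beta> z ag, of "r \<beta>"] r0 rt by simp
      then have "F \<beta>' = F \<beta>" by (simp add: F_def iff req)
      moreover have "agree (t - r \<beta>) (shift (r \<beta>) \<beta>) (shift (r \<beta>) \<beta>')" using ag r0 by (intro agree_shift) auto
      ultimately have "agree (t - r \<beta>) (\<Psi> \<beta>) (\<Psi> \<beta>')"
        unfolding \<Psi>_def req using strategies_agree[OF F] \<beta> r0 by (simp add: shift_control)
      then show "\<sigma> \<beta>' = \<sigma> \<beta> \<and> agree (t - real_of_ereal (\<sigma> \<beta>)) (\<Psi> \<beta>) (\<Psi> \<beta>')"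
        using eq by (simp add: r_def)
    next
      show "0 \<le> \<sigma> \<beta>" for \<beta> using exit_nonneg[OF z] \<theta> by (simp add: \<sigma>_def)
    qed
    then have \<Phi>: "\<Phi> \<in> strategies C C" by (simp add: \<Phi>_def[abs_def] \<sigma>_r)
    have "trackable (real (Suc n) * \<theta>) e q z z e2 \<Phi>"
    proof (rule trackableI[OF \<Phi> z])
      fix \<beta> q' assume \<beta>: "\<beta> \<in> controls C" and q': "0 \<le> depth z q'" "norm (q - q') \<le> e2"
      note \<Phi>\<beta> = strategies_control[OF \<Phi> \<beta>]
      define p where "p = traj \<beta> q z (r \<beta>)"
      define p' where "p' = traj (\<Phi> \<beta>) q' z (r \<beta>)"
      have "agree (r \<beta>) (\<Phi>1 \<beta>) (\<Phi> \<beta>)" unfolding \<Phi>_def by (intro agree_sym[OF agree_splice_self])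
      from step[OF \<beta> \<Phi>\<beta> q' r0[of \<beta>] r_ex[of \<beta>] this]
      have ex': "ereal (r \<beta>) \<le> exit (\<Phi> \<beta>) q' z" and close: "norm (p - p') \<le> K * e2"
        and tr: "tracks (r \<beta>) ((K + 8 / c) * e2) \<beta> q z (\<Phi> \<beta>) q' z" by (auto simp: p_def p'_def)
      have tr: "tracks (r \<beta>) (e / 3) \<beta> q z (\<Phi> \<beta>) q' z" using tr e2 by (intro tracks_mono[OF tr]) auto
      have p'0: "0 \<le> depth z p'" unfolding p'_def by (rule inside_until_exit[OF \<Phi>\<beta> z q'(1) r0(1) ex'])
      have R': "restarts (r \<beta>) (\<Phi> \<beta>) q' z p' z"
        unfolding p'_def using r0 ex' by (intro restartsI[OF \<Phi>\<beta> z q'(1)]) auto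
      have shc: "shift (r \<beta>) \<beta> \<in> controls C" "shift (r \<beta>) (\<Phi> \<beta>) \<in> controls C"
        using \<beta> \<Phi>\<beta> r0 by (auto intro: shift_control)
      have "norm (p - q) \<le> M * r \<beta>"
        using traj_lipschitz[OF \<beta> z, of q "r \<beta>" 0] \<beta> z r0 by (simp add: p_def)
      also have "\<dots> \<le> M * \<theta>" using r0 M_pos by (intro mult_left_mono) auto
      finally have np: "norm p \<le> norm q + M * \<theta>" using norm_triangle_ineq2[of p q] by linarith
      have agF: "agree t (shift (r \<beta>) (\<Phi> \<beta>)) (F \<beta> (shift (r \<beta>) \<beta>))" for t
        unfolding \<Phi>_def \<Psi>_def by (rule agree_shift_splice)
      show "tracks (real (Suc n) * \<theta>) e \<beta> q z (\<Phi> \<beta>) q' z"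
      proof (cases "exit \<beta> q z < ereal \<theta>")
        case True
        note ex = r_lt[OF True]
        have R: "restarts (r \<beta>) \<beta> q z p (- z)"
          unfolding p_def using r0 ex by (intro restartsI[OF \<beta> z q(1)]) auto
        have "depth z p = 0" unfolding p_def by (rule depth_at_exit[OF \<beta> z q(1) ex])
        then have "\<exists>\<Phi>. trackable (real (Suc n) * \<theta>) (2 * e / 3) p (- z) z e1 \<Phi>"
          using e1 np q(2) by (intro mismatch[OF z]) auto
        then have "tracks (real (Suc n) * \<theta>) (2 * e / 3) (shift (r \<beta>) \<beta>) p (- z) (shift (r \<beta>) (\<Phi> \<beta>)) p' z"
        proof (rule trackerD[OF _ shc _ p'0])
          show "agree t (shift (r \<beta>) (\<Phi> \<beta>)) (tracker (real (Suc n) * \<theta>) (2 * e / 3) p (- z) z e1 (shift (r \<beta>) \<beta>))" for t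
            using agF True by (simp add: F_def p_def)
          show "norm (p - p') \<le> e1" using close e2 by linarith
        qed
        then have "tracks (r \<beta> + real (Suc n) * \<theta>) (e / 3 + 2 * e / 3) \<beta> q z (\<Phi> \<beta>) q' z"
          using Suc.prems by (intro tracks_append[OF tr _ R R']) auto
        then show ?thesis using r0 by (rule_tac tracks_mono) auto
      next
        case False
        note rt = r_ge[OF False]
        have R: "restarts (r \<beta>) \<beta> q z p z"
          unfolding p_def using r0 r_ex by (intro restartsI[OF \<beta> z q(1)]) auto
        have "0 \<le> depth z p" unfolding p_def by (rule inside_until_exit[OF \<beta> z q(1) r0(1) r_ex])
        then have "\<exists>\<Phi>. trackable (real n * \<theta>) (e / 3) p z z \<delta>' \<Phi>"
          using np q(2) M\<theta> by (intro match[OF z]) (auto simp: algebra_simps)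
        then have "tracks (real n * \<theta>) (e / 3) (shift (r \<beta>) \<beta>) p z (shift (r \<beta>) (\<Phi> \<beta>)) p' z"
        proof (rule trackerD[OF _ shc _ p'0])
          show "agree t (shift (r \<beta>) (\<Phi> \<beta>)) (tracker (real n * \<theta>) (e / 3) p z z \<delta>' (shift (r \<beta>) \<beta>))" for t
            using agF False by (simp add: F_def p_def)
          show "norm (p - p') \<le> \<delta>'" using close e2 by linarith
        qed
        then have "tracks (r \<beta> + real n * \<theta>) (e / 3 + e / 3) \<beta> q z (\<Phi> \<beta>) q' z"
          using Suc.prems by (intro tracks_append[OF tr _ R R']) auto
        then show ?thesis unfolding Sn rt using Suc.prems by (rule_tac tracks_mono) auto
      qed
    qed
    then show ?thesis by blast
  qed
  show ?case
  proof (intro exI[of _ e2] conjI allI ballI impI e2(1))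
    fix q z assume "z \<in> {-1, 1}" "0 \<le> depth z q" "norm q + 2 * real (Suc n) * (M * \<theta>) \<le> R"
    then show "\<exists>\<Phi>. trackable (real (Suc n) * \<theta>) e q z z e2 \<Phi>" by (rule matched)
  next
    fix q z assume *: "z \<in> {-1, 1}" "\<bar>depth z q\<bar> \<le> e2" "norm q + 2 * real (Suc n) * (M * \<theta>) \<le> R + M * \<theta>"
    have "\<bar>depth z q\<bar> \<le> e1" using *(2) e21 by (rule order_trans)
    from mismatch[OF *(1) this *(3)]
    obtain \<Phi> where "trackable (real (Suc n) * \<theta>) (2 * e / 3) q (- z) z e1 \<Phi>" ..
    then have "trackable (real (Suc n) * \<theta>) e q (- z) z e2 \<Phi>"
      by (rule trackable_mono) (use e21 Suc.prems in auto)
    then show "\<exists>\<Phi>. trackable (real (Suc n) * \<theta>) e q (- z) z e2 \<Phi>" by blast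
  qed
qed

text \<open>The control \<open>\<Phi> \<beta>0 \<beta>\<close> begins with \<open>\<beta>0\<close> for a time \<open>\<delta>\<close> and then makes the motion from \<open>q\<close> follow the
  motion that \<open>\<beta>\<close> would have produced. It depends causally on both arguments, because later \<open>\<beta>0\<close> is itself
  an answer to the opponent.\<close>

definition imitation :: "real \<Rightarrow> real \<Rightarrow> real ^ 'n \<Rightarrow> int \<Rightarrow> real \<Rightarrow> ((real \<Rightarrow> 'c) \<Rightarrow> (real \<Rightarrow> 'c) \<Rightarrow> (real \<Rightarrow> 'c)) \<Rightarrow> bool" where
  "imitation T e q z \<delta> \<Phi> \<longleftrightarrow>
    (\<forall>\<beta>0\<in>controls C. \<forall>\<beta>\<in>controls C. \<Phi> \<beta>0 \<beta> \<in> controls C \<and> agree \<delta> (\<Phi> \<beta>0 \<beta>) \<beta>0 \<and>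
       (ereal \<delta> \<le> exit \<beta>0 q z \<longrightarrow> tracks T e \<beta> q z (\<Phi> \<beta>0 \<beta>) q z)) \<and>
    (\<forall>t. \<forall>\<beta>0\<in>controls C. \<forall>\<beta>0'\<in>controls C. \<forall>\<beta>\<in>controls C. \<forall>\<beta>'\<in>controls C.
       agree t \<beta>0 \<beta>0' \<longrightarrow> agree t \<beta> \<beta>' \<longrightarrow> agree t (\<Phi> \<beta>0 \<beta>) (\<Phi> \<beta>0' \<beta>'))"

lemma
  assumes "imitation T e q z \<delta> \<Phi>" "\<beta>0 \<in> controls C" "\<beta> \<in> controls C"
  shows imitation_control: "\<Phi> \<beta>0 \<beta> \<in> controls C"
    and imitation_prefix: "agree \<delta> (\<Phi> \<beta>0 \<beta>) \<beta>0"
    and imitation_tracks: "ereal \<delta> \<le> exit \<beta>0 q z \<Longrightarrow> tracks T e \<beta> q z (\<Phi> \<beta>0 \<beta>) q z"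
  using assms by (simp_all add: imitation_def)

lemma imitation_causal:
  assumes "imitation T e q z \<delta> \<Phi>" "\<beta>0 \<in> controls C" "\<beta>0' \<in> controls C" "\<beta> \<in> controls C" "\<beta>' \<in> controls C"
    "agree t \<beta>0 \<beta>0'" "agree t \<beta> \<beta>'"
  shows "agree t (\<Phi> \<beta>0 \<beta>) (\<Phi> \<beta>0' \<beta>')"
  using assms by (simp add: imitation_def)

text \<open>During the short time \<open>\<delta>\<close> in which the follower obeys \<open>\<beta>0\<close>, leader and follower drift apart by
  at most \<open>2 * M * \<delta>\<close>, and the leader may switch while the follower does not. Both outcomes are starting
  configurations for tracking.\<close>

theorem imitation_exists:
  assumes z: "z \<in> {-1, 1}" and q: "0 \<le> depth z q" and e: "0 < e"
  shows "\<exists>\<delta>0>0. \<forall>\<delta>>0. \<delta> \<le> \<delta>0 \<longrightarrow> (\<exists>\<Phi>. imitation T e q z \<delta> \<Phi>)"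
proof -
  have z': "- z \<in> {-1, 1}" using z by auto
  define S where "S = max T 0"
  (* the n windows used below last at most S + 1 in total; the summand M pays for a beginning shorter than 1 *)
  define R where "R = norm q + M + 2 * M * (S + 1)"
  obtain c d where c: "0 < c" and d: "0 < d" and P: "push R c d"
    using push_exists by blast
  have "\<forall>\<^sub>F x in at_right (0::real). 1 * x \<le> 1 \<and> (2 * L) * x \<le> 1 \<and> (32 * L * M) * x \<le> c \<and> M * x \<le> gap / 2"
    using c gap_pos by (intro eventually_conj eventually_small_multiple) auto
  then have "\<forall>\<^sub>F x in at_right (0::real). (1 * x \<le> 1 \<and> (2 * L) * x \<le> 1 \<and> (32 * L * M) * x \<le> c \<and> M * x \<le> gap / 2) \<and> 0 < x"
    using eventually_at_right_less[of "0::real"] by eventually_elim auto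
  then obtain \<theta> where \<theta>: "0 < \<theta>" "\<theta> \<le> 1" "2 * L * \<theta> \<le> 1" "32 * L * M * \<theta> \<le> c" "M * \<theta> \<le> gap / 2"
    using eventually_happens'[OF trivial_limit_at_right_real] by auto
  define n where "n = nat \<lceil>S / \<theta>\<rceil>"
  have S0: "0 \<le> S / \<theta>" using \<theta> by (simp add: S_def)
  have n: "S / \<theta> \<le> real n" "real n \<le> S / \<theta> + 1" using S0 by (simp_all add: n_def)
  then have nT: "T \<le> real n * \<theta>" and nS: "real n * \<theta> \<le> S + 1"
    using \<theta> mult_right_mono[of "S / \<theta>" "real n" \<theta>] mult_right_mono[of "real n" "S / \<theta> + 1" \<theta>]
    by (auto simp: S_def distrib_right)
  have R: "norm p + 2 * real n * (M * \<theta>) \<le> R" if "norm (p - q) \<le> M" for p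
  proof -
    have "2 * M * (real n * \<theta>) \<le> 2 * M * (S + 1)" using nS M_pos by (intro mult_left_mono) auto
    then show ?thesis using that norm_triangle_ineq2[of p q] by (simp add: R_def mult_ac)
  qed
  have "0 < e / 2" using e by simp
  from tracking_steps[OF P c d \<theta>(1,3-5) this, of n]
  obtain \<delta>1 where \<delta>1: "0 < \<delta>1"
    and matched: "\<And>q z. z \<in> {-1, 1} \<Longrightarrow> 0 \<le> depth z q \<Longrightarrow> norm q + 2 * real n * (M * \<theta>) \<le> R \<Longrightarrow>
       \<exists>\<Phi>. trackable (real n * \<theta>) (e / 2) q z z \<delta>1 \<Phi>"
    and mismatched: "\<And>q z. z \<in> {-1, 1} \<Longrightarrow> \<bar>depth z q\<bar> \<le> \<delta>1 \<Longrightarrow>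
       norm q + 2 * real n * (M * \<theta>) \<le> R + M * \<theta> \<Longrightarrow> \<exists>\<Phi>. trackable (real n * \<theta>) (e / 2) q (- z) z \<delta>1 \<Phi>"
    by blast
  have "\<forall>\<^sub>F x in at_right (0::real). 1 * x \<le> 1 \<and> (2 * M) * x \<le> \<delta>1 \<and> 1 * x \<le> e / 2 \<and> M * x \<le> gap"
    using e gap_pos \<delta>1 by (intro eventually_conj eventually_small_multiple) auto
  then have "\<forall>\<^sub>F x in at_right (0::real). (1 * x \<le> 1 \<and> (2 * M) * x \<le> \<delta>1 \<and> 1 * x \<le> e / 2 \<and> M * x \<le> gap) \<and> 0 < x"
    using eventually_at_right_less[of "0::real"] by eventually_elim auto
  then obtain \<delta>0 where \<delta>0: "0 < \<delta>0" "\<delta>0 \<le> 1" "2 * M * \<delta>0 \<le> \<delta>1" "\<delta>0 \<le> e / 2" "M * \<delta>0 \<le> gap"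
    using eventually_happens'[OF trivial_limit_at_right_real] by auto
  show ?thesis
  proof (intro exI[of _ \<delta>0] conjI allI impI \<delta>0(1))
    fix \<delta> :: real assume \<delta>: "0 < \<delta>" "\<delta> \<le> \<delta>0"
    have M\<delta>: "M * \<delta> \<le> M * \<delta>0" using \<delta> M_pos by simp
    moreover have "M * \<delta>0 \<le> M" using \<delta>0 M_pos by simp
    moreover have "2 * (M * \<delta>0) \<le> \<delta>1" using \<delta>0 by (simp add: mult.assoc)
    ultimately have \<delta>': "M * \<delta> \<le> M" "2 * (M * \<delta>) \<le> \<delta>1" "\<delta> \<le> e / 2" "M * \<delta> \<le> gap"
      using \<delta> \<delta>0(4,5) by linarith+
    define p where "p \<beta> = st \<beta> q z \<delta>" for \<beta>
    (* at time \<delta> the leader has switched at most once *)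
    define v where "v \<beta> = (if exit \<beta> q z < ereal \<delta> then - z else z)" for \<beta>
    define F where "F \<beta> = tracker (real n * \<theta>) (e / 2) (p \<beta>) (v \<beta>) z \<delta>1" for \<beta>
    define \<Phi> where "\<Phi> \<beta>0 \<beta> = splice \<delta> \<beta>0 (F \<beta> (shift \<delta> \<beta>))" for \<beta>0 \<beta>
    have F: "F \<beta> \<in> strategies C C" for \<beta> unfolding F_def by (rule tracker_strategy)
    have \<Phi>_ctrl: "\<Phi> \<beta>0 \<beta> \<in> controls C" if "\<beta>0 \<in> controls C" "\<beta> \<in> controls C" for \<beta>0 \<beta>
      unfolding \<Phi>_def using that \<delta> by (intro splice_control strategies_control[OF F] shift_control) auto
    have \<Phi>_agree: "agree \<delta> (\<Phi> \<beta>0 \<beta>) \<beta>0" for \<beta>0 \<beta>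
      unfolding \<Phi>_def by (rule agree_splice_self)
    have "agree t (\<Phi> \<beta>0 \<beta>) (\<Phi> \<beta>0' \<beta>')"
      if c: "\<beta>0 \<in> controls C" "\<beta>0' \<in> controls C" "\<beta> \<in> controls C" "\<beta>' \<in> controls C"
        and ag: "agree t \<beta>0 \<beta>0'" "agree t \<beta> \<beta>'" for t \<beta>0 \<beta>0' \<beta> \<beta>'
      unfolding \<Phi>_def
    proof (rule agree_splice)
      show "agree (min \<delta> t) \<beta>0 \<beta>0'" using ag by (auto intro: agree_mono)
      assume t: "\<delta> < t"
      have ag\<delta>: "agree \<delta> \<beta> \<beta>'" using ag t by (auto intro: agree_mono)
      have "p \<beta> = p \<beta>'" using state_agree[OF c(3,4) z q ag\<delta>, of \<delta>] \<delta> by (simp add: p_def)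
      moreover have "v \<beta> = v \<beta>'"
        using exit_less_agree[OF c(3,4) z ag\<delta> order_refl, of q]
          exit_less_agree[OF c(4,3) z agree_sym[OF ag\<delta>] order_refl, of q] by (auto simp: v_def)
      ultimately have "F \<beta>' = F \<beta>" by (simp add: F_def)
      moreover have "agree (t - \<delta>) (shift \<delta> \<beta>) (shift \<delta> \<beta>')" using ag \<delta> by (intro agree_shift) auto
      ultimately show "agree (t - \<delta>) (F \<beta> (shift \<delta> \<beta>)) (F \<beta>' (shift \<delta> \<beta>'))"
        using strategies_agree[OF F] c \<delta> by (simp add: shift_control)
    qed (use \<delta> in auto)
    note causal = this
    have track: "tracks T e \<beta> q z (\<Phi> \<beta>0 \<beta>) q z"
      if \<beta>0: "\<beta>0 \<in> controls C" and \<beta>: "\<beta> \<in> controls C" and ex0: "ereal \<delta> \<le> exit \<beta>0 q z" for \<beta>0 \<beta>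
    proof -
      define \<beta>' where "\<beta>' = \<Phi> \<beta>0 \<beta>"
      have \<beta>': "\<beta>' \<in> controls C" unfolding \<beta>'_def by (rule \<Phi>_ctrl[OF \<beta>0 \<beta>])
      have ex': "ereal \<delta> \<le> exit \<beta>' q z"
        unfolding \<beta>'_def by (rule exit_agree_ge[OF \<beta>0 \<Phi>_ctrl[OF \<beta>0 \<beta>] z agree_sym[OF \<Phi>_agree] ex0])
      define p' where "p' = traj \<beta>' q z \<delta>"
      have p'0: "0 \<le> depth z p'" unfolding p'_def using \<delta> by (intro inside_until_exit[OF \<beta>' z q _ ex']) auto
      have R': "restarts \<delta> \<beta>' q z p' z" unfolding p'_def using \<delta> by (intro restartsI[OF \<beta>' z q _ ex']) auto
      have p'q: "norm (p' - q) \<le> M * \<delta>"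
        using traj_lipschitz[OF \<beta>' z, of q \<delta> 0] \<beta>' z \<delta> by (simp add: p'_def)
      have start: "tracks \<delta> (e / 2) \<beta> q z \<beta>' q z"
        unfolding tracks_def using \<delta> \<delta>' by (intro exI[of _ "{0..\<delta>}"]) auto
      have shc: "shift \<delta> \<beta> \<in> controls C" "shift \<delta> \<beta>' \<in> controls C" using \<beta> \<beta>' \<delta> by (auto intro: shift_control)
      have "\<exists>\<Phi>. trackable (real n * \<theta>) (e / 2) (p \<beta>) (v \<beta>) z \<delta>1 \<Phi>"
        and Rp: "restarts \<delta> \<beta> q z (p \<beta>) (v \<beta>)" and pq: "norm (p \<beta> - q) \<le> M * \<delta>"
      proof -
        have "(\<exists>\<Phi>. trackable (real n * \<theta>) (e / 2) (p \<beta>) (v \<beta>) z \<delta>1 \<Phi>) \<and>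
          restarts \<delta> \<beta> q z (p \<beta>) (v \<beta>) \<and> norm (p \<beta> - q) \<le> M * \<delta>"
        proof (cases "exit \<beta> q z < ereal \<delta>")
          case True
          then obtain s where s: "exit \<beta> q z = ereal s" "0 \<le> s" "s < \<delta>"
            using exit_nonneg[OF z, of \<beta> q] by (cases "exit \<beta> q z") auto
          define p1 where "p1 = traj \<beta> q z s"
          have sc: "shift s \<beta> \<in> controls C" using \<beta> s by (intro shift_control) auto
          have p1: "depth z p1 = 0" "depth (- z) p1 = gap"
            unfolding p1_def using depth_at_exit[OF \<beta> z q s(1)] depth_after_switch[OF \<beta> z q s(1)] by auto
          have "M * (\<delta> - s) \<le> gap" using \<delta>' s M_pos mult_left_mono[of "\<delta> - s" \<delta> M] by linarith
          then have "\<delta> - s \<le> gap / M" using M_pos by (simp add: field_simps)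
          then have ex1: "ereal (\<delta> - s) \<le> exit (shift s \<beta>) p1 (- z)"
            using order_trans[OF _ exit_lower_bound[OF sc z', of p1], of "ereal (\<delta> - s)"] p1 by simp
          have p: "p \<beta> = traj (shift s \<beta>) p1 (- z) (\<delta> - s)"
            using state_after_exit[OF \<beta> z q s(1,3)] state_until_exit[OF ex1] by (simp add: p_def p1_def)
          have pp1: "norm (p \<beta> - p1) \<le> M * (\<delta> - s)"
            using traj_lipschitz[OF sc z', of p1 "\<delta> - s" 0] sc z' s by (simp add: p)
          have "norm (p1 - q) \<le> M * s" using traj_lipschitz[OF \<beta> z, of q s 0] \<beta> z s by (simp add: p1_def)
          then have pq: "norm (p \<beta> - q) \<le> M * \<delta>"
            using pp1 norm_triangle_ineq[of "p \<beta> - p1" "p1 - q"] by (simp add: algebra_simps)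
          have "\<bar>depth z (p \<beta>) - depth z p1\<bar> \<le> M * (\<delta> - s)" using depth_diff[OF z] pp1 by (rule order_trans)
          also have "\<dots> \<le> M * \<delta>" using s M_pos by simp
          finally have "\<bar>depth z (p \<beta>)\<bar> \<le> M * \<delta>" using p1 by simp
          moreover have "0 \<le> M * \<delta>" using M_pos \<delta> by simp
          ultimately have "\<bar>depth z (p \<beta>)\<bar> \<le> \<delta>1" using \<delta>' by linarith
          moreover have "norm (p \<beta>) + 2 * real n * (M * \<theta>) \<le> R + M * \<theta>"
            using R[of "p \<beta>"] pq \<delta>' mult_pos_pos[OF M_pos \<theta>(1)] by linarith
          ultimately have "\<exists>\<Phi>. trackable (real n * \<theta>) (e / 2) (p \<beta>) (- z) z \<delta>1 \<Phi>"
            by (intro mismatched[OF z])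
          moreover have "restarts \<delta> \<beta> q z (p \<beta>) (- z)"
          proof -
            have "restarts s \<beta> q z p1 (- z)" unfolding p1_def using s by (intro restartsI[OF \<beta> z q]) auto
            moreover have "restarts (\<delta> - s) (shift s \<beta>) p1 (- z) (p \<beta>) (- z)"
              unfolding p using s p1 gap_pos by (intro restartsI[OF sc z' _ _ ex1]) auto
            ultimately show ?thesis using restarts_trans[of s \<beta> q z p1 "- z" "\<delta> - s"] s by simp
          qed
          ultimately show ?thesis using True pq by (simp add: v_def)
        next
          case False
          then have ex: "ereal \<delta> \<le> exit \<beta> q z" by simp
          have p: "p \<beta> = traj \<beta> q z \<delta>" using state_until_exit[OF ex] by (simp add: p_def)
          have pq: "norm (p \<beta> - q) \<le> M * \<delta>"
            using traj_lipschitz[OF \<beta> z, of q \<delta> 0] \<beta> z \<delta> by (simp add: p)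
          have "0 \<le> depth z (p \<beta>)" unfolding p using \<delta> by (intro inside_until_exit[OF \<beta> z q _ ex]) auto
          moreover have "norm (p \<beta>) + 2 * real n * (M * \<theta>) \<le> R" using R[of "p \<beta>"] pq \<delta>' by linarith
          ultimately have "\<exists>\<Phi>. trackable (real n * \<theta>) (e / 2) (p \<beta>) z z \<delta>1 \<Phi>" by (intro matched[OF z])
          moreover have "restarts \<delta> \<beta> q z (p \<beta>) z" unfolding p using \<delta> by (intro restartsI[OF \<beta> z q _ ex]) auto
          ultimately show ?thesis using False pq by (simp add: v_def)
        qed
        then show "\<exists>\<Phi>. trackable (real n * \<theta>) (e / 2) (p \<beta>) (v \<beta>) z \<delta>1 \<Phi>"
          "restarts \<delta> \<beta> q z (p \<beta>) (v \<beta>)" "norm (p \<beta> - q) \<le> M * \<delta>" by auto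
      qed
      then have "tracks (real n * \<theta>) (e / 2) (shift \<delta> \<beta>) (p \<beta>) (v \<beta>) (shift \<delta> \<beta>') p' z"
      proof (rule_tac trackerD[OF _ shc _ p'0])
        show "agree t (shift \<delta> \<beta>') (tracker (real n * \<theta>) (e / 2) (p \<beta>) (v \<beta>) z \<delta>1 (shift \<delta> \<beta>))" for t
          unfolding \<beta>'_def \<Phi>_def F_def by (rule agree_shift_splice)
        show "norm (p \<beta> - p') \<le> \<delta>1"
          using pq p'q \<delta>' norm_triangle_ineq4[of "p \<beta> - q" "p' - q"] by simp
      qed
      then have "tracks (\<delta> + real n * \<theta>) (e / 2 + e / 2) \<beta> q z \<beta>' q z"
        using e by (intro tracks_append[OF start _ Rp R']) auto
      then show ?thesis unfolding \<beta>'_def[symmetric] by (rule tracks_mono) (use nT \<delta> in auto)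
    qed
    show "\<exists>\<Phi>. imitation T e q z \<delta> \<Phi>" unfolding imitation_def
      by (intro exI[of _ \<Phi>] conjI ballI allI impI; (rule \<Phi>_ctrl \<Phi>_agree track causal; assumption)?)
  qed
qed

end

section \<open>The discounted cost\<close>

context thermostat
begin

lemma tracks_refl:
  assumes "0 \<le> e" shows "tracks T e \<beta> q z \<beta> q z"
  unfolding tracks_def using assms by (intro exI[of _ "{}"]) auto

end

lemma exp_decay_integral: "0 < lam \<Longrightarrow> ((\<lambda>t. exp (- lam * t)) has_integral exp (- lam * c) / lam) {c..}"
  for lam :: real
  using has_integral_exp_minus_to_infinity[of lam c] by simp

lemma agree_join:
  assumes "agree r \<alpha> \<beta>" "agree d (shift r \<alpha>) (shift r \<beta>)"
  shows "agree (r + d) \<alpha> \<beta>"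
proof -
  let ?N = "{s \<in> {0..d}. shift r \<alpha> s \<noteq> shift r \<beta> s}"
  have "negligible ({s \<in> {0..r}. \<alpha> s \<noteq> \<beta> s} \<union> (+) r ` ?N)"
    using assms by (intro negligible_Un negligible_translation) (auto simp: agree_iff_negligible)
  moreover have "{s \<in> {0..r + d}. \<alpha> s \<noteq> \<beta> s} \<subseteq> \<dots>"
  proof
    fix s assume s: "s \<in> {s \<in> {0..r + d}. \<alpha> s \<noteq> \<beta> s}"
    show "s \<in> {s \<in> {0..r}. \<alpha> s \<noteq> \<beta> s} \<union> (+) r ` ?N"
    proof (cases "s \<le> r")
      case False
      with s have "s - r \<in> ?N" by (auto simp: shift_def)
      then show ?thesis by (intro UnI2 image_eqI[of _ _ "s - r"]) auto
    qed (use s in auto)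
  qed
  ultimately show ?thesis unfolding agree_iff_negligible by (rule negligible_subset)
qed

text \<open>The running cost may have either sign, so that exchanging the players and negating the cost
  leads to a game of the same kind.\<close>

locale switching_game =
  X: thermostat i \<rho> A f M1 L1 + Y: thermostat j \<eta> B g M2 L2
  for i :: "'n::finite" and \<rho> :: "int \<Rightarrow> real" and A :: "'a::metric_space set"
    and f :: "real ^ 'n \<Rightarrow> int \<Rightarrow> 'a \<Rightarrow> real ^ 'n" and M1 L1 :: real
    and j :: "'m::finite" and \<eta> :: "int \<Rightarrow> real" and B :: "'b::metric_space set"
    and g :: "real ^ 'm \<Rightarrow> int \<Rightarrow> 'b \<Rightarrow> real ^ 'm" and M2 L2 :: real +
  fixes l :: "real ^ 'n \<Rightarrow> real ^ 'm \<Rightarrow> int \<Rightarrow> int \<Rightarrow> 'a \<Rightarrow> 'b \<Rightarrow> real"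
    and l1 :: "real ^ 'n \<Rightarrow> real ^ 'm \<Rightarrow> int \<Rightarrow> int \<Rightarrow> 'a \<Rightarrow> real"
    and l2 :: "real ^ 'n \<Rightarrow> real ^ 'm \<Rightarrow> int \<Rightarrow> int \<Rightarrow> 'b \<Rightarrow> real"
    and lam Kb Kl :: real
  assumes l_split: "\<And>x y w z a b. w \<in> {-1, 1} \<Longrightarrow> z \<in> {-1, 1} \<Longrightarrow> a \<in> A \<Longrightarrow> b \<in> B \<Longrightarrow>
        l x y w z a b = l1 x y w z a + l2 x y w z b"
    and l1_cont: "\<And>w z. w \<in> {-1, 1} \<Longrightarrow> z \<in> {-1, 1} \<Longrightarrow> continuous_on (UNIV \<times> A) (\<lambda>(p, a). l1 (fst p) (snd p) w z a)"
    and l2_cont: "\<And>w z. w \<in> {-1, 1} \<Longrightarrow> z \<in> {-1, 1} \<Longrightarrow> continuous_on (UNIV \<times> B) (\<lambda>(p, b). l2 (fst p) (snd p) w z b)"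
    and l_bound: "\<And>x y w z a b. w \<in> {-1, 1} \<Longrightarrow> z \<in> {-1, 1} \<Longrightarrow> a \<in> A \<Longrightarrow> b \<in> B \<Longrightarrow> \<bar>l x y w z a b\<bar> \<le> Kb"
    and l_lips: "\<And>x y x' y' w z a b. w \<in> {-1, 1} \<Longrightarrow> z \<in> {-1, 1} \<Longrightarrow> a \<in> A \<Longrightarrow> b \<in> B \<Longrightarrow>
        \<bar>l x y w z a b - l x' y' w z a b\<bar> \<le> Kl * (norm (x - x') + norm (y - y'))"
    and lam_pos: "0 < lam" and Kb_nonneg: "0 \<le> Kb" and Kl_nonneg: "0 \<le> Kl"
begin

abbreviation J :: "real ^ 'n \<Rightarrow> real ^ 'm \<Rightarrow> int \<Rightarrow> int \<Rightarrow> (real \<Rightarrow> 'a) \<Rightarrow> (real \<Rightarrow> 'b) \<Rightarrow> real" where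
  "J \<equiv> cost i j \<rho> \<eta> f g l lam"

abbreviation V :: "real ^ 'n \<Rightarrow> real ^ 'm \<Rightarrow> int \<Rightarrow> int \<Rightarrow> real" where
  "V \<equiv> lower_value A B i j \<rho> \<eta> f g l lam"

abbreviation G :: "real ^ 'n \<Rightarrow> real ^ 'm \<Rightarrow> int \<Rightarrow> int \<Rightarrow> (real \<Rightarrow> 'a) \<Rightarrow> (real \<Rightarrow> 'b) \<Rightarrow> real" where
  "G \<equiv> cost_to_first_switch i j \<rho> \<eta> f g l lam V"

definition discounted :: "real ^ 'n \<Rightarrow> real ^ 'm \<Rightarrow> int \<Rightarrow> int \<Rightarrow> (real \<Rightarrow> 'a) \<Rightarrow> (real \<Rightarrow> 'b) \<Rightarrow> real \<Rightarrow> real" where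
  "discounted x y w z \<alpha> \<beta> t = exp (- lam * t) *
     l (X.st \<alpha> x w t) (Y.st \<beta> y z t) (X.lb \<alpha> x w t) (Y.lb \<beta> y z t) (\<alpha> t) (\<beta> t)"

lemma cost_eq: "J x y w z \<alpha> \<beta> = (LINT t:{0..}|lebesgue. discounted x y w z \<alpha> \<beta> t)"
  by (simp add: cost_def discounted_def)

text \<open>There are finitely many labels, so measurability can be checked with the labels fixed. Cost terms
  that involve a single control are needed here, because pairs of controls live in a product that may fail
  to have a countable base.\<close>

lemma running_cost_measurable:
  fixes k :: "real ^ 'n \<Rightarrow> real ^ 'm \<Rightarrow> int \<Rightarrow> int \<Rightarrow> 'k::metric_space \<Rightarrow> real"
  assumes k: "\<And>w z. w \<in> {-1, 1} \<Longrightarrow> z \<in> {-1, 1} \<Longrightarrow> continuous_on (UNIV \<times> D) (\<lambda>(p, c). k (fst p) (snd p) w z c)"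
    and \<alpha>: "\<alpha> \<in> controls A" and \<beta>: "\<beta> \<in> controls B" and w: "w \<in> {-1, 1}" and z: "z \<in> {-1, 1}"
    and \<delta>: "\<delta> \<in> controls D"
  shows "(\<lambda>t. k (X.st \<alpha> x w t) (Y.st \<beta> y z t) (X.lb \<alpha> x w t) (Y.lb \<beta> y z t) (\<delta> t)) \<in> borel_measurable (lebesgue_on {0..})"
proof -
  let ?N = "lebesgue_on {0..} :: real measure" and ?I = "{-1, 1} \<times> {-1, 1} :: (int \<times> int) set"
  have g: "(\<lambda>t. (X.lb \<alpha> x w t, Y.lb \<beta> y z t)) \<in> measurable ?N (count_space ?I)"
  proof (subst measurable_count_space_eq2, simp, intro conjI ballI)
    show "(\<lambda>t. (X.lb \<alpha> x w t, Y.lb \<beta> y z t)) \<in> space ?N \<rightarrow> ?I"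
      using X.label_cases[OF w] Y.label_cases[OF z] by blast
    fix p :: "int \<times> int"
    have "(\<lambda>t. (X.lb \<alpha> x w t, Y.lb \<beta> y z t)) -` {p} \<inter> space ?N =
        (X.lb \<alpha> x w -` {fst p} \<inter> space ?N) \<inter> (Y.lb \<beta> y z -` {snd p} \<inter> space ?N)" by (cases p) auto
    also have "\<dots> \<in> sets ?N"
      by (intro sets.Int measurable_sets[OF X.label_measurable[OF \<alpha> w]] measurable_sets[OF Y.label_measurable[OF \<beta> z]]) auto
    finally show "(\<lambda>t. (X.lb \<alpha> x w t, Y.lb \<beta> y z t)) -` {p} \<inter> space ?N \<in> sets ?N" .
  qed
  have F: "(\<lambda>t. k (X.st \<alpha> x w t) (Y.st \<beta> y z t) (fst p) (snd p) (\<delta> t)) \<in> borel_measurable ?N" if "p \<in> ?I" for p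
  proof -
    have "(\<lambda>t. k (fst (X.st \<alpha> x w t, Y.st \<beta> y z t)) (snd (X.st \<alpha> x w t, Y.st \<beta> y z t)) (fst p) (snd p) (\<delta> t))
        \<in> borel_measurable ?N"
    proof (rule measurable_caratheodory[where C = D and F = "\<lambda>p' c. k (fst p') (snd p') (fst p) (snd p) c"
          and X = "\<lambda>t. (X.st \<alpha> x w t, Y.st \<beta> y z t)" and \<alpha> = \<delta>])
      show "continuous_on (UNIV \<times> D) (\<lambda>(x, c). k (fst x) (snd x) (fst p) (snd p) c)"
        using that by (intro k) auto
      show "(\<lambda>t. (X.st \<alpha> x w t, Y.st \<beta> y z t)) \<in> borel_measurable ?N"
        using X.state_measurable[OF \<alpha> w] Y.state_measurable[OF \<beta> z] by measurable
      show "\<delta> \<in> borel_measurable ?N" by (rule controls_measurable[OF \<delta>])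
      show "\<delta> s \<in> D" if "s \<in> space ?N" for s using that by (intro controls_in[OF \<delta>]) auto
    qed
    then show ?thesis by simp
  qed
  have "countable ?I" by simp
  from measurable_compose_countable'[where f = "\<lambda>p t. k (X.st \<alpha> x w t) (Y.st \<beta> y z t) (fst p) (snd p) (\<delta> t)", OF F g this]
  show ?thesis by simp
qed

lemma discounted_measurable:
  assumes \<alpha>: "\<alpha> \<in> controls A" and \<beta>: "\<beta> \<in> controls B" and w: "w \<in> {-1, 1}" and z: "z \<in> {-1, 1}"
  shows "discounted x y w z \<alpha> \<beta> \<in> borel_measurable (lebesgue_on {0..})"
proof -
  let ?N = "lebesgue_on {0..} :: real measure"
  note 1 = running_cost_measurable[OF l1_cont \<alpha> \<beta> w z \<alpha>] running_cost_measurable[OF l2_cont \<alpha> \<beta> w z \<beta>]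
  have 2: "(\<lambda>t. exp (- lam * t)) \<in> borel_measurable ?N"
    by (intro continuous_imp_measurable_on_sets_lebesgue continuous_intros) auto
  have "(\<lambda>t. exp (- lam * t) * (l1 (X.st \<alpha> x w t) (Y.st \<beta> y z t) (X.lb \<alpha> x w t) (Y.lb \<beta> y z t) (\<alpha> t) +
      l2 (X.st \<alpha> x w t) (Y.st \<beta> y z t) (X.lb \<alpha> x w t) (Y.lb \<beta> y z t) (\<beta> t))) \<in> borel_measurable ?N"
    using 1 2 by measurable
  then show ?thesis
  proof (rule measurable_cong[THEN iffD1, rotated])
    fix t assume "t \<in> space ?N"
    then have "0 \<le> t" by simp
    then show "exp (- lam * t) * (l1 (X.st \<alpha> x w t) (Y.st \<beta> y z t) (X.lb \<alpha> x w t) (Y.lb \<beta> y z t) (\<alpha> t) +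
      l2 (X.st \<alpha> x w t) (Y.st \<beta> y z t) (X.lb \<alpha> x w t) (Y.lb \<beta> y z t) (\<beta> t)) = discounted x y w z \<alpha> \<beta> t"
      unfolding discounted_def
      by (subst l_split[OF X.label_cases[OF w] Y.label_cases[OF z] controls_in[OF \<alpha>] controls_in[OF \<beta>]]) auto
  qed
qed

lemma discounted_bound:
  assumes "\<alpha> \<in> controls A" "\<beta> \<in> controls B" "w \<in> {-1, 1}" "z \<in> {-1, 1}" "0 \<le> t"
  shows "\<bar>discounted x y w z \<alpha> \<beta> t\<bar> \<le> Kb * exp (- lam * t)"
proof -
  have "\<bar>l (X.st \<alpha> x w t) (Y.st \<beta> y z t) (X.lb \<alpha> x w t) (Y.lb \<beta> y z t) (\<alpha> t) (\<beta> t)\<bar> \<le> Kb"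
    by (rule l_bound[OF X.label_cases[OF assms(3)] Y.label_cases[OF assms(4)]
          controls_in[OF assms(1,5)] controls_in[OF assms(2,5)]])
  then show ?thesis by (simp add: discounted_def abs_mult mult.commute)
qed

lemma discounted_integrable:
  assumes "\<alpha> \<in> controls A" "\<beta> \<in> controls B" "w \<in> {-1, 1}" "z \<in> {-1, 1}" "S \<subseteq> {0..}" "S \<in> sets lebesgue"
  shows "discounted x y w z \<alpha> \<beta> absolutely_integrable_on S" "discounted x y w z \<alpha> \<beta> integrable_on S"
proof -
  have "discounted x y w z \<alpha> \<beta> absolutely_integrable_on {0..}"
  proof (rule measurable_bounded_by_integrable_imp_absolutely_integrable)
    show "(\<lambda>t. Kb * exp (- lam * t)) integrable_on {0..}"
      using exp_decay_integral[OF lam_pos, of 0] by (intro integrable_on_mult_right) blast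
  qed (use assms discounted_measurable discounted_bound in auto)
  then show "discounted x y w z \<alpha> \<beta> absolutely_integrable_on S"
    by (rule set_integrable_subset) (use assms in auto)
  then show "discounted x y w z \<alpha> \<beta> integrable_on S" by (rule set_lebesgue_integral_eq_integral(1))
qed

lemma cost_integral:
  assumes "\<alpha> \<in> controls A" "\<beta> \<in> controls B" "w \<in> {-1, 1}" "z \<in> {-1, 1}"
  shows "J x y w z \<alpha> \<beta> = integral {0..} (discounted x y w z \<alpha> \<beta>)"
  unfolding cost_eq using assms by (intro set_lebesgue_integral_eq_integral(2) discounted_integrable) auto

lemma cost_bound:
  assumes "\<alpha> \<in> controls A" "\<beta> \<in> controls B" "w \<in> {-1, 1}" "z \<in> {-1, 1}"
  shows "\<bar>J x y w z \<alpha> \<beta>\<bar> \<le> Kb / lam"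
proof -
  have "norm (integral {0..} (discounted x y w z \<alpha> \<beta>)) \<le> integral {0..} (\<lambda>t. Kb * exp (- lam * t))"
  proof (rule integral_norm_bound_integral)
    show "(\<lambda>t. Kb * exp (- lam * t)) integrable_on {0..}"
      using exp_decay_integral[OF lam_pos, of 0] by (intro integrable_on_mult_right) blast
  qed (use assms discounted_bound discounted_integrable in auto)
  also have "\<dots> = Kb / lam" using integral_unique[OF exp_decay_integral[OF lam_pos, of 0]] by simp
  finally show ?thesis using cost_integral[OF assms] by simp
qed

definition running :: "real ^ 'n \<Rightarrow> real ^ 'm \<Rightarrow> int \<Rightarrow> int \<Rightarrow> (real \<Rightarrow> 'a) \<Rightarrow> (real \<Rightarrow> 'b) \<Rightarrow> real \<Rightarrow> real" where
  "running x y w z \<alpha> \<beta> r = (LINT s:{0..r}|lebesgue. exp (- lam * s) * l (X.st \<alpha> x w s) (Y.st \<beta> y z s) w z (\<alpha> s) (\<beta> s))"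

lemma running_integral:
  assumes "\<alpha> \<in> controls A" "\<beta> \<in> controls B" "w \<in> {-1, 1}" "z \<in> {-1, 1}"
    and "ereal r \<le> X.exit \<alpha> x w" "ereal r \<le> Y.exit \<beta> y z"
  shows "running x y w z \<alpha> \<beta> r = integral {0..r} (discounted x y w z \<alpha> \<beta>)"
proof -
  have "running x y w z \<alpha> \<beta> r = (LINT s:{0..r}|lebesgue. discounted x y w z \<alpha> \<beta> s)"
    unfolding running_def
  proof (rule set_lebesgue_integral_cong)
    show "\<forall>s. s \<in> {0..r} \<longrightarrow> exp (- lam * s) * l (X.st \<alpha> x w s) (Y.st \<beta> y z s) w z (\<alpha> s) (\<beta> s) = discounted x y w z \<alpha> \<beta> s"
    proof (intro allI impI)
      fix s assume "s \<in> {0..r}"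
      then have s: "ereal s \<le> X.exit \<alpha> x w" "ereal s \<le> Y.exit \<beta> y z"
        using assms(5,6) by (auto elim!: order_trans[rotated])
      show "exp (- lam * s) * l (X.st \<alpha> x w s) (Y.st \<beta> y z s) w z (\<alpha> s) (\<beta> s) = discounted x y w z \<alpha> \<beta> s"
        by (simp add: discounted_def X.label_until_exit[OF s(1)] Y.label_until_exit[OF s(2)])
    qed
  qed simp
  also have "\<dots> = integral {0..r} (discounted x y w z \<alpha> \<beta>)"
    using assms by (intro set_lebesgue_integral_eq_integral(2) discounted_integrable) auto
  finally show ?thesis .
qed

text \<open>The dynamic programming identity for fixed controls. Each system may be restarted with its new
  label only if it exits exactly at \<open>r\<close>.\<close>

lemma cost_restart:
  assumes \<alpha>: "\<alpha> \<in> controls A" and \<beta>: "\<beta> \<in> controls B" and w: "w \<in> {-1, 1}" and z: "z \<in> {-1, 1}"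
    and x: "0 \<le> X.depth w x" and y: "0 \<le> Y.depth z y"
    and r: "0 \<le> r" "ereal r \<le> X.exit \<alpha> x w" "ereal r \<le> Y.exit \<beta> y z"
    and w': "w' = w \<or> w' = - w \<and> X.exit \<alpha> x w = ereal r"
    and z': "z' = z \<or> z' = - z \<and> Y.exit \<beta> y z = ereal r"
  shows "J x y w z \<alpha> \<beta> = running x y w z \<alpha> \<beta> r +
    exp (- lam * r) * J (X.traj \<alpha> x w r) (Y.traj \<beta> y z r) w' z' (shift r \<alpha>) (shift r \<beta>)"
proof -
  let ?D = "discounted x y w z \<alpha> \<beta>"
  let ?p = "X.traj \<alpha> x w r" and ?q = "Y.traj \<beta> y z r"
  let ?E = "discounted ?p ?q w' z' (shift r \<alpha>) (shift r \<beta>)"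
  have sh: "shift r \<alpha> \<in> controls A" "shift r \<beta> \<in> controls B" using \<alpha> \<beta> r by (auto intro: shift_control)
  have lab: "w' \<in> {-1, 1}" "z' \<in> {-1, 1}" using w z w' z' by auto
  have int: "?D absolutely_integrable_on {r..}" "?D integrable_on {r..}" "?D integrable_on {0..r}"
    using r by (intro discounted_integrable[OF \<alpha> \<beta> w z]; auto)+
  have "{0..} = {0..r} \<union> {r..}" using r by auto
  then have "J x y w z \<alpha> \<beta> = integral ({0..r} \<union> {r..}) ?D" using cost_integral[OF \<alpha> \<beta> w z] by simp
  also have "\<dots> = integral {0..r} ?D + integral {r..} ?D"
    using int by (intro Henstock_Kurzweil_Integration.integral_Un) (auto intro: negligible_subset[of "{r}"])
  also have "integral {r..} ?D = (LINT s:{r..}|lebesgue. ?D s)"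
    by (rule set_lebesgue_integral_eq_integral(2)[symmetric, OF int(1)])
  also have "\<dots> = (LINT s:{s. r + s \<in> {r..}}|lebesgue. ?D (r + s))" by (rule set_integral_time_shift)
  also have "\<dots> = (LINT s:{0..}|lebesgue. ?D (r + s))" by (simp add: atLeast_def)
  also have "\<dots> = integral {0..} (\<lambda>s. ?D (r + s))"
  proof (rule set_lebesgue_integral_eq_integral(2))
    show "(\<lambda>s. ?D (r + s)) absolutely_integrable_on {0..}"
    proof (rule measurable_bounded_by_integrable_imp_absolutely_integrable)
      show "(\<lambda>s. ?D (r + s)) \<in> borel_measurable (lebesgue_on {0..})"
        using discounted_measurable[OF \<alpha> \<beta> w z] r by (intro measurable_time_shift)
      show "(\<lambda>t. Kb * exp (- lam * t)) integrable_on {0..}"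
        using exp_decay_integral[OF lam_pos, of 0] by (intro integrable_on_mult_right) blast
      fix s :: real assume s: "s \<in> {0..}"
      have "\<bar>?D (r + s)\<bar> \<le> Kb * exp (- lam * (r + s))"
        using s r by (intro discounted_bound[OF \<alpha> \<beta> w z]) auto
      also have "\<dots> \<le> Kb * exp (- lam * s)"
        using r lam_pos Kb_nonneg by (intro mult_left_mono) auto
      finally show "norm (?D (r + s)) \<le> Kb * exp (- lam * s)" by simp
    qed auto
  qed
  also have "\<dots> = integral {0..} (\<lambda>s. exp (- lam * r) * ?E s)"
  proof (rule integral_spike[of "{0}"])
    fix s :: real assume "s \<in> {0..} - {0}"
    then have s: "0 < s" by auto
    have "exp (- lam * (r + s)) = exp (- lam * r) * exp (- lam * s)"
      by (simp add: distrib_left exp_add[symmetric])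
    then show "exp (- lam * r) * ?E s = ?D (r + s)"
      using X.state_restart[OF \<alpha> w x r(1,2) s w'] X.label_restart[OF \<alpha> w x r(1,2) s w']
        Y.state_restart[OF \<beta> z y r(1,3) s z'] Y.label_restart[OF \<beta> z y r(1,3) s z']
      by (simp add: discounted_def shift_def)
  qed auto
  also have "\<dots> = exp (- lam * r) * J ?p ?q w' z' (shift r \<alpha>) (shift r \<beta>)"
    by (simp add: cost_integral[OF sh lab])
  finally show ?thesis using running_integral[OF \<alpha> \<beta> w z r(2,3)] by simp
qed

lemma running_agree:
  assumes \<alpha>: "\<alpha> \<in> controls A" "\<alpha>' \<in> controls A" and \<beta>: "\<beta> \<in> controls B" "\<beta>' \<in> controls B"
    and w: "w \<in> {-1, 1}" and z: "z \<in> {-1, 1}"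
    and r: "ereal r \<le> X.exit \<alpha> x w" "ereal r \<le> Y.exit \<beta> y z"
    and ag: "agree r \<alpha> \<alpha>'" "agree r \<beta> \<beta>'"
  shows "running x y w z \<alpha>' \<beta>' r = running x y w z \<alpha> \<beta> r"
proof -
  have r': "ereal r \<le> X.exit \<alpha>' x w" "ereal r \<le> Y.exit \<beta>' y z"
    using X.exit_agree_ge[OF \<alpha> w ag(1) r(1)] Y.exit_agree_ge[OF \<beta> z ag(2) r(2)] by auto
  show ?thesis
    unfolding running_integral[OF \<alpha>(1) \<beta>(1) w z r] running_integral[OF \<alpha>(2) \<beta>(2) w z r']
  proof (rule integral_spike[of "{s \<in> {0..r}. \<alpha> s \<noteq> \<alpha>' s} \<union> {s \<in> {0..r}. \<beta> s \<noteq> \<beta>' s}"])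
    show "negligible ({s \<in> {0..r}. \<alpha> s \<noteq> \<alpha>' s} \<union> {s \<in> {0..r}. \<beta> s \<noteq> \<beta>' s})"
      using ag by (auto simp: agree_iff_negligible)
    fix s assume s: "s \<in> {0..r} - ({s \<in> {0..r}. \<alpha> s \<noteq> \<alpha>' s} \<union> {s \<in> {0..r}. \<beta> s \<noteq> \<beta>' s})"
    then have "ereal s \<le> ereal r" by simp
    then have e: "ereal s \<le> X.exit \<alpha> x w" "ereal s \<le> Y.exit \<beta> y z" "ereal s \<le> X.exit \<alpha>' x w" "ereal s \<le> Y.exit \<beta>' y z"
      using r r' order_trans by blast+
    show "discounted x y w z \<alpha> \<beta> s = discounted x y w z \<alpha>' \<beta>' s"
      using s X.traj_agree[OF \<alpha> w ag(1), of s x] Y.traj_agree[OF \<beta> z ag(2), of s y]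
      by (simp add: discounted_def X.label_until_exit[OF e(1)] X.label_until_exit[OF e(3)] Y.label_until_exit[OF e(2)]
          Y.label_until_exit[OF e(4)] X.state_until_exit[OF e(1)] X.state_until_exit[OF e(3)] Y.state_until_exit[OF e(2)]
          Y.state_until_exit[OF e(4)])
  qed
qed

text \<open>The three terms account for the small distance of the states, for the exceptional times, and for
  the discounted future after \<open>T\<close>.\<close>

lemma cost_tracks:
  assumes \<alpha>: "\<alpha> \<in> controls A" "\<alpha>' \<in> controls A" and \<beta>: "\<beta> \<in> controls B" "\<beta>' \<in> controls B"
    and w: "w \<in> {-1, 1}" and z: "z \<in> {-1, 1}" and T: "0 \<le> T" and e: "0 \<le> e"
    and tr: "X.tracks T e \<alpha> x w \<alpha>' x w" "Y.tracks T e \<beta> y z \<beta>' y z"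
  shows "\<bar>J x y w z \<alpha> \<beta> - J x y w z \<alpha>' \<beta>'\<bar> \<le> Kl * (2 * e) * T + 2 * Kb * (2 * e) + 2 * Kb * (exp (- lam * T) / lam)"
proof -
  let ?D = "discounted x y w z \<alpha> \<beta>" and ?D' = "discounted x y w z \<alpha>' \<beta>'"
  obtain E1 where E1: "E1 \<in> lmeasurable" "measure lebesgue E1 \<le> e"
    "\<And>t. 0 < t \<Longrightarrow> t \<le> T \<Longrightarrow> t \<notin> E1 \<Longrightarrow> X.lb \<alpha> x w t = X.lb \<alpha>' x w t \<and> \<alpha> t = \<alpha>' t \<and> norm (X.st \<alpha> x w t - X.st \<alpha>' x w t) \<le> e"
    using tr(1) unfolding X.tracks_def by blast
  obtain E2 where E2: "E2 \<in> lmeasurable" "measure lebesgue E2 \<le> e"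
    "\<And>t. 0 < t \<Longrightarrow> t \<le> T \<Longrightarrow> t \<notin> E2 \<Longrightarrow> Y.lb \<beta> y z t = Y.lb \<beta>' y z t \<and> \<beta> t = \<beta>' t \<and> norm (Y.st \<beta> y z t - Y.st \<beta>' y z t) \<le> e"
    using tr(2) unfolding Y.tracks_def by blast
  define E where "E = E1 \<union> E2 \<union> {0}"
  have E: "E \<in> lmeasurable" unfolding E_def using E1(1) E2(1) negligible_imp_measurable[OF negligible_sing[of "0::real"]] by (intro fmeasurable.Un)
  have "measure lebesgue E \<le> measure lebesgue (E1 \<union> E2) + measure lebesgue {0::real}"
    unfolding E_def using E1 E2 by (intro measure_Un_le) (auto simp: fmeasurableD)
  also have "measure lebesgue (E1 \<union> E2) \<le> measure lebesgue E1 + measure lebesgue E2"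
    using E1 E2 by (intro measure_Un_le) (auto simp: fmeasurableD)
  finally have Em: "measure lebesgue E \<le> 2 * e" using E1 E2 by simp
  define h where "h t = Kl * (2 * e) * indicator {0..T} t + 2 * Kb * indicator E t +
     2 * Kb * (if t \<in> {T..} then exp (- lam * t) else 0)" for t
  have iT: "(indicator {0..T} :: real \<Rightarrow> real) integrable_on {0..}"
    by (subst integrable_on_indicator) (auto simp: Int_absorb2)
  have iE: "(indicator E :: real \<Rightarrow> real) integrable_on {0..}"
    using E by (subst integrable_on_indicator) (auto intro: fmeasurable_Int_fmeasurable)
  have sub: "{T..} \<subseteq> {0..}" using T by auto
  have iX: "((\<lambda>t. if t \<in> {T..} then exp (- lam * t) else 0) has_integral exp (- lam * T) / lam) {0..}"
    using exp_decay_integral[OF lam_pos, of T] by (subst has_integral_restrict[OF sub])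
  have h_int: "h integrable_on {0..}"
    unfolding h_def[abs_def] using iX by (intro integrable_add integrable_on_mult_right iT iE) blast
  have "integral {0..} h = Kl * (2 * e) * integral {0..} (indicator {0..T}) + 2 * Kb * integral {0..} (indicator E) +
     2 * Kb * (exp (- lam * T) / lam)"
    unfolding h_def[abs_def] using integral_unique[OF iX] iT iE has_integral_integrable[OF iX]
    by (simp add: Henstock_Kurzweil_Integration.integral_add integrable_add integrable_on_mult_right)
  also have "integral {0..} (indicator {0..T}) = T"
    using T by (subst Equivalence_Lebesgue_Henstock_Integration.integral_indicator) (auto simp: Int_absorb2)
  also have "integral {0..} (indicator E) = measure lebesgue (E \<inter> {0..})"
    using E by (intro Equivalence_Lebesgue_Henstock_Integration.integral_indicator) (auto intro: fmeasurable_Int_fmeasurable)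
  finally have h_eq: "integral {0..} h = Kl * (2 * e) * T + 2 * Kb * measure lebesgue (E \<inter> {0..}) +
     2 * Kb * (exp (- lam * T) / lam)" .
  have "measure lebesgue (E \<inter> {0..}) \<le> measure lebesgue E"
    using E by (intro measure_mono_fmeasurable) (auto simp: fmeasurableD)
  then have "2 * Kb * measure lebesgue (E \<inter> {0..}) \<le> 2 * Kb * (2 * e)"
    using Em Kb_nonneg by (intro mult_left_mono) auto
  moreover have "norm (integral {0..} (\<lambda>t. ?D t - ?D' t)) \<le> integral {0..} h"
  proof (rule integral_norm_bound_integral[OF _ h_int])
    show "(\<lambda>t. ?D t - ?D' t) integrable_on {0..}"
      using \<alpha> \<beta> w z by (intro integrable_diff discounted_integrable) auto
    fix t :: real assume t: "t \<in> {0..}"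
    have b: "\<bar>?D t\<bar> \<le> Kb * exp (- lam * t)" "\<bar>?D' t\<bar> \<le> Kb * exp (- lam * t)"
      using t discounted_bound[OF \<alpha>(1) \<beta>(1) w z, of t] discounted_bound[OF \<alpha>(2) \<beta>(2) w z, of t] by simp_all
    have le1: "exp (- lam * t) \<le> 1" using t lam_pos by simp
    have nn: "0 \<le> Kl * (2 * e) * indicator {0..T} t" "0 \<le> 2 * Kb * indicator E t"
      "0 \<le> 2 * Kb * (if t \<in> {T..} then exp (- lam * t) else 0)"
      using Kl_nonneg Kb_nonneg e by auto
    consider "t \<in> E" | "T \<le> t" | "t \<notin> E" "t < T" by linarith
    then have "\<bar>?D t - ?D' t\<bar> \<le> h t"
    proof cases
      case 1
      have "Kb * exp (- lam * t) \<le> Kb" using le1 Kb_nonneg mult_left_mono[of "exp (- lam * t)" 1 Kb] by simp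
      then have "\<bar>?D t - ?D' t\<bar> \<le> 2 * Kb" using b by linarith
      moreover have "2 * Kb * indicator E t = 2 * Kb" using 1 by simp
      ultimately show ?thesis unfolding h_def using nn by linarith
    next
      case 2
      have "\<bar>?D t - ?D' t\<bar> \<le> 2 * (Kb * exp (- lam * t))" using b by linarith
      moreover have "2 * Kb * (if t \<in> {T..} then exp (- lam * t) else 0) = 2 * (Kb * exp (- lam * t))" using 2 by simp
      ultimately show ?thesis unfolding h_def using nn by linarith
    next
      case 3
      then have t0: "0 < t" using t by (auto simp: E_def)
      let ?x = "X.st \<alpha> x w t" and ?x' = "X.st \<alpha>' x w t" and ?y = "Y.st \<beta> y z t" and ?y' = "Y.st \<beta>' y z t"
      let ?w = "X.lb \<alpha> x w t" and ?z = "Y.lb \<beta> y z t"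
      have eq: "X.lb \<alpha>' x w t = ?w" "\<alpha>' t = \<alpha> t" "norm (?x - ?x') \<le> e"
        "Y.lb \<beta>' y z t = ?z" "\<beta>' t = \<beta> t" "norm (?y - ?y') \<le> e"
        using E1(3)[of t] E2(3)[of t] 3 t0 by (auto simp: E_def)
      have "\<bar>l ?x ?y ?w ?z (\<alpha> t) (\<beta> t) - l ?x' ?y' ?w ?z (\<alpha> t) (\<beta> t)\<bar> \<le> Kl * (norm (?x - ?x') + norm (?y - ?y'))"
        using t by (intro l_lips X.label_cases[OF w] Y.label_cases[OF z] controls_in[OF \<alpha>(1)] controls_in[OF \<beta>(1)]) auto
      also have "\<dots> \<le> Kl * (2 * e)" using eq Kl_nonneg by (intro mult_left_mono) auto
      finally have d: "\<bar>l ?x ?y ?w ?z (\<alpha> t) (\<beta> t) - l ?x' ?y' ?w ?z (\<alpha> t) (\<beta> t)\<bar> \<le> Kl * (2 * e)" .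
      have "\<bar>?D t - ?D' t\<bar> = exp (- lam * t) * \<bar>l ?x ?y ?w ?z (\<alpha> t) (\<beta> t) - l ?x' ?y' ?w ?z (\<alpha> t) (\<beta> t)\<bar>"
        by (simp add: discounted_def eq right_diff_distrib[symmetric] abs_mult)
      also have "\<dots> \<le> 1 * (Kl * (2 * e))" using le1 d by (intro mult_mono) auto
      also have "\<dots> = Kl * (2 * e) * indicator {0..T} t" using 3 t by simp
      finally show ?thesis unfolding h_def using nn by linarith
    qed
    then show "norm (?D t - ?D' t) \<le> h t" by simp
  qed
  moreover have "J x y w z \<alpha> \<beta> - J x y w z \<alpha>' \<beta>' = integral {0..} (\<lambda>t. ?D t - ?D' t)"
    using \<alpha> \<beta> w z
    by (subst Henstock_Kurzweil_Integration.integral_diff) (auto simp: cost_integral intro!: discounted_integrable)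
  ultimately show ?thesis using h_eq by simp
qed

lemma cost_close:
  assumes "0 < \<epsilon>"
  obtains T e where "0 < e" "\<And>x y w z \<alpha> \<alpha>' \<beta> \<beta>'. \<alpha> \<in> controls A \<Longrightarrow> \<alpha>' \<in> controls A \<Longrightarrow> \<beta> \<in> controls B \<Longrightarrow> \<beta>' \<in> controls B \<Longrightarrow>
    w \<in> {-1, 1} \<Longrightarrow> z \<in> {-1, 1} \<Longrightarrow> X.tracks T e \<alpha> x w \<alpha>' x w \<Longrightarrow> Y.tracks T e \<beta> y z \<beta>' y z \<Longrightarrow>
    \<bar>J x y w z \<alpha> \<beta> - J x y w z \<alpha>' \<beta>'\<bar> \<le> \<epsilon>"
proof -
  have "((\<lambda>T. 2 * Kb * (exp (- lam * T) / lam)) \<longlongrightarrow> 2 * Kb * (0 / lam)) at_top"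
  proof (intro tendsto_intros)
    have "filterlim (\<lambda>T. lam * T) at_top at_top"
      using filterlim_tendsto_pos_mult_at_top[OF tendsto_const lam_pos filterlim_ident] .
    then have "filterlim (\<lambda>T. - (lam * T)) at_bot at_top" by (simp add: filterlim_uminus_at_bot)
    then show "((\<lambda>T. exp (- lam * T)) \<longlongrightarrow> 0) at_top"
      using filterlim_compose[OF exp_at_bot] by simp
  qed (use lam_pos in auto)
  then have "\<forall>\<^sub>F T in at_top. 2 * Kb * (exp (- lam * T) / lam) < \<epsilon> / 2"
    using assms by (intro order_tendstoD(2)) auto
  then have "\<forall>\<^sub>F T in at_top. 2 * Kb * (exp (- lam * T) / lam) < \<epsilon> / 2 \<and> 0 \<le> T"
    using eventually_ge_at_top[of 0] by eventually_elim auto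
  then obtain T where T: "2 * Kb * (exp (- lam * T) / lam) < \<epsilon> / 2" "0 \<le> T"
    using eventually_happens'[OF trivial_limit_at_top_linorder] by blast
  have "\<forall>\<^sub>F e in at_right (0::real). (2 * Kl * T + 4 * Kb) * e \<le> \<epsilon> / 2 \<and> 0 < e"
    using assms by (intro eventually_conj eventually_small_multiple eventually_at_right_less) auto
  then obtain e where e: "(2 * Kl * T + 4 * Kb) * e \<le> \<epsilon> / 2" "0 < e"
    using eventually_happens'[OF trivial_limit_at_right_real] by blast
  show ?thesis
  proof (rule that[of e T])
    fix x y w z \<alpha> \<alpha>' \<beta> \<beta>'
    assume "\<alpha> \<in> controls A" "\<alpha>' \<in> controls A" "\<beta> \<in> controls B" "\<beta>' \<in> controls B" "w \<in> {-1, 1}" "z \<in> {-1, 1}"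
      "X.tracks T e \<alpha> x w \<alpha>' x w" "Y.tracks T e \<beta> y z \<beta>' y z"
    then have "\<bar>J x y w z \<alpha> \<beta> - J x y w z \<alpha>' \<beta>'\<bar> \<le> Kl * (2 * e) * T + 2 * Kb * (2 * e) + 2 * Kb * (exp (- lam * T) / lam)"
      using T e by (intro cost_tracks) auto
    also have "Kl * (2 * e) * T + 2 * Kb * (2 * e) = (2 * Kl * T + 4 * Kb) * e" by (simp add: algebra_simps)
    finally show "\<bar>J x y w z \<alpha> \<beta> - J x y w z \<alpha>' \<beta>'\<bar> \<le> \<epsilon>" using T e by linarith
  qed (rule e)
qed

end

section \<open>The lower value at the first switching\<close>

context switching_game
begin

lemma strategies_nonempty: "strategies B A \<noteq> {}"
proof -
  obtain a where "a \<in> A" using X.controls_nonempty by blast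
  then have "(\<lambda>_ _. a) \<in> strategies B A" by (intro strategiesI const_control) auto
  then show ?thesis by blast
qed

lemma controls_nonempty: "controls B \<noteq> {}"
  using Y.controls_nonempty const_control by blast

lemma cost_response_bdd:
  assumes "\<gamma> \<in> strategies B A" "w \<in> {-1, 1}" "z \<in> {-1, 1}"
  shows "bdd_above ((\<lambda>\<beta>. J x y w z (\<gamma> \<beta>) \<beta>) ` controls B)"
proof (rule bdd_aboveI2)
  fix \<beta> assume "\<beta> \<in> controls B"
  from cost_bound[OF strategies_control[OF assms(1) this] this assms(2,3), of x y]
  show "J x y w z (\<gamma> \<beta>) \<beta> \<le> Kb / lam" by linarith
qed

lemma sup_cost_bound:
  assumes "\<gamma> \<in> strategies B A" "w \<in> {-1, 1}" "z \<in> {-1, 1}"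
  shows "\<bar>SUP \<beta>\<in>controls B. J x y w z (\<gamma> \<beta>) \<beta>\<bar> \<le> Kb / lam"
proof -
  have b: "\<bar>J x y w z (\<gamma> \<beta>) \<beta>\<bar> \<le> Kb / lam" if "\<beta> \<in> controls B" for \<beta>
    by (rule cost_bound[OF strategies_control[OF assms(1) that] that assms(2,3)])
  obtain \<beta> where \<beta>: "\<beta> \<in> controls B" using controls_nonempty by blast
  have "(SUP \<beta>\<in>controls B. J x y w z (\<gamma> \<beta>) \<beta>) \<le> Kb / lam"
    by (intro cSUP_least controls_nonempty order_trans[OF abs_ge_self b])
  moreover have "J x y w z (\<gamma> \<beta>) \<beta> \<le> (SUP \<beta>\<in>controls B. J x y w z (\<gamma> \<beta>) \<beta>)"
    using \<beta> by (intro cSUP_upper cost_response_bdd assms)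
  ultimately show ?thesis using b[OF \<beta>] by linarith
qed

lemma sup_cost_bdd:
  assumes "w \<in> {-1, 1}" "z \<in> {-1, 1}"
  shows "bdd_below ((\<lambda>\<gamma>. SUP \<beta>\<in>controls B. J x y w z (\<gamma> \<beta>) \<beta>) ` strategies B A)"
  using sup_cost_bound[OF _ assms] by (intro bdd_belowI2[of _ "- (Kb / lam)"]) (simp add: abs_le_iff minus_le_iff)

lemma lower_value_le:
  assumes "\<gamma> \<in> strategies B A" "w \<in> {-1, 1}" "z \<in> {-1, 1}"
  shows "V x y w z \<le> (SUP \<beta>\<in>controls B. J x y w z (\<gamma> \<beta>) \<beta>)"
  unfolding lower_value_def by (rule cINF_lower[OF sup_cost_bdd[OF assms(2,3)] assms(1)])

lemma near_optimal_strategy: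
  assumes "w \<in> {-1, 1}" "z \<in> {-1, 1}" "0 < \<epsilon>"
  shows "\<exists>\<gamma>\<in>strategies B A. \<forall>\<beta>\<in>controls B. J x y w z (\<gamma> \<beta>) \<beta> \<le> V x y w z + \<epsilon>"
proof -
  have "V x y w z < V x y w z + \<epsilon>" using assms by simp
  then obtain \<gamma> where \<gamma>: "\<gamma> \<in> strategies B A" "(SUP \<beta>\<in>controls B. J x y w z (\<gamma> \<beta>) \<beta>) < V x y w z + \<epsilon>"
    unfolding lower_value_def cINF_less_iff[OF strategies_nonempty sup_cost_bdd[OF assms(1,2)]] by blast
  have "J x y w z (\<gamma> \<beta>) \<beta> \<le> V x y w z + \<epsilon>" if "\<beta> \<in> controls B" for \<beta>
    using cSUP_upper[OF that cost_response_bdd[OF \<gamma>(1) assms(1,2)], of x y] \<gamma>(2) by linarith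
  then show ?thesis using \<gamma> by blast
qed

lemma near_optimal_response:
  assumes "\<gamma> \<in> strategies B A" "w \<in> {-1, 1}" "z \<in> {-1, 1}" "0 < \<epsilon>"
  shows "\<exists>\<beta>\<in>controls B. V x y w z - \<epsilon> < J x y w z (\<gamma> \<beta>) \<beta>"
proof -
  have "V x y w z - \<epsilon> < (SUP \<beta>\<in>controls B. J x y w z (\<gamma> \<beta>) \<beta>)"
    using lower_value_le[OF assms(1-3), of x y] assms(4) by linarith
  then show ?thesis unfolding less_cSUP_iff[OF controls_nonempty cost_response_bdd[OF assms(1-3)]] by blast
qed

lemma lower_value_bound:
  assumes "w \<in> {-1, 1}" "z \<in> {-1, 1}"
  shows "\<bar>V x y w z\<bar> \<le> Kb / lam"
proof -
  obtain \<gamma> where \<gamma>: "\<gamma> \<in> strategies B A" using strategies_nonempty by blast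
  have "- (Kb / lam) \<le> V x y w z"
    unfolding lower_value_def
  proof (rule cINF_greatest[OF strategies_nonempty])
    fix \<gamma> assume "\<gamma> \<in> strategies B A"
    from sup_cost_bound[OF this assms, of x y]
    show "- (Kb / lam) \<le> (SUP \<beta>\<in>controls B. J x y w z (\<gamma> \<beta>) \<beta>)" by linarith
  qed
  moreover have "V x y w z \<le> Kb / lam"
    using lower_value_le[OF \<gamma> assms, of x y] sup_cost_bound[OF \<gamma> assms, of x y] by linarith
  ultimately show ?thesis by linarith
qed

lemma never_switching_cost:
  assumes "min (X.exit \<alpha> x w) (Y.exit \<beta> y z) = \<infinity>"
  shows "G x y w z \<alpha> \<beta> = J x y w z \<alpha> \<beta>"
proof -
  have e: "X.exit \<alpha> x w = \<infinity>" "Y.exit \<beta> y z = \<infinity>" using assms by (auto simp: min_def split: if_splits)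
  have "X.lb \<alpha> x w s = w" "Y.lb \<beta> y z s = z" for s
    using e by (auto intro: X.label_until_exit Y.label_until_exit)
  then show ?thesis using e by (simp add: cost_to_first_switch_def switched_label_def cost_def atLeast_def)
qed

lemma switching_cost:
  assumes m: "min (X.exit \<alpha> x w) (Y.exit \<beta> y z) = ereal r"
    and sl: "switched_label (X.exit \<alpha> x w) (Y.exit \<beta> y z) w z = (w', z')"
  shows "G x y w z \<alpha> \<beta> = running x y w z \<alpha> \<beta> r +
    exp (- lam * r) * V (X.traj \<alpha> x w r) (Y.traj \<beta> y z r) w' z'"
proof -
  have r: "ereal r \<le> X.exit \<alpha> x w" "ereal r \<le> Y.exit \<beta> y z" by (auto simp flip: m)
  show ?thesis
    unfolding cost_to_first_switch_def Let_def m sl prod.case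
    by (simp add: running_def X.state_until_exit[OF r(1)] Y.state_until_exit[OF r(2)] atLeastAtMost_def atLeast_def
        atMost_def Int_def)
qed

lemma switched_label_cases:
  assumes "min S T = ereal r" "switched_label S T w z = (w', z')"
  shows "(w' = w \<and> ereal r < S) \<or> (w' = - w \<and> S = ereal r)"
    and "(z' = z \<and> ereal r < T) \<or> (z' = - z \<and> T = ereal r)"
    and "ereal r \<le> S" "ereal r \<le> T"
  using assms by (auto simp: switched_label_def min_def split: if_splits)

text \<open>A first switching strictly before \<open>t\<close>, including the decision which systems switch, is determined
  by the controls on \<open>{0..t}\<close>: if one of the two exit times is not yet determined, it is at least \<open>t\<close>.\<close>

lemma first_switch_agree:
  assumes \<alpha>: "\<alpha> \<in> controls A" "\<alpha>' \<in> controls A" and \<beta>: "\<beta> \<in> controls B" "\<beta>' \<in> controls B"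
    and w: "w \<in> {-1, 1}" and z: "z \<in> {-1, 1}" and ag: "agree t \<alpha> \<alpha>'" "agree t \<beta> \<beta>'"
    and lt: "min (X.exit \<alpha> x w) (Y.exit \<beta> y z) < ereal t"
  shows "min (X.exit \<alpha>' x w) (Y.exit \<beta>' y z) = min (X.exit \<alpha> x w) (Y.exit \<beta> y z) \<and>
    switched_label (X.exit \<alpha>' x w) (Y.exit \<beta>' y z) w z = switched_label (X.exit \<alpha> x w) (Y.exit \<beta> y z) w z"
proof -
  have X: "X.exit \<alpha>' x w = X.exit \<alpha> x w \<or> (ereal t \<le> X.exit \<alpha> x w \<and> ereal t \<le> X.exit \<alpha>' x w)"
    using X.exit_agree[OF \<alpha> w ag(1), of x] X.exit_agree_ge[OF \<alpha> w ag(1), of x] by (meson not_le)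
  have Y: "Y.exit \<beta>' y z = Y.exit \<beta> y z \<or> (ereal t \<le> Y.exit \<beta> y z \<and> ereal t \<le> Y.exit \<beta>' y z)"
    using Y.exit_agree[OF \<beta> z ag(2), of y] Y.exit_agree_ge[OF \<beta> z ag(2), of y] by (meson not_le)
  show ?thesis using X Y lt by (auto simp: switched_label_def min_def split: if_splits)
qed

text \<open>The controls \<open>\<alpha>'\<close> and \<open>\<beta>'\<close> may depart from \<open>\<alpha>\<close> and \<open>\<beta>\<close> after the first switching instant \<open>r\<close> of
  the latter. For a system that switches at \<open>r\<close> the departure has to wait for some time \<open>d\<close>, or else the
  switching could be lost. A system that does not switch at \<open>r\<close> is free at once: if it now exits at \<open>r\<close>, then
  restarting it with the old label reproduces that exit.\<close>

lemma cost_restart_agree: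
  assumes \<alpha>: "\<alpha> \<in> controls A" "\<alpha>' \<in> controls A" and \<beta>: "\<beta> \<in> controls B" "\<beta>' \<in> controls B"
    and w: "w \<in> {-1, 1}" and z: "z \<in> {-1, 1}"
    and x: "0 \<le> X.depth w x" and y: "0 \<le> Y.depth z y"
    and m: "min (X.exit \<alpha> x w) (Y.exit \<beta> y z) = ereal r"
    and sl: "switched_label (X.exit \<alpha> x w) (Y.exit \<beta> y z) w z = (w', z')"
    and ag: "agree r \<alpha> \<alpha>'" "agree r \<beta> \<beta>'"
    and d: "0 < d" "w' = - w \<Longrightarrow> agree (r + d) \<alpha> \<alpha>'" "z' = - z \<Longrightarrow> agree (r + d) \<beta> \<beta>'"
  shows "J x y w z \<alpha>' \<beta>' = running x y w z \<alpha> \<beta> r +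
    exp (- lam * r) * J (X.traj \<alpha> x w r) (Y.traj \<beta> y z r) w' z' (shift r \<alpha>') (shift r \<beta>')"
proof -
  note sc = switched_label_cases[OF m sl]
  have r0: "0 \<le> r" using m X.exit_nonneg[OF w, of \<alpha> x] Y.exit_nonneg[OF z, of \<beta> y]
    by (auto simp: min_def split: if_splits)
  have r': "ereal r \<le> X.exit \<alpha>' x w" "ereal r \<le> Y.exit \<beta>' y z"
    using X.exit_agree_ge[OF \<alpha> w ag(1) sc(3)] Y.exit_agree_ge[OF \<beta> z ag(2) sc(4)] by auto
  have w': "w' = w \<or> w' = - w \<and> X.exit \<alpha>' x w = ereal r"
  proof (rule disjE[OF sc(1)])
    assume s: "w' = - w \<and> X.exit \<alpha> x w = ereal r"
    then show ?thesis using X.exit_agree[OF \<alpha> w d(2), of x] d(1) by simp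
  qed simp
  have z': "z' = z \<or> z' = - z \<and> Y.exit \<beta>' y z = ereal r"
  proof (rule disjE[OF sc(2)])
    assume s: "z' = - z \<and> Y.exit \<beta> y z = ereal r"
    then show ?thesis using Y.exit_agree[OF \<beta> z d(3), of y] d(1) by simp
  qed simp
  have "X.traj \<alpha> x w r = X.traj \<alpha>' x w r" "Y.traj \<beta> y z r = Y.traj \<beta>' y z r"
    using X.traj_agree[OF \<alpha> w ag(1), of r x] Y.traj_agree[OF \<beta> z ag(2), of r y] r0 by auto
  then show ?thesis
    using cost_restart[OF \<alpha>(2) \<beta>(2) w z x y r0 r' w' z'] running_agree[OF \<alpha> \<beta> w z sc(3,4) ag] by simp
qed

lemma
  assumes \<alpha>: "\<alpha> \<in> controls A" and \<beta>: "\<beta> \<in> controls B"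
    and w: "w \<in> {-1, 1}" and z: "z \<in> {-1, 1}"
    and x: "0 \<le> X.depth w x" and y: "0 \<le> Y.depth z y"
    and m: "min (X.exit \<alpha> x w) (Y.exit \<beta> y z) = ereal r"
    and sl: "switched_label (X.exit \<alpha> x w) (Y.exit \<beta> y z) w z = (w', z')"
  shows switch_time_nonneg: "0 \<le> r"
    and switched_label_range: "w' \<in> {-1, 1}" "z' \<in> {-1, 1}"
    and switch_depth: "0 \<le> X.depth w' (X.traj \<alpha> x w r)" "0 \<le> Y.depth z' (Y.traj \<beta> y z r)"
    and switch_depth_X: "w' = - w \<Longrightarrow> X.depth (- w) (X.traj \<alpha> x w r) = X.gap"
    and switch_depth_Y: "z' = - z \<Longrightarrow> Y.depth (- z) (Y.traj \<beta> y z r) = Y.gap"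
proof -
  note sc = switched_label_cases[OF m sl]
  show r0: "0 \<le> r" using m X.exit_nonneg[OF w, of \<alpha> x] Y.exit_nonneg[OF z, of \<beta> y]
    by (auto simp: min_def split: if_splits)
  show "w' \<in> {-1, 1}" "z' \<in> {-1, 1}" using sc(1,2) w z by auto
  show X: "X.depth (- w) (X.traj \<alpha> x w r) = X.gap" if "w' = - w"
    using sc(1) w that by (intro X.depth_after_switch[OF \<alpha> w x]) auto
  show Y: "Y.depth (- z) (Y.traj \<beta> y z r) = Y.gap" if "z' = - z"
    using sc(2) z that by (intro Y.depth_after_switch[OF \<beta> z y]) auto
  show "0 \<le> X.depth w' (X.traj \<alpha> x w r)"
    using sc(1) X X.gap_pos X.inside_until_exit[OF \<alpha> w x r0 sc(3)] by auto
  show "0 \<le> Y.depth z' (Y.traj \<beta> y z r)"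
    using sc(2) Y Y.gap_pos Y.inside_until_exit[OF \<beta> z y r0 sc(4)] by auto
qed

lemma switch_cost_bound:
  assumes \<alpha>: "\<alpha> \<in> controls A" and \<beta>: "\<beta> \<in> controls B" and w: "w \<in> {-1, 1}" and z: "z \<in> {-1, 1}"
    and x: "0 \<le> X.depth w x" and y: "0 \<le> Y.depth z y"
  shows "\<bar>G x y w z \<alpha> \<beta>\<bar> \<le> 3 * (Kb / lam)"
proof (cases "min (X.exit \<alpha> x w) (Y.exit \<beta> y z)")
  case (real r)
  obtain w' z' where sl: "switched_label (X.exit \<alpha> x w) (Y.exit \<beta> y z) w z = (w', z')" by fastforce
  note sc = switched_label_cases[OF real sl]
  let ?p = "X.traj \<alpha> x w r" and ?q = "Y.traj \<beta> y z r"
  have r0: "0 \<le> r" and lab: "w' \<in> {-1, 1}" "z' \<in> {-1, 1}"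
    using switch_time_nonneg[OF \<alpha> \<beta> w z x y real sl] switched_label_range[OF \<alpha> \<beta> w z x y real sl] by auto
  have sh: "shift r \<alpha> \<in> controls A" "shift r \<beta> \<in> controls B" using \<alpha> \<beta> r0 by (auto intro: shift_control)
  have e1: "exp (- lam * r) \<le> 1" using r0 lam_pos by simp
  have sm: "\<bar>exp (- lam * r) * c\<bar> \<le> Kb / lam" if "\<bar>c\<bar> \<le> Kb / lam" for c
    using mult_mono[OF e1 that] by (simp add: abs_mult)
  have "J x y w z \<alpha> \<beta> = running x y w z \<alpha> \<beta> r + exp (- lam * r) * J ?p ?q w' z' (shift r \<alpha>) (shift r \<beta>)"
    by (rule cost_restart_agree[OF \<alpha> \<alpha> \<beta> \<beta> w z x y real sl, of 1]) auto
  then have "\<bar>running x y w z \<alpha> \<beta> r\<bar> \<le> 2 * (Kb / lam)"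
    using cost_bound[OF \<alpha> \<beta> w z, of x y] sm[OF cost_bound[OF sh lab, of ?p ?q]] by linarith
  then show ?thesis
    unfolding switching_cost[OF real sl] using sm[OF lower_value_bound[OF lab, of ?p ?q]] by linarith
next
  case PInf
  have "0 \<le> Kb / lam" using Kb_nonneg lam_pos by simp
  then show ?thesis using cost_bound[OF \<alpha> \<beta> w z, of x y] never_switching_cost[OF PInf] by linarith
next
  case MInf
  then show ?thesis using X.exit_nonneg[OF w, of \<alpha> x] Y.exit_nonneg[OF z, of \<beta> y]
    by (auto simp: min_def split: if_splits)
qed

lemma exit_after_switch:
  assumes "\<alpha> \<in> controls A" "v \<in> {-1, 1}" "X.depth v p = X.gap"
  shows "ereal (X.gap / M1) \<le> X.exit \<alpha> p v"
  using X.exit_lower_bound[OF assms(1,2), of p] assms(3) by simp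

text \<open>Let \<open>\<gamma>\<close> be any strategy in the one-step problem. After the first switching, player one would like
  to change to a near-optimal strategy \<open>opt\<close> for the state that has been reached. If the first system has
  switched, this could undo the switching; then player one plays an imitation of the control \<open>c \<beta>\<close> that
  \<open>opt\<close> prescribes, beginning with what \<open>\<gamma>\<close> would have played. The opponent's control is untouched, so
  that the second system needs no protection. The duration of the beginning has to be fixed by the state at
  the switching alone, since otherwise the strategy would anticipate; this is possible because the state
  lies a full gap inside its new sector.\<close>

lemma lower_value_le_switch:
  assumes w: "w \<in> {-1, 1}" and z: "z \<in> {-1, 1}"
    and x: "0 \<le> X.depth w x" and y: "0 \<le> Y.depth z y" and \<gamma>: "\<gamma> \<in> strategies B A"
  shows "V x y w z \<le> (SUP \<beta>\<in>controls B. G x y w z (\<gamma> \<beta>) \<beta>)"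
proof (rule field_le_epsilon)
  fix \<epsilon>' :: real assume "0 < \<epsilon>'"
  define \<epsilon> where "\<epsilon> = \<epsilon>' / 2"
  have \<epsilon>: "0 < \<epsilon>" "\<epsilon>' = 2 * \<epsilon>" using \<open>0 < \<epsilon>'\<close> by (auto simp: \<epsilon>_def)
  obtain T e where e: "0 < e" and near: "\<And>x y w z \<alpha> \<alpha>' \<beta> \<beta>'. \<alpha> \<in> controls A \<Longrightarrow> \<alpha>' \<in> controls A \<Longrightarrow>
      \<beta> \<in> controls B \<Longrightarrow> \<beta>' \<in> controls B \<Longrightarrow> w \<in> {-1, 1} \<Longrightarrow> z \<in> {-1, 1} \<Longrightarrow>
      X.tracks T e \<alpha> x w \<alpha>' x w \<Longrightarrow> Y.tracks T e \<beta> y z \<beta>' y z \<Longrightarrow>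
      \<bar>J x y w z \<alpha> \<beta> - J x y w z \<alpha>' \<beta>'\<bar> \<le> \<epsilon>"
    using cost_close[OF \<epsilon>(1)] by metis
  define opt where "opt p q v u = (SOME \<gamma>'. \<gamma>' \<in> strategies B A \<and> (\<forall>\<beta>\<in>controls B. J p q v u (\<gamma>' \<beta>) \<beta> \<le> V p q v u + \<epsilon>))" for p q v u
  have opt: "opt p q v u \<in> strategies B A" "\<And>\<beta>. \<beta> \<in> controls B \<Longrightarrow> J p q v u (opt p q v u \<beta>) \<beta> \<le> V p q v u + \<epsilon>"
    if "v \<in> {-1, 1}" "u \<in> {-1, 1}" for p q v u
  proof -
    have "\<exists>\<gamma>'. \<gamma>' \<in> strategies B A \<and> (\<forall>\<beta>\<in>controls B. J p q v u (\<gamma>' \<beta>) \<beta> \<le> V p q v u + \<epsilon>)"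
      using near_optimal_strategy[OF that \<epsilon>(1), of p q] by blast
    from someI_ex[OF this] show "opt p q v u \<in> strategies B A"
      "\<And>\<beta>. \<beta> \<in> controls B \<Longrightarrow> J p q v u (opt p q v u \<beta>) \<beta> \<le> V p q v u + \<epsilon>"
      unfolding opt_def by auto
  qed
  have mw: "- w \<in> {-1, 1}" using w by auto
  have "\<exists>d \<Phi>. 0 < d \<and> d \<le> X.gap / M1 \<and> X.imitation T e p (- w) d \<Phi>" if "X.depth (- w) p = X.gap" for p
  proof -
    have "0 \<le> X.depth (- w) p" using that X.gap_pos by simp
    from X.imitation_exists[OF mw this e, of T]
    obtain d0 where d0: "0 < d0" "\<And>d. 0 < d \<Longrightarrow> d \<le> d0 \<Longrightarrow> \<exists>\<Phi>. X.imitation T e p (- w) d \<Phi>"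
      by blast
    have "0 < X.gap / M1" using X.gap_pos X.M_pos by simp
    then show ?thesis using d0 by (intro exI[of _ "min d0 (X.gap / M1)"]) auto
  qed
  then obtain D F where D: "\<And>p. X.depth (- w) p = X.gap \<Longrightarrow> 0 < D p \<and> D p \<le> X.gap / M1"
    and F: "\<And>p. X.depth (- w) p = X.gap \<Longrightarrow> X.imitation T e p (- w) (D p) (F p)" by metis
  define \<sigma> where "\<sigma> \<beta> = min (X.exit (\<gamma> \<beta>) x w) (Y.exit \<beta> y z)" for \<beta>
  define r where "r \<beta> = real_of_ereal (\<sigma> \<beta>)" for \<beta>
  define lab where "lab \<beta> = switched_label (X.exit (\<gamma> \<beta>) x w) (Y.exit \<beta> y z) w z" for \<beta>
  define p where "p \<beta> = X.traj (\<gamma> \<beta>) x w (r \<beta>)" for \<beta>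
  define q where "q \<beta> = Y.traj \<beta> y z (r \<beta>)" for \<beta>
  define c where "c \<beta> = opt (p \<beta>) (q \<beta>) (fst (lab \<beta>)) (snd (lab \<beta>)) (shift (r \<beta>) \<beta>)" for \<beta>
  (* the second condition holds automatically if the first system switches at a finite time; stating it makes F applicable in any case *)
  define sw where "sw \<beta> \<longleftrightarrow> fst (lab \<beta>) = - w \<and> X.depth (- w) (p \<beta>) = X.gap" for \<beta>
  define \<Psi> where "\<Psi> \<beta> = (if sw \<beta> then F (p \<beta>) (shift (r \<beta>) (\<gamma> \<beta>)) (c \<beta>) else c \<beta>)" for \<beta>
  define \<gamma>' where "\<gamma>' \<beta> = (if \<sigma> \<beta> = \<infinity> then \<gamma> \<beta> else splice (real_of_ereal (\<sigma> \<beta>)) (\<gamma> \<beta>) (\<Psi> \<beta>))" for \<beta>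
  have \<sigma>0: "0 \<le> \<sigma> \<beta>" for \<beta> using X.exit_nonneg[OF w] Y.exit_nonneg[OF z] by (simp add: \<sigma>_def)
  then have r0: "0 \<le> r \<beta>" for \<beta> unfolding r_def by (rule real_of_ereal_pos)
  have \<sigma>r: "\<sigma> \<beta> = ereal (r \<beta>)" if "\<sigma> \<beta> \<noteq> \<infinity>" for \<beta> using that \<sigma>0[of \<beta>] by (cases "\<sigma> \<beta>") (auto simp: r_def)
  have labr: "fst (lab \<beta>) \<in> {-1, 1}" "snd (lab \<beta>) \<in> {-1, 1}" for \<beta>
    using w z by (auto simp: lab_def switched_label_def)
  have \<gamma>c: "\<gamma> \<beta> \<in> controls A" if "\<beta> \<in> controls B" for \<beta> using strategies_control[OF \<gamma> that] .
  have c_ctrl: "c \<beta> \<in> controls A" if "\<beta> \<in> controls B" for \<beta>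
    unfolding c_def using that r0 by (intro strategies_control[OF opt(1)[OF labr]] shift_control)
  have s\<gamma>: "shift (r \<beta>) (\<gamma> \<beta>) \<in> controls A" if "\<beta> \<in> controls B" for \<beta>
    using shift_control[OF \<gamma>c[OF that] r0] .
  have \<Psi>: "\<Psi> \<beta> \<in> controls A" if "\<beta> \<in> controls B" for \<beta>
    using X.imitation_control[OF F s\<gamma>[OF that] c_ctrl[OF that]] c_ctrl[OF that] by (auto simp: \<Psi>_def sw_def)
  have \<gamma>': "\<gamma>' \<in> strategies B A"
    unfolding \<gamma>'_def[abs_def]
  proof (rule splice_strategy[OF \<gamma> \<Psi> \<sigma>0])
    fix \<beta> \<beta>' t
    assume \<beta>: "\<beta> \<in> controls B" "\<beta>' \<in> controls B" and ag: "agree t \<beta> \<beta>'" and lt: "\<sigma> \<beta> < ereal t"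
    have ag\<gamma>: "agree t (\<gamma> \<beta>) (\<gamma> \<beta>')" using strategies_agree[OF \<gamma> \<beta> ag] .
    have eq: "\<sigma> \<beta>' = \<sigma> \<beta>" "lab \<beta>' = lab \<beta>"
      using first_switch_agree[OF \<gamma>c[OF \<beta>(1)] \<gamma>c[OF \<beta>(2)] \<beta> w z ag\<gamma> ag, of x y] lt by (auto simp: \<sigma>_def lab_def)
    have req: "r \<beta>' = r \<beta>" by (simp add: r_def eq)
    have "\<sigma> \<beta> \<noteq> \<infinity>" using lt by auto
    from lt[unfolded \<sigma>r[OF this]] have rt: "r \<beta> < t" by simp
    have pq: "p \<beta>' = p \<beta>" "q \<beta>' = q \<beta>"
      using X.traj_agree[OF \<gamma>c[OF \<beta>(1)] \<gamma>c[OF \<beta>(2)] w ag\<gamma>, of "r \<beta>" x] Y.traj_agree[OF \<beta> z ag, of "r \<beta>" y] r0 rt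
      by (auto simp: p_def q_def req)
    have sw: "sw \<beta>' = sw \<beta>" by (simp add: sw_def eq pq)
    have sh: "agree (t - r \<beta>) (shift (r \<beta>) \<beta>) (shift (r \<beta>) \<beta>')" "agree (t - r \<beta>) (shift (r \<beta>) (\<gamma> \<beta>)) (shift (r \<beta>) (\<gamma> \<beta>'))"
      using ag ag\<gamma> r0 by (auto intro: agree_shift)
    have agc: "agree (t - r \<beta>) (c \<beta>) (c \<beta>')"
      unfolding c_def pq eq req by (intro strategies_agree[OF opt(1)[OF labr] _ _ sh(1)] shift_control \<beta> r0)
    have "agree (t - r \<beta>) (\<Psi> \<beta>) (\<Psi> \<beta>')"
    proof (cases "sw \<beta>")
      case True
      then show ?thesis
        using X.imitation_causal[OF F s\<gamma>[OF \<beta>(1)] s\<gamma>[OF \<beta>(2)] c_ctrl[OF \<beta>(1)] c_ctrl[OF \<beta>(2)], of "p \<beta>" "t - r \<beta>"]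
          sh(2) agc sw by (simp add: \<Psi>_def pq req sw_def)
    qed (use agc sw in \<open>simp add: \<Psi>_def\<close>)
    then show "\<sigma> \<beta>' = \<sigma> \<beta> \<and> agree (t - real_of_ereal (\<sigma> \<beta>)) (\<Psi> \<beta>) (\<Psi> \<beta>')" using eq by (simp add: r_def)
  qed
  have bdd: "bdd_above ((\<lambda>\<beta>. G x y w z (\<gamma> \<beta>) \<beta>) ` controls B)"
  proof (rule bdd_aboveI2)
    fix \<beta> assume "\<beta> \<in> controls B"
    from switch_cost_bound[OF \<gamma>c[OF this] this w z x y]
    show "G x y w z (\<gamma> \<beta>) \<beta> \<le> 3 * (Kb / lam)" by linarith
  qed
  have key: "J x y w z (\<gamma>' \<beta>) \<beta> \<le> G x y w z (\<gamma> \<beta>) \<beta> + 2 * \<epsilon>" if \<beta>: "\<beta> \<in> controls B" for \<beta>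
  proof (cases "\<sigma> \<beta> = \<infinity>")
    case True
    then show ?thesis using never_switching_cost[of "\<gamma> \<beta>" x w \<beta> y z] \<epsilon> by (simp add: \<gamma>'_def \<sigma>_def)
  next
    case False
    note m = \<sigma>r[OF False, unfolded \<sigma>_def]
    define \<alpha>' where "\<alpha>' = \<gamma>' \<beta>"
    obtain w' z' where lab: "lab \<beta> = (w', z')" by fastforce
    note sl = lab[unfolded lab_def]
    note facts = \<gamma>c[OF \<beta>] \<beta> w z x y m sl
    have w'z': "w' \<in> {-1, 1}" "z' \<in> {-1, 1}" by (rule switched_label_range[OF facts])+
    have \<alpha>'c: "\<alpha>' \<in> controls A" unfolding \<alpha>'_def by (rule strategies_control[OF \<gamma>' \<beta>])
    have \<alpha>'_eq: "\<alpha>' = splice (r \<beta>) (\<gamma> \<beta>) (\<Psi> \<beta>)" using False by (simp add: \<alpha>'_def \<gamma>'_def r_def)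
    have sh\<alpha>': "agree t (shift (r \<beta>) \<alpha>') (\<Psi> \<beta>)" for t unfolding \<alpha>'_eq by (rule agree_shift_splice)
    have ag: "agree (r \<beta>) (\<gamma> \<beta>) \<alpha>'" unfolding \<alpha>'_eq by (rule agree_sym[OF agree_splice_self])
    have sw: "sw \<beta> \<longleftrightarrow> w' = - w" using switch_depth_X[OF facts] by (auto simp: sw_def lab p_def)
    define d where "d = (if w' = - w then D (p \<beta>) else 1)"
    have gapp: "X.depth (- w) (p \<beta>) = X.gap" if "w' = - w" using switch_depth_X[OF facts that] by (simp add: p_def)
    have d: "0 < d" using D[OF gapp] by (auto simp: d_def)
    have "agree (r \<beta> + d) (\<gamma> \<beta>) \<alpha>'" if "w' = - w"
    proof (rule agree_join[OF ag])
      have pre: "agree (D (p \<beta>)) (\<Psi> \<beta>) (shift (r \<beta>) (\<gamma> \<beta>))"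
        using X.imitation_prefix[OF F[OF gapp[OF that]] s\<gamma>[OF \<beta>] c_ctrl[OF \<beta>]] sw that by (simp add: \<Psi>_def)
      show "agree d (shift (r \<beta>) (\<gamma> \<beta>)) (shift (r \<beta>) \<alpha>')"
        using that agree_sym[OF agree_trans[OF sh\<alpha>' pre]] by (simp add: d_def)
    qed
    then have J: "J x y w z \<alpha>' \<beta> = running x y w z (\<gamma> \<beta>) \<beta> (r \<beta>) +
        exp (- lam * r \<beta>) * J (p \<beta>) (q \<beta>) w' z' (shift (r \<beta>) \<alpha>') (shift (r \<beta>) \<beta>)"
      using d ag unfolding p_def q_def
      by (intro cost_restart_agree[OF \<gamma>c[OF \<beta>] \<alpha>'c \<beta> \<beta> w z x y m sl]) auto
    have p0: "0 \<le> X.depth w' (p \<beta>)" using switch_depth(1)[OF facts] by (simp add: p_def)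
    have "X.tracks T e (c \<beta>) (p \<beta>) w' (\<Psi> \<beta>) (p \<beta>) w'"
    proof (cases "w' = - w")
      case True
      have "ereal (D (p \<beta>)) \<le> ereal (X.gap / M1)" using D[OF gapp[OF True]] by simp
      also have "\<dots> \<le> X.exit (shift (r \<beta>) (\<gamma> \<beta>)) (p \<beta>) (- w)"
        by (rule exit_after_switch[OF s\<gamma>[OF \<beta>] mw gapp[OF True]])
      finally show ?thesis
        using X.imitation_tracks[OF F[OF gapp[OF True]] s\<gamma>[OF \<beta>] c_ctrl[OF \<beta>]] True sw by (simp add: \<Psi>_def)
    next
      case False
      then show ?thesis using sw X.tracks_refl e by (simp add: \<Psi>_def)
    qed
    then have "X.tracks T e (c \<beta>) (p \<beta>) w' (shift (r \<beta>) \<alpha>') (p \<beta>) w'"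
      by (rule X.tracks_agree[OF _ agree_sym[OF sh\<alpha>'] \<Psi>[OF \<beta>] shift_control[OF \<alpha>'c r0] w'z'(1) p0])
    then have "\<bar>J (p \<beta>) (q \<beta>) w' z' (c \<beta>) (shift (r \<beta>) \<beta>) - J (p \<beta>) (q \<beta>) w' z' (shift (r \<beta>) \<alpha>') (shift (r \<beta>) \<beta>)\<bar> \<le> \<epsilon>"
      using e by (intro near c_ctrl \<beta> shift_control r0 \<alpha>'c w'z' Y.tracks_refl) auto
    moreover have "J (p \<beta>) (q \<beta>) w' z' (c \<beta>) (shift (r \<beta>) \<beta>) \<le> V (p \<beta>) (q \<beta>) w' z' + \<epsilon>"
      unfolding c_def lab fst_conv snd_conv by (intro opt(2) w'z' shift_control \<beta> r0)
    ultimately have "J (p \<beta>) (q \<beta>) w' z' (shift (r \<beta>) \<alpha>') (shift (r \<beta>) \<beta>) \<le> V (p \<beta>) (q \<beta>) w' z' + 2 * \<epsilon>" by linarith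
    then have "exp (- lam * r \<beta>) * J (p \<beta>) (q \<beta>) w' z' (shift (r \<beta>) \<alpha>') (shift (r \<beta>) \<beta>)
        \<le> exp (- lam * r \<beta>) * (V (p \<beta>) (q \<beta>) w' z' + 2 * \<epsilon>)" by (intro mult_left_mono) auto
    also have "\<dots> \<le> exp (- lam * r \<beta>) * V (p \<beta>) (q \<beta>) w' z' + 2 * \<epsilon>"
      using lam_pos r0[of \<beta>] \<epsilon> by (simp add: distrib_left)
    finally show ?thesis
      using J switching_cost[OF m sl] by (simp add: \<alpha>'_def p_def q_def)
  qed
  have "V x y w z \<le> (SUP \<beta>\<in>controls B. J x y w z (\<gamma>' \<beta>) \<beta>)" by (rule lower_value_le[OF \<gamma>' w z])
  also have "\<dots> \<le> (SUP \<beta>\<in>controls B. G x y w z (\<gamma> \<beta>) \<beta>) + \<epsilon>'"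
  proof (rule cSUP_least[OF controls_nonempty])
    fix \<beta> assume \<beta>: "\<beta> \<in> controls B"
    show "J x y w z (\<gamma>' \<beta>) \<beta> \<le> (SUP \<beta>\<in>controls B. G x y w z (\<gamma> \<beta>) \<beta>) + \<epsilon>'"
      using key[OF \<beta>] cSUP_upper[OF \<beta> bdd] \<epsilon>(2) by linarith
  qed
  finally show "V x y w z \<le> (SUP \<beta>\<in>controls B. G x y w z (\<gamma> \<beta>) \<beta>) + \<epsilon>'" .
qed

text \<open>A near-optimal strategy \<open>\<gamma>\<close> of the whole game is near-optimal for the one-step problem. Fix a
  control \<open>\<beta>\<close> with first switching at \<open>r\<close>. Against an opponent \<open>b\<close> in the restarted game, player one answers
  as \<open>\<gamma>\<close> answers to \<open>B' b\<close>, which is \<open>\<beta>\<close> up to \<open>r\<close> followed by an imitation of \<open>b\<close> beginning with the remainder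
  of \<open>\<beta>\<close>. The beginning makes \<open>\<gamma>\<close> answer on \<open>{r..r + d}\<close> as it does to \<open>\<beta>\<close>, so the same systems switch at
  \<open>r\<close>. Thus the lower value at the switching is bounded by costs of \<open>\<gamma>\<close> in the whole game. Only the
  second system is tracked; the first one runs with the same control in both comparisons.\<close>

lemma switch_le_lower_value:
  assumes w: "w \<in> {-1, 1}" and z: "z \<in> {-1, 1}"
    and x: "0 \<le> X.depth w x" and y: "0 \<le> Y.depth z y" and \<epsilon>: "0 < \<epsilon>"
  shows "\<exists>\<gamma>\<in>strategies B A. \<forall>\<beta>\<in>controls B. G x y w z (\<gamma> \<beta>) \<beta> \<le> V x y w z + 3 * \<epsilon>"
proof -
  obtain \<gamma> where \<gamma>: "\<gamma> \<in> strategies B A" and opt: "\<And>\<beta>. \<beta> \<in> controls B \<Longrightarrow> J x y w z (\<gamma> \<beta>) \<beta> \<le> V x y w z + \<epsilon>"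
    using near_optimal_strategy[OF w z \<epsilon>] by metis
  obtain T e where e: "0 < e" and near: "\<And>x y w z \<alpha> \<alpha>' \<beta> \<beta>'. \<alpha> \<in> controls A \<Longrightarrow> \<alpha>' \<in> controls A \<Longrightarrow>
      \<beta> \<in> controls B \<Longrightarrow> \<beta>' \<in> controls B \<Longrightarrow> w \<in> {-1, 1} \<Longrightarrow> z \<in> {-1, 1} \<Longrightarrow>
      X.tracks T e \<alpha> x w \<alpha>' x w \<Longrightarrow> Y.tracks T e \<beta> y z \<beta>' y z \<Longrightarrow>
      \<bar>J x y w z \<alpha> \<beta> - J x y w z \<alpha>' \<beta>'\<bar> \<le> \<epsilon>"
    using cost_close[OF \<epsilon>] by metis
  have \<gamma>c: "\<gamma> \<beta> \<in> controls A" if "\<beta> \<in> controls B" for \<beta> using strategies_control[OF \<gamma> that] .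
  have "G x y w z (\<gamma> \<beta>) \<beta> \<le> V x y w z + 3 * \<epsilon>" if \<beta>: "\<beta> \<in> controls B" for \<beta>
  proof (cases "min (X.exit (\<gamma> \<beta>) x w) (Y.exit \<beta> y z)")
    case (real r)
    obtain w' z' where sl: "switched_label (X.exit (\<gamma> \<beta>) x w) (Y.exit \<beta> y z) w z = (w', z')" by fastforce
    note sc = switched_label_cases[OF real sl]
    note facts = \<gamma>c[OF \<beta>] \<beta> w z x y real sl
    have r0: "0 \<le> r" and w'z': "w' \<in> {-1, 1}" "z' \<in> {-1, 1}"
      by (rule switch_time_nonneg[OF facts], (rule switched_label_range[OF facts])+)
    define p where "p = X.traj (\<gamma> \<beta>) x w r"
    define q where "q = Y.traj \<beta> y z r"
    define b0 where "b0 = shift r \<beta>"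
    have b0: "b0 \<in> controls B" unfolding b0_def using \<beta> r0 by (rule shift_control)
    have q0: "0 \<le> Y.depth z' q" unfolding q_def by (rule switch_depth(2)[OF facts])
    have ex0: "0 < Y.exit b0 q z'"
    proof (rule disjE[OF sc(2)])
      assume s: "z' = z \<and> ereal r < Y.exit \<beta> y z"
      have "ereal r + Y.exit b0 q z = Y.exit \<beta> y z"
        unfolding b0_def q_def by (rule Y.exit_shift[OF \<beta> z r0 sc(4)])
      then show ?thesis using s
        by (cases "Y.exit b0 q z"; cases "Y.exit \<beta> y z") (auto simp: zero_ereal_def)
    next
      assume s: "z' = - z \<and> Y.exit \<beta> y z = ereal r"
      have "Y.depth z' q = Y.gap" using switch_depth_Y[OF facts] s by (simp add: q_def)
      then have "ereal (Y.gap / M2) \<le> Y.exit b0 q z'" using Y.exit_lower_bound[OF b0 w'z'(2), of q] by simp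
      moreover have "0 < ereal (Y.gap / M2)" using Y.gap_pos Y.M_pos by simp
      ultimately show ?thesis by (rule less_le_trans[rotated])
    qed
    obtain d0 where d0: "0 < d0" "\<And>d. 0 < d \<Longrightarrow> d \<le> d0 \<Longrightarrow> \<exists>\<Phi>. Y.imitation T e q z' d \<Phi>"
      using Y.imitation_exists[OF w'z'(2) q0 e, of T] by auto
    obtain d1 where d1: "0 < d1" "ereal d1 \<le> Y.exit b0 q z'"
      using ereal_dense2[OF ex0] by (auto simp: zero_ereal_def intro: less_imp_le)
    define d where "d = min d0 d1"
    have d: "0 < d" "d \<le> d0" "ereal d \<le> Y.exit b0 q z'"
      using d0 d1 by (auto simp: d_def elim!: order_trans[rotated])
    obtain \<Phi> where \<Phi>: "Y.imitation T e q z' d \<Phi>" using d0(2)[OF d(1,2)] by blast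
    define B' where "B' b = splice r \<beta> (\<Phi> b0 b)" for b
    have B'c: "B' b \<in> controls B" if "b \<in> controls B" for b
      unfolding B'_def using \<beta> Y.imitation_control[OF \<Phi> b0 that] r0 by (intro splice_control)
    have shB': "agree t (shift r (B' b)) (\<Phi> b0 b)" for t b unfolding B'_def by (rule agree_shift_splice)
    have agB': "agree (r + d) \<beta> (B' b)" if "b \<in> controls B" for b
    proof (rule agree_join)
      show "agree r \<beta> (B' b)" unfolding B'_def by (rule agree_sym[OF agree_splice_self])
      show "agree d (shift r \<beta>) (shift r (B' b))"
        using agree_trans[OF shB' Y.imitation_prefix[OF \<Phi> b0 that]] unfolding b0_def by (rule agree_sym)
    qed
    define \<gamma>t where "\<gamma>t b = shift r (\<gamma> (B' b))" for b
    have \<gamma>t: "\<gamma>t \<in> strategies B A"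
    proof (rule strategiesI)
      show "\<gamma>t b \<in> controls A" if "b \<in> controls B" for b
        unfolding \<gamma>t_def by (rule shift_control[OF \<gamma>c[OF B'c[OF that]] r0])
      fix t b b' assume t: "(0::real) \<le> t" and b: "b \<in> controls B" "b' \<in> controls B" and ag: "agree t b b'"
      have "agree t (\<Phi> b0 b) (\<Phi> b0 b')" by (rule Y.imitation_causal[OF \<Phi> b0 b0 b agree_refl ag])
      then have "agree (r + t) (B' b) (B' b')" unfolding B'_def using r0 by (intro agree_splice) auto
      from strategies_agree[OF \<gamma> B'c[OF b(1)] B'c[OF b(2)] this]
      show "agree t (\<gamma>t b) (\<gamma>t b')" unfolding \<gamma>t_def using r0 by (rule agree_shift)
    qed
    obtain b where b: "b \<in> controls B" "V p q w' z' - \<epsilon> < J p q w' z' (\<gamma>t b) b"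
      using near_optimal_response[OF \<gamma>t w'z' \<epsilon>] by blast
    have ag\<gamma>: "agree (r + d) (\<gamma> \<beta>) (\<gamma> (B' b))" by (rule strategies_agree[OF \<gamma> \<beta> B'c[OF b(1)] agB'[OF b(1)]])
    have "J x y w z (\<gamma> (B' b)) (B' b) = running x y w z (\<gamma> \<beta>) \<beta> r +
        exp (- lam * r) * J p q w' z' (shift r (\<gamma> (B' b))) (shift r (B' b))"
      unfolding p_def q_def using d agree_mono[OF ag\<gamma>] agree_mono[OF agB'[OF b(1)]] ag\<gamma> agB'[OF b(1)]
      by (intro cost_restart_agree[OF \<gamma>c[OF \<beta>] \<gamma>c[OF B'c[OF b(1)]] \<beta> B'c[OF b(1)] w z x y real sl]) auto
    then have J: "running x y w z (\<gamma> \<beta>) \<beta> r + exp (- lam * r) * J p q w' z' (\<gamma>t b) (shift r (B' b)) \<le> V x y w z + \<epsilon>"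
      using opt[OF B'c[OF b(1)]] by (simp add: \<gamma>t_def)
    have "Y.tracks T e b q z' (\<Phi> b0 b) q z'" by (rule Y.imitation_tracks[OF \<Phi> b0 b(1) d(3)])
    then have "Y.tracks T e b q z' (shift r (B' b)) q z'"
      by (rule Y.tracks_agree[OF _ agree_sym[OF shB'] Y.imitation_control[OF \<Phi> b0 b(1)]
            shift_control[OF B'c[OF b(1)] r0] w'z'(2) q0])
    then have "\<bar>J p q w' z' (\<gamma>t b) b - J p q w' z' (\<gamma>t b) (shift r (B' b))\<bar> \<le> \<epsilon>"
      using e by (intro near strategies_control[OF \<gamma>t] b(1) shift_control B'c r0 w'z' X.tracks_refl) auto
    then have "V p q w' z' \<le> J p q w' z' (\<gamma>t b) (shift r (B' b)) + 2 * \<epsilon>" using b(2) by linarith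
    then have "exp (- lam * r) * V p q w' z' \<le> exp (- lam * r) * (J p q w' z' (\<gamma>t b) (shift r (B' b)) + 2 * \<epsilon>)"
      by (intro mult_left_mono) auto
    also have "\<dots> \<le> exp (- lam * r) * J p q w' z' (\<gamma>t b) (shift r (B' b)) + 2 * \<epsilon>"
      using lam_pos r0 \<epsilon> by (simp add: distrib_left)
    finally show ?thesis unfolding switching_cost[OF real sl] using J by (simp add: p_def q_def)
  next
    case PInf
    then show ?thesis using never_switching_cost[OF PInf] opt[OF \<beta>] \<epsilon> by simp
  next
    case MInf
    then show ?thesis using X.exit_nonneg[OF w, of "\<gamma> \<beta>" x] Y.exit_nonneg[OF z, of \<beta> y]
      by (auto simp: min_def split: if_splits)
  qed
  then show ?thesis using \<gamma> by blast
qed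

theorem lower_value_switch:
  assumes w: "w \<in> {-1, 1}" and z: "z \<in> {-1, 1}"
    and x: "x \<in> closure (sector i \<rho> w)" and y: "y \<in> closure (sector j \<eta> z)"
  shows "V x y w z = (INF \<gamma>\<in>strategies B A. SUP \<beta>\<in>controls B. G x y w z (\<gamma> \<beta>) \<beta>)"
proof (rule antisym)
  have x: "0 \<le> X.depth w x" and y: "0 \<le> Y.depth z y"
    using x y X.closure_sector[OF w] Y.closure_sector[OF z] by auto
  have le: "V x y w z \<le> (SUP \<beta>\<in>controls B. G x y w z (\<gamma> \<beta>) \<beta>)" if "\<gamma> \<in> strategies B A" for \<gamma>
    by (rule lower_value_le_switch[OF w z x y that])
  then show "V x y w z \<le> (INF \<gamma>\<in>strategies B A. SUP \<beta>\<in>controls B. G x y w z (\<gamma> \<beta>) \<beta>)"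
    by (intro cINF_greatest strategies_nonempty)
  have bdd: "bdd_below ((\<lambda>\<gamma>. SUP \<beta>\<in>controls B. G x y w z (\<gamma> \<beta>) \<beta>) ` strategies B A)"
    using le by (intro bdd_belowI2[of _ "V x y w z"])
  show "(INF \<gamma>\<in>strategies B A. SUP \<beta>\<in>controls B. G x y w z (\<gamma> \<beta>) \<beta>) \<le> V x y w z"
  proof (rule field_le_epsilon)
    fix \<epsilon> :: real assume "0 < \<epsilon>"
    then obtain \<gamma> where \<gamma>: "\<gamma> \<in> strategies B A" and G: "\<And>\<beta>. \<beta> \<in> controls B \<Longrightarrow> G x y w z (\<gamma> \<beta>) \<beta> \<le> V x y w z + \<epsilon>"
      using switch_le_lower_value[OF w z x y, of "\<epsilon> / 3"] by auto
    have "(INF \<gamma>\<in>strategies B A. SUP \<beta>\<in>controls B. G x y w z (\<gamma> \<beta>) \<beta>) \<le> (SUP \<beta>\<in>controls B. G x y w z (\<gamma> \<beta>) \<beta>)"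
      by (rule cINF_lower[OF bdd \<gamma>])
    also have "\<dots> \<le> V x y w z + \<epsilon>" by (rule cSUP_least[OF controls_nonempty G])
    finally show "(INF \<gamma>\<in>strategies B A. SUP \<beta>\<in>controls B. G x y w z (\<gamma> \<beta>) \<beta>) \<le> V x y w z + \<epsilon>" .
  qed
qed

end

section \<open>Both values\<close>

lemma thermostatI:
  assumes "\<rho> (-1) < \<rho> 1" "regular_dynamics C f" "controllable i \<rho> C f"
  obtains M L where "thermostat i \<rho> C f M L"
proof -
  obtain M where bd: "\<forall>u\<in>(\<lambda>(x, w, a). f x w a) ` (UNIV \<times> {-1, 1} \<times> C). norm u \<le> M"
    using assms(2) unfolding regular_dynamics_def bounded_iff by blast
  have M: "norm (f x v a) \<le> M" if "v \<in> {-1, 1}" "a \<in> C" for x v a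
    by (rule bspec[OF bd], rule image_eqI[of _ _ "(x, v, a)"]) (use that in auto)
  obtain L where L: "\<And>v a. v \<in> {-1, 1} \<Longrightarrow> a \<in> C \<Longrightarrow> L-lipschitz_on UNIV (\<lambda>x. f x v a)"
    using assms(2) unfolding regular_dynamics_def by blast
  have "thermostat i \<rho> C f (max M 1) (max L 1)"
  proof
    show "norm (f x v a) \<le> max M 1" if "v \<in> {-1, 1}" "a \<in> C" for x v a
      using M[OF that, of x] by simp
    show "norm (f x v a - f y v a) \<le> max L 1 * norm (x - y)" if "v \<in> {-1, 1}" "a \<in> C" for x y v a
    proof -
      have "norm (f x v a - f y v a) \<le> L * norm (x - y)"
        using lipschitz_onD[OF L[OF that], of x y] by (simp add: dist_norm)
      also have "\<dots> \<le> max L 1 * norm (x - y)" by (intro mult_right_mono) auto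
      finally show ?thesis .
    qed
  qed (use assms in \<open>auto simp: regular_dynamics_def\<close>)
  then show ?thesis by (rule that)
qed

lemma regular_costE:
  assumes "regular_cost C k"
  obtains K where "0 \<le> K"
    "\<And>w z. w \<in> {-1, 1} \<Longrightarrow> z \<in> {-1, 1} \<Longrightarrow> continuous_on (UNIV \<times> C) (\<lambda>(p, c). k (fst p) (snd p) w z c)"
    "\<And>x y w z c. w \<in> {-1, 1} \<Longrightarrow> z \<in> {-1, 1} \<Longrightarrow> c \<in> C \<Longrightarrow> \<bar>k x y w z c\<bar> \<le> K"
    "\<And>x y x' y' w z c. w \<in> {-1, 1} \<Longrightarrow> z \<in> {-1, 1} \<Longrightarrow> c \<in> C \<Longrightarrow>
        \<bar>k x y w z c - k x' y' w z c\<bar> \<le> K * (norm (x - x') + norm (y - y'))"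
proof -
  obtain M where bd: "\<forall>u\<in>(\<lambda>(x, y, w, z, c). k x y w z c) ` (UNIV \<times> UNIV \<times> {-1, 1} \<times> {-1, 1} \<times> C). norm u \<le> M"
    using assms unfolding regular_cost_def bounded_iff by blast
  have M: "norm (k x y w z c) \<le> M" if "w \<in> {-1, 1}" "z \<in> {-1, 1}" "c \<in> C" for x y w z c
    by (rule bspec[OF bd], rule image_eqI[of _ _ "(x, y, w, z, c)"]) (use that in auto)
  obtain L where L: "\<And>w z c. w \<in> {-1, 1} \<Longrightarrow> z \<in> {-1, 1} \<Longrightarrow> c \<in> C \<Longrightarrow> L-lipschitz_on UNIV (\<lambda>(x, y). k x y w z c)"
    using assms unfolding regular_cost_def by blast
  have cont: "continuous_on (UNIV \<times> UNIV \<times> {-1, 1} \<times> {-1, 1} \<times> C) (\<lambda>(x, y, w, z, c). k x y w z c)"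
    using assms unfolding regular_cost_def by blast
  show ?thesis
  proof (rule that[of "max 0 (max M L)"])
    fix w z :: int assume wz: "w \<in> {-1, 1}" "z \<in> {-1, 1}"
    have "continuous_on (UNIV \<times> C) (\<lambda>pc. (\<lambda>(x, y, w, z, c). k x y w z c) (fst (fst pc), snd (fst pc), w, z, snd pc))"
      by (rule continuous_on_compose2[OF cont]) (use wz in \<open>auto intro!: continuous_intros\<close>)
    then show "continuous_on (UNIV \<times> C) (\<lambda>(p, c). k (fst p) (snd p) w z c)" by (simp add: split_def)
    fix x y c assume c: "c \<in> C"
    show "\<bar>k x y w z c\<bar> \<le> max 0 (max M L)" using M[OF wz c, of x y] by simp
    fix x' y'
    have "\<bar>k x y w z c - k x' y' w z c\<bar> \<le> L * dist (x, y) (x', y')"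
      using lipschitz_onD[OF L[OF wz c], of "(x, y)" "(x', y')"] by (simp add: dist_real_def)
    also have "\<dots> \<le> max 0 (max M L) * (norm (x - x') + norm (y - y'))"
      using norm_Pair_le[of "x - x'" "y - y'"] by (intro mult_mono) (auto simp: dist_norm)
    finally show "\<bar>k x y w z c - k x' y' w z c\<bar> \<le> max 0 (max M L) * (norm (x - x') + norm (y - y'))" .
  qed simp
qed

lemma continuous_on_swap_minus:
  fixes k :: "'s::topological_space \<Rightarrow> 't::topological_space \<Rightarrow> 'c::topological_space \<Rightarrow> real"
  assumes "continuous_on (UNIV \<times> D) (\<lambda>(p, c). k (fst p) (snd p) c)"
  shows "continuous_on (UNIV \<times> D) (\<lambda>(p, c). - k (snd p) (fst p) c)"
proof -
  have "continuous_on (UNIV \<times> D) (\<lambda>pc. (\<lambda>(p, c). k (fst p) (snd p) c) ((snd (fst pc), fst (fst pc)), snd pc))"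
    by (rule continuous_on_compose2[OF assms]) (auto intro!: continuous_intros)
  then have "continuous_on (UNIV \<times> D) (\<lambda>pc. - k (snd (fst pc)) (fst (fst pc)) (snd pc))"
    by (intro continuous_on_minus) simp
  then show ?thesis by (simp add: split_def)
qed

lemma real_INF_minus: "(INF x\<in>S. - h x) = - (SUP x\<in>S. h x)" for h :: "'s \<Rightarrow> real"
  by (simp add: Inf_real_def image_image)

lemma real_SUP_minus: "(SUP x\<in>S. - h x) = - (INF x\<in>S. h x)" for h :: "'s \<Rightarrow> real"
  by (simp add: Inf_real_def image_image)

text \<open>Exchanging the players and changing the sign of the running cost turns the upper value into
  minus the lower value.\<close>

lemma cost_swap:
  "cost j i \<eta> \<rho> g f (\<lambda>y x z w b a. - l x y w z a b) lam y x z w \<beta> \<alpha> = - cost i j \<rho> \<eta> f g l lam x y w z \<alpha> \<beta>"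
  by (simp add: cost_def set_lebesgue_integral_def)

lemma value_swap:
  "lower_value B A j i \<eta> \<rho> g f (\<lambda>y x z w b a. - l x y w z a b) lam y x z w =
    - upper_value A B i j \<rho> \<eta> f g l lam x y w z"
  unfolding lower_value_def upper_value_def cost_swap real_SUP_minus real_INF_minus ..

lemma cost_to_first_switch_swap:
  "cost_to_first_switch j i \<eta> \<rho> g f (\<lambda>y x z w b a. - l x y w z a b) lam (\<lambda>y x z w. - U x y w z) y x z w \<beta> \<alpha> =
    - cost_to_first_switch i j \<rho> \<eta> f g l lam U x y w z \<alpha> \<beta>"
proof -
  let ?S = "first_switch i \<rho> f \<alpha> x w" and ?T = "first_switch j \<eta> g \<beta> y z"
  have sw: "switched_label ?T ?S z w = prod.swap (switched_label ?S ?T w z)"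
    by (auto simp: switched_label_def)
  show ?thesis
    unfolding cost_to_first_switch_def Let_def min.commute[of ?T ?S] sw
    by (cases "switched_label ?S ?T w z") (simp add: set_lebesgue_integral_def)
qed

theorem proposition6:
  fixes A :: "'a::metric_space set" and B :: "'b::metric_space set"
    and i :: "'n::finite" and j :: "'m::finite"
    and \<rho> \<eta> :: "int \<Rightarrow> real"
    and f :: "real ^ 'n \<Rightarrow> int \<Rightarrow> 'a \<Rightarrow> real ^ 'n"
    and g :: "real ^ 'm \<Rightarrow> int \<Rightarrow> 'b \<Rightarrow> real ^ 'm"
    and l :: "real ^ 'n \<Rightarrow> real ^ 'm \<Rightarrow> int \<Rightarrow> int \<Rightarrow> 'a \<Rightarrow> 'b \<Rightarrow> real"
    and l1 :: "real ^ 'n \<Rightarrow> real ^ 'm \<Rightarrow> int \<Rightarrow> int \<Rightarrow> 'a \<Rightarrow> real"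
    and l2 :: "real ^ 'n \<Rightarrow> real ^ 'm \<Rightarrow> int \<Rightarrow> int \<Rightarrow> 'b \<Rightarrow> real"
    and lam :: real
    and w z :: int and x :: "real ^ 'n" and y :: "real ^ 'm"
  assumes "\<rho> (-1) < \<rho> 1" and "\<eta> (-1) < \<eta> 1"
    and "compact A" and "compact B"
    and "regular_dynamics A f" and "regular_dynamics B g"
    and "\<And>x y w z a b. w \<in> {-1, 1} \<Longrightarrow> z \<in> {-1, 1} \<Longrightarrow> a \<in> A \<Longrightarrow> b \<in> B \<Longrightarrow>
           l x y w z a b = l1 x y w z a + l2 x y w z b \<and> 0 \<le> l x y w z a b"
    and "regular_cost A l1" and "regular_cost B l2"
    and "0 < lam"
    and "controllable i \<rho> A f" and "controllable j \<eta> B g"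
    and "w \<in> {-1, 1}" and "z \<in> {-1, 1}"
    and "(x, y) \<in> closure (sector i \<rho> w) \<times> closure (sector j \<eta> z)"
  shows "lower_value A B i j \<rho> \<eta> f g l lam x y w z =
           (INF \<gamma>\<in>strategies B A. SUP \<beta>\<in>controls B.
              cost_to_first_switch i j \<rho> \<eta> f g l lam
                (lower_value A B i j \<rho> \<eta> f g l lam) x y w z (\<gamma> \<beta>) \<beta>) \<and>
         upper_value A B i j \<rho> \<eta> f g l lam x y w z =
           (SUP \<xi>\<in>strategies A B. INF \<alpha>\<in>controls A.
              cost_to_first_switch i j \<rho> \<eta> f g l lam
                (upper_value A B i j \<rho> \<eta> f g l lam) x y w z \<alpha> (\<xi> \<alpha>))"
proof
  obtain M1 L1 where X: "thermostat i \<rho> A f M1 L1" using thermostatI assms(1,5,11) by metis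
  obtain M2 L2 where Y: "thermostat j \<eta> B g M2 L2" using thermostatI assms(2,6,12) by metis
  obtain K1 where K1: "0 \<le> K1"
    "\<And>w z. w \<in> {-1, 1} \<Longrightarrow> z \<in> {-1, 1} \<Longrightarrow> continuous_on (UNIV \<times> A) (\<lambda>(p, a). l1 (fst p) (snd p) w z a)"
    "\<And>x y w z a. w \<in> {-1, 1} \<Longrightarrow> z \<in> {-1, 1} \<Longrightarrow> a \<in> A \<Longrightarrow> \<bar>l1 x y w z a\<bar> \<le> K1"
    "\<And>x y x' y' w z a. w \<in> {-1, 1} \<Longrightarrow> z \<in> {-1, 1} \<Longrightarrow> a \<in> A \<Longrightarrow>
        \<bar>l1 x y w z a - l1 x' y' w z a\<bar> \<le> K1 * (norm (x - x') + norm (y - y'))"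
    by (rule regular_costE[OF assms(8)]) blast
  obtain K2 where K2: "0 \<le> K2"
    "\<And>w z. w \<in> {-1, 1} \<Longrightarrow> z \<in> {-1, 1} \<Longrightarrow> continuous_on (UNIV \<times> B) (\<lambda>(p, b). l2 (fst p) (snd p) w z b)"
    "\<And>x y w z b. w \<in> {-1, 1} \<Longrightarrow> z \<in> {-1, 1} \<Longrightarrow> b \<in> B \<Longrightarrow> \<bar>l2 x y w z b\<bar> \<le> K2"
    "\<And>x y x' y' w z b. w \<in> {-1, 1} \<Longrightarrow> z \<in> {-1, 1} \<Longrightarrow> b \<in> B \<Longrightarrow>
        \<bar>l2 x y w z b - l2 x' y' w z b\<bar> \<le> K2 * (norm (x - x') + norm (y - y'))"
    by (rule regular_costE[OF assms(9)]) blast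
  have split: "l x y w z a b = l1 x y w z a + l2 x y w z b"
    if "w \<in> {-1, 1}" "z \<in> {-1, 1}" "a \<in> A" "b \<in> B" for x y w z a b
    using assms(7)[OF that] by blast
  have bound: "\<bar>l x y w z a b\<bar> \<le> K1 + K2"
    if "w \<in> {-1, 1}" "z \<in> {-1, 1}" "a \<in> A" "b \<in> B" for x y w z a b
    using K1(3)[OF that(1-3), of x y] K2(3)[OF that(1,2,4), of x y] unfolding split[OF that] by linarith
  have lips: "\<bar>l x y w z a b - l x' y' w z a b\<bar> \<le> (K1 + K2) * (norm (x - x') + norm (y - y'))"
    if "w \<in> {-1, 1}" "z \<in> {-1, 1}" "a \<in> A" "b \<in> B" for x y x' y' w z a b
    using K1(4)[OF that(1-3), of x y x' y'] K2(4)[OF that(1,2,4), of x y x' y']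
    unfolding split[OF that] distrib_right by linarith
  have dom: "x \<in> closure (sector i \<rho> w)" "y \<in> closure (sector j \<eta> z)" using assms(15) by auto
  interpret G: switching_game i \<rho> A f M1 L1 j \<eta> B g M2 L2 l l1 l2 lam "K1 + K2" "K1 + K2"
    by (intro switching_game.intro switching_game_axioms.intro X Y split K1(2) K2(2) bound lips assms(10) add_nonneg_nonneg K1(1) K2(1))
  show "lower_value A B i j \<rho> \<eta> f g l lam x y w z =
     (INF \<gamma>\<in>strategies B A. SUP \<beta>\<in>controls B.
        cost_to_first_switch i j \<rho> \<eta> f g l lam (lower_value A B i j \<rho> \<eta> f g l lam) x y w z (\<gamma> \<beta>) \<beta>)"
    by (rule G.lower_value_switch[OF assms(13,14) dom])
  have swapped: "switching_game_axioms B A (\<lambda>y x z w b a. - l x y w z a b)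
      (\<lambda>y x z w b. - l2 x y w z b) (\<lambda>y x z w a. - l1 x y w z a) lam (K1 + K2) (K1 + K2)"
  proof
    fix z w :: int assume wz: "z \<in> {-1, 1}" "w \<in> {-1, 1}"
    show "continuous_on (UNIV \<times> B) (\<lambda>(p, b). - l2 (snd p) (fst p) w z b)"
      by (rule continuous_on_swap_minus[OF K2(2)[OF wz(2,1)]])
    show "continuous_on (UNIV \<times> A) (\<lambda>(p, a). - l1 (snd p) (fst p) w z a)"
      by (rule continuous_on_swap_minus[OF K1(2)[OF wz(2,1)]])
    fix b a assume ba: "b \<in> B" "a \<in> A"
    fix y x
    show "- l x y w z a b = - l2 x y w z b + - l1 x y w z a" using split[OF wz(2,1) ba(2,1)] by simp
    show "\<bar>- l x y w z a b\<bar> \<le> K1 + K2" using bound[OF wz(2,1) ba(2,1)] by simp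
    fix y' x'
    show "\<bar>- l x y w z a b - - l x' y' w z a b\<bar> \<le> (K1 + K2) * (norm (y - y') + norm (x - x'))"
      using lips[OF wz(2,1) ba(2,1), of x y x' y'] by (simp add: add.commute abs_minus_commute)
  qed (use assms(10) K1 K2 in auto)
  interpret H: switching_game j \<eta> B g M2 L2 i \<rho> A f M1 L1 "\<lambda>y x z w b a. - l x y w z a b"
    "\<lambda>y x z w b. - l2 x y w z b" "\<lambda>y x z w a. - l1 x y w z a" lam "K1 + K2" "K1 + K2"
    by (intro switching_game.intro X Y swapped)
  show "upper_value A B i j \<rho> \<eta> f g l lam x y w z =
     (SUP \<xi>\<in>strategies A B. INF \<alpha>\<in>controls A.
        cost_to_first_switch i j \<rho> \<eta> f g l lam (upper_value A B i j \<rho> \<eta> f g l lam) x y w z \<alpha> (\<xi> \<alpha>))"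
    using H.lower_value_switch[OF assms(14,13) dom(2,1)]
    unfolding value_swap[abs_def] value_swap cost_to_first_switch_swap real_SUP_minus real_INF_minus neg_equal_iff_equal .
qed

end
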